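(* Let $v:\mathbb R^3\to\mathbb R^3$ and $p:\mathbb R^3\to\mathbb R$ be smooth functions solving the steady Navier-Stokes equations on $\mathbb R^3$: $$(v\cdot\nabla)v=-\nabla p+\Delta v,\qquad \operatorname{div} v=0.$$ Suppose that $$\lim_{|x|\to\infty}v(x)=0\qquad\text{and}\qquad \int_{\mathbb R^3}|\Delta v|^{6/5}\,dx<\infty.$$ Then $v=0$ on $\mathbb R^3$.
   Context: $(v\cdot\nabla)v$ is the vector field with components $\sum_{j=1}^3 v_j\partial_j v_i$, and $\Delta v$ is the componentwise Laplacian. No decay condition is imposed on the pressure $p$. *)

theory Defs
  imports "HOL-Analysis.Analysis"
begin

text \<open>\<^const>\<open>frechet_derivative\<close> is a choice operator, so the following is meaningful only
  where \<open>f\<close> is differentiable; \<open>smooth\<close> below makes this explicit at every order.\<close>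

definition partial :: "'n::finite \<Rightarrow> (real ^ 'n \<Rightarrow> 'b::real_normed_vector) \<Rightarrow> real ^ 'n \<Rightarrow> 'b" where
  "partial j f x = frechet_derivative f (at x) (axis j 1)"

primrec C_k :: "nat \<Rightarrow> (real ^ 'n::finite \<Rightarrow> 'b::real_normed_vector) \<Rightarrow> bool" where
  "C_k 0 f \<longleftrightarrow> continuous_on UNIV f"
| "C_k (Suc k) f \<longleftrightarrow> (\<forall>x. f differentiable (at x)) \<and> (\<forall>j. C_k k (partial j f))"

definition smooth :: "(real ^ 'n::finite \<Rightarrow> 'b::real_normed_vector) \<Rightarrow> bool" where
  "smooth f \<longleftrightarrow> (\<forall>k. C_k k f)"

definition grad :: "(real ^ 'n::finite \<Rightarrow> real) \<Rightarrow> real ^ 'n \<Rightarrow> real ^ 'n" where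
  "grad p x = (\<chi> i. partial i p x)"

definition divergence :: "(real ^ 'n::finite \<Rightarrow> real ^ 'n) \<Rightarrow> real ^ 'n \<Rightarrow> real" where
  "divergence v x = (\<Sum>i\<in>UNIV. partial i (\<lambda>y. v y $ i) x)"

definition laplacian :: "(real ^ 'n::finite \<Rightarrow> real) \<Rightarrow> real ^ 'n \<Rightarrow> real" where
  "laplacian f x = (\<Sum>j\<in>UNIV. partial j (partial j f) x)"

definition vector_laplacian :: "(real ^ 'n::finite \<Rightarrow> real ^ 'm::finite) \<Rightarrow> real ^ 'n \<Rightarrow> real ^ 'm" where
  "vector_laplacian v x = (\<chi> i. laplacian (\<lambda>y. v y $ i) x)"

text \<open>\<open>convective v w\<close> is the field $(v\cdot\nabla)w$.\<close>

definition convective ::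
  "(real ^ 'n::finite \<Rightarrow> real ^ 'n) \<Rightarrow> (real ^ 'n \<Rightarrow> real ^ 'm::finite) \<Rightarrow> real ^ 'n \<Rightarrow> real ^ 'm" where
  "convective v w x = (\<chi> i. \<Sum>j\<in>UNIV. v x $ j * partial j (\<lambda>y. w y $ i) x)"

definition steady_navier_stokes ::
  "(real ^ 'n::finite \<Rightarrow> real ^ 'n) \<Rightarrow> (real ^ 'n \<Rightarrow> real) \<Rightarrow> bool" where
  "steady_navier_stokes v p \<longleftrightarrow>
     (\<forall>x. convective v v x = - grad p x + vector_laplacian v x) \<and> (\<forall>x. divergence v x = 0)"

end

theory Submission
  imports Defs
begin

text \<open>Testing the equation for a component \<open>u\<close> of \<open>v\<close> with a truncation of \<open>u\<close>, which has compact
  support because \<open>v\<close> vanishes at infinity, the Sobolev inequality turns \<open>\<Delta>v \<in> L\<^sup>6\<^sup>/\<^sup>5\<close> into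
  \<open>v \<in> L\<^sup>6\<close> and \<open>\<nabla>v \<in> L\<^sup>2\<close>. Hence \<open>v \<cdot> \<Delta>v\<close> is integrable, and its integral is minus that of
  \<open>\<bar>\<nabla>v\<bar>\<^sup>2\<close>. The head pressure \<open>Q = \<bar>v\<bar>\<^sup>2/2 + p\<close> satisfies \<open>v \<cdot> \<nabla>Q = v \<cdot> \<Delta>v\<close>, so it remains to see
  that the integral of \<open>v \<cdot> \<nabla>Q\<close> is 0. On the surfaces of suitable cubes with sides tending to infinity
  the integral of \<open>\<bar>\<nabla>Q\<bar>\<close> tends to 0. By a Poincare inequality on the two-dimensional surface, \<open>Q\<close> is
  there \<open>L\<^sup>2\<close>-close to a constant \<open>c\<close>. For a function \<open>H\<close> with \<open>\<bar>H(s)\<bar> \<le> s\<^sup>2/\<lambda>\<close>, the flux of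
  \<open>H(Q - c) v\<close> through the surface is therefore small, although that of \<open>(Q - c) v\<close> need not be. Letting
  \<open>H'\<close> tend to 1 away from 0, and treating the level sets of \<open>Q\<close> separately, gives the claim. No
  decay of \<open>p\<close> is needed because \<open>c\<close> may vary with the cube.\<close>

section \<open>Coordinates, cubes and fluxes\<close>

text \<open>The surface estimate is scale-critical. Finiteness of the integral of |v|^6 +
  |\<nabla>v|^2 + |\<Delta>v|^(6/5) gives large cubes on whose surface it integrates to less than
  \<epsilon>/r. Hoelder's inequality for |v| |\<nabla>v| on an area of order r^2 then gives
  (\<epsilon>/r)^(2/3) (r^2)^(1/3): the powers of r cancel, with no rate to spare. This is why the
  flux of (Q - c) v is out of reach: Q - c is small only in L^2, and Cauchy-Schwarz against the area
  costs a factor r, which decay of v without a rate does not pay for. A quadratic H never meets the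
  area. The price is H'(0) = 0, so points where Q is close to c are missed; if the constants
  converge, a level set of Q remains in the limit. On a level set the gradient of Q vanishes almost
  everywhere, so nothing should be lost there; this is obtained from the flux of a function bounded
  by \<lambda> through a fixed cube. Cubes instead of balls turn all surface integrals into
  integrals over squares, for which Fubini and the fundamental theorem of calculus suffice.\<close>

lemma cyclic3_distinct [simp]:
  fixes i :: 3
  shows "i \<noteq> i + 1" "i \<noteq> i + 2" "i + 1 \<noteq> i + 2"
    "i + 1 \<noteq> i" "i + 2 \<noteq> i" "i + 2 \<noteq> i + 1"
    "i + 1 + 1 = i + 2" "i + 1 + 2 = i" "i + 2 + 1 = i" "i + 2 + 2 = i + 1"
  by (simp_all add: add.assoc)

lemma UNIV_cyclic3: "(UNIV :: 3 set) = {i, i + 1, i + 2}" for i :: 3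
  by (rule card_subset_eq[symmetric]) auto

lemma sum_cyclic3: "(\<Sum>j\<in>UNIV. f j) = f i + (f (i + 1) + f (i + 2))" for i :: 3 and f :: "3 \<Rightarrow> 'a::comm_monoid_add"
  by (subst UNIV_cyclic3[of i]) simp

lemma prod_cyclic3: "(\<Prod>j\<in>UNIV. f j) = f i * (f (i + 1) * f (i + 2))" for i :: 3 and f :: "3 \<Rightarrow> 'a::comm_monoid_mult"
  by (subst UNIV_cyclic3[of i]) simp

lemma all_cyclic3: "(\<forall>j. P j) \<longleftrightarrow> P i \<and> P (i + 1) \<and> P (i + 2)" for i :: 3
proof -
  have "(\<forall>j. P j) \<longleftrightarrow> (\<forall>j\<in>{i, i + 1, i + 2}. P j)"
    by (metis UNIV_I UNIV_cyclic3)
  then show ?thesis by simp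
qed

text \<open>The coordinates of \<open>\<real>\<^sup>3\<close> are used cyclically (the numeral type 3 is the ring of integers mod 3), so
  that one argument serves all three directions.\<close>

definition pt :: "3 \<Rightarrow> real \<Rightarrow> real \<times> real \<Rightarrow> real ^ 3" where
  "pt i x q = x *\<^sub>R axis i 1 + fst q *\<^sub>R axis (i + 1) 1 + snd q *\<^sub>R axis (i + 2) 1"

lemma pt_nth [simp]: "pt i x q $ i = x" "pt i x q $ (i + 1) = fst q" "pt i x q $ (i + 2) = snd q"
  unfolding pt_def by (auto simp: axis_def)

lemma pt_eqI: "y $ i = x \<Longrightarrow> y $ (i + 1) = fst q \<Longrightarrow> y $ (i + 2) = snd q \<Longrightarrow> y = pt i x q"
  unfolding vec_eq_iff using all_cyclic3[of "\<lambda>j. y $ j = pt i x q $ j" i] by simp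

lemma pt_coords: "pt i (x $ i) (x $ (i + 1), x $ (i + 2)) = x"
  by (rule pt_eqI[symmetric]) auto

text \<open>The pair lists the other two coordinates in cyclic order, which is why \<open>z\<close>
  precedes \<open>x\<close>. Together with \<open>pt_shift2\<close> this lets a line in direction
  \<open>i + 1\<close> or \<open>i + 2\<close> be read in the coordinates of direction
  \<open>i\<close>.\<close>

lemma pt_shift1: "pt (i + 1) y (z, x) = pt i x (y, z)"
  using pt_nth[of "i + 1" y "(z, x)"] by (intro pt_eqI) simp_all

lemma pt_shift2: "pt (i + 2) z (x, y) = pt i x (y, z)"
  using pt_nth[of "i + 2" z "(x, y)"] by (intro pt_eqI) simp_all

lemma pt_add: "pt i (x + t) q = pt i x q + t *\<^sub>R axis i 1"
  unfolding pt_def by (simp add: algebra_simps)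

lemma continuous_on_pt [continuous_intros]:
  "continuous_on S f \<Longrightarrow> continuous_on S g \<Longrightarrow> continuous_on S (\<lambda>x. pt i (f x) (g x))"
  unfolding pt_def by (intro continuous_intros)

lemma measurable_pt [measurable]:
  assumes "f \<in> borel_measurable M" "g \<in> borel_measurable M"
  shows "(\<lambda>x. pt i (f x) (g x)) \<in> borel_measurable M"
proof -
  have *: "(\<lambda>p. pt i (fst p) (snd p)) \<in> borel_measurable borel"
    by (intro borel_measurable_continuous_onI continuous_intros)
  have "(\<lambda>x. (f x, g x)) \<in> borel_measurable M"
    using assms by (simp flip: borel_prod)
  from measurable_compose[OF this *] show ?thesis
    by simp
qed

lemma measurable_pt_pair [measurable]:
  "(\<lambda>p. pt i (fst p) (snd p)) \<in> borel_measurable (borel :: (real \<times> (real \<times> real)) measure)"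
  by (intro borel_measurable_continuous_onI continuous_intros)

lemma measurable_pt_prod [measurable]:
  "(\<lambda>(x, q). pt i x q) \<in> borel_measurable (borel :: (real \<times> (real \<times> real)) measure)"
  unfolding split_beta by (intro borel_measurable_continuous_onI continuous_intros)

section \<open>Lebesgue integration in cyclic coordinates\<close>

lemma prod_Basis_cart: "(\<Prod>b\<in>Basis. f b) = (\<Prod>i\<in>UNIV. f (axis i (1::real)))" for f :: "real ^ 'n::finite \<Rightarrow> real"
proof -
  have "(Basis :: (real ^ 'n) set) = (\<lambda>i. axis i 1) ` UNIV"
    by (auto simp: Basis_vec_def)
  moreover have "inj (\<lambda>i::'n. axis i (1::real))"
    by (auto simp: inj_on_def axis_eq_axis)
  ultimately show ?thesis
    by (metis (no_types, lifting) prod.reindex_cong)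
qed

text \<open>Lebesgue measure is determined by its values on open boxes, and the preimage of a box
  under \<open>pt i\<close> is the box with its sides permuted.\<close>

lemma lborel_pt: "distr lborel borel (\<lambda>(x, q). pt i x q) = lborel"
proof (rule lborel_eqI[symmetric])
  fix l u :: "real ^ 3"
  assume le: "\<And>b. b \<in> Basis \<Longrightarrow> l \<bullet> b \<le> u \<bullet> b"
  have lu: "l $ j \<le> u $ j" for j
    using le[of "axis j 1"] by (simp add: inner_axis axis_in_Basis_iff)
  have Times: "emeasure lborel (A \<times> B) = emeasure lborel A * emeasure lborel B"
    if "A \<in> sets borel" "B \<in> sets borel" for A :: "'a::euclidean_space set" and B :: "'b::euclidean_space set"
    using lborel.emeasure_pair_measure_Times[of A lborel B] that by (simp add: lborel_prod)
  have "(\<lambda>(x, q). pt i x q) -` box l u = {l $ i <..< u $ i} \<times> {l $ (i + 1) <..< u $ (i + 1)} \<times> {l $ (i + 2) <..< u $ (i + 2)}"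
    by (auto simp: mem_box_cart all_cyclic3[of _ i])
  then have "emeasure (distr lborel borel (\<lambda>(x, q). pt i x q)) (box l u)
     = emeasure lborel ({l $ i <..< u $ i} \<times> {l $ (i + 1) <..< u $ (i + 1)} \<times> {l $ (i + 2) <..< u $ (i + 2)})"
    by (subst emeasure_distr) simp_all
  also have "\<dots> = ennreal ((u - l) $ i * ((u - l) $ (i + 1) * (u - l) $ (i + 2)))"
    using lu by (simp add: Times borel_Times ennreal_mult)
  also have "\<dots> = (\<Prod>b\<in>Basis. (u - l) \<bullet> b)"
    by (simp add: prod_Basis_cart inner_axis prod_cyclic3[of _ i])
  finally show "emeasure (distr lborel borel (\<lambda>(x, q). pt i x q)) (box l u) = (\<Prod>b\<in>Basis. (u - l) \<bullet> b)" .
qed simp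

lemma nn_integral_pt_pair:
  assumes [measurable]: "f \<in> borel_measurable borel"
  shows "(\<integral>\<^sup>+x. f x \<partial>lborel) = (\<integral>\<^sup>+x. \<integral>\<^sup>+q. f (pt i x q) \<partial>lborel \<partial>lborel)"
proof -
  have "(\<integral>\<^sup>+x. f x \<partial>lborel) = (\<integral>\<^sup>+x. f x \<partial>distr lborel borel (\<lambda>(x, q). pt i x q))"
    by (simp add: lborel_pt)
  also have "\<dots> = (\<integral>\<^sup>+p. f (pt i (fst p) (snd p)) \<partial>(lborel \<Otimes>\<^sub>M lborel))"
    by (subst nn_integral_distr) (simp_all add: lborel_prod split_beta)
  also have "\<dots> = (\<integral>\<^sup>+x. \<integral>\<^sup>+q. f (pt i x q) \<partial>lborel \<partial>lborel)"
    by (subst lborel.nn_integral_fst[symmetric]) (simp_all add: lborel_prod)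
  finally show ?thesis .
qed

lemma nn_integral_plane:
  fixes f :: "real \<times> real \<Rightarrow> ennreal"
  assumes [measurable]: "f \<in> borel_measurable borel"
  shows "(\<integral>\<^sup>+q. f q \<partial>lborel) = (\<integral>\<^sup>+y. \<integral>\<^sup>+z. f (y, z) \<partial>lborel \<partial>lborel)"
    and "(\<integral>\<^sup>+q. f q \<partial>lborel) = (\<integral>\<^sup>+z. \<integral>\<^sup>+y. f (y, z) \<partial>lborel \<partial>lborel)"
  by (subst lborel_prod[symmetric], subst lborel.nn_integral_fst[symmetric]; simp add: lborel_prod)
     (subst lborel_prod[symmetric], subst lborel_pair.nn_integral_snd[symmetric]; simp add: lborel_prod)

lemma lborel_integral_pt_pair:
  fixes f :: "real ^ 3 \<Rightarrow> real"
  assumes f: "integrable lborel f"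
  shows "integrable lborel (\<lambda>q. \<integral>x. f (pt i x q) \<partial>lborel)"
    and "(\<integral>x. f x \<partial>lborel) = (\<integral>q. \<integral>x. f (pt i x q) \<partial>lborel \<partial>lborel)"
proof -
  have [measurable]: "f \<in> borel_measurable borel"
    using f by auto
  have "integrable (distr lborel borel (\<lambda>(x, q). pt i x q)) f"
    using f by (simp add: lborel_pt)
  then have int: "integrable (lborel \<Otimes>\<^sub>M lborel) (case_prod (\<lambda>x q. f (pt i x q)))"
    by (subst (asm) integrable_distr_eq) (simp_all add: lborel_prod split_def measurable_pt_prod[unfolded split_def])
  show "integrable lborel (\<lambda>q. \<integral>x. f (pt i x q) \<partial>lborel)"
    using lborel_pair.integrable_snd[OF int] .
  have "(\<integral>x. f x \<partial>lborel) = (\<integral>x. f x \<partial>distr lborel borel (\<lambda>(x, q). pt i x q))"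
    by (simp add: lborel_pt)
  also have "\<dots> = (\<integral>p. f (pt i (fst p) (snd p)) \<partial>(lborel \<Otimes>\<^sub>M lborel))"
    by (subst integral_distr) (simp_all add: lborel_prod split_beta)
  also have "\<dots> = (\<integral>q. \<integral>x. f (pt i x q) \<partial>lborel \<partial>lborel)"
    using lborel_pair.integral_snd[OF int] by (simp add: split_def)
  finally show "(\<integral>x. f x \<partial>lborel) = (\<integral>q. \<integral>x. f (pt i x q) \<partial>lborel \<partial>lborel)" .
qed

section \<open>Cubes, integrals over their surfaces and the divergence theorem\<close>

definition cube :: "real \<Rightarrow> (real ^ 3) set" where
  "cube r = {x. \<forall>i. \<bar>x $ i\<bar> \<le> r}"

lemma cube_eq_cbox: "cube r = cbox (\<chi> i. - r) (\<chi> i. r)"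
  unfolding cube_def by (auto simp: mem_box_cart abs_le_iff minus_le_iff)

lemma compact_cube [simp]: "compact (cube r)"
  by (simp add: cube_eq_cbox)

lemma sets_cube [measurable, simp]: "cube r \<in> sets borel"
  by (simp add: cube_eq_cbox)

definition square :: "real \<Rightarrow> (real \<times> real) set" where
  "square r = {-r..r} \<times> {-r..r}"

lemma compact_square [simp]: "compact (square r)"
  unfolding square_def by (intro compact_Times compact_Icc)

lemma sets_square [measurable, simp]: "square r \<in> sets borel"
  by (simp add: borel_compact)

lemma pt_in_cube: "pt i x q \<in> cube r \<longleftrightarrow> x \<in> {-r..r} \<and> q \<in> square r"
  by (cases q) (auto simp: cube_def square_def all_cyclic3[of _ i] abs_le_iff)

definition face :: "real \<Rightarrow> 3 \<Rightarrow> real \<Rightarrow> (real ^ 3 \<Rightarrow> real) \<Rightarrow> ennreal" where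
  "face r i s g = (\<integral>\<^sup>+q. ennreal (g (pt i s q)) * indicator (square r) q \<partial>lborel)"

text \<open>The surface integral of \<open>g\<close> over the boundary of \<open>cube r\<close>; negative values of \<open>g\<close> count as 0,
  since \<open>ennreal\<close> truncates.\<close>

definition surf :: "real \<Rightarrow> (real ^ 3 \<Rightarrow> real) \<Rightarrow> ennreal" where
  "surf r g = (\<Sum>i\<in>UNIV. face r i r g + face r i (- r) g)"

text \<open>A relation rather than the operator \<open>partial\<close>: derivatives are carried
  explicitly, and the rules of one-variable calculus apply along each coordinate line.\<close>

definition has_partial :: "3 \<Rightarrow> (real ^ 3 \<Rightarrow> real) \<Rightarrow> (real ^ 3 \<Rightarrow> real) \<Rightarrow> bool" where
  "has_partial i F F' \<longleftrightarrow> (\<forall>x. ((\<lambda>t. F (x + t *\<^sub>R axis i 1)) has_real_derivative F' x) (at 0))"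

lemma has_partial_pt:
  assumes "has_partial i F F'"
  shows "((\<lambda>t. F (pt i t q)) has_real_derivative F' (pt i s q)) (at s)"
proof -
  have "((\<lambda>t. F (pt i s q + t *\<^sub>R axis i 1)) has_real_derivative F' (pt i s q)) (at (s + (- s)))"
    using assms by (simp add: has_partial_def)
  then have "((\<lambda>t. F (pt i s q + (t + (- s)) *\<^sub>R axis i 1)) has_real_derivative F' (pt i s q)) (at s)"
    by (subst (asm) DERIV_shift)
  then show ?thesis
    by (simp add: pt_add[symmetric])
qed

lemma integrable_on_cube:
  fixes f :: "real ^ 3 \<Rightarrow> real"
  assumes "continuous_on UNIV f"
  shows "integrable lborel (\<lambda>x. f x * indicator (cube r) x)"
  using borel_integrable_compact[of "cube r" f] assms
  by (auto simp: mult.commute intro: continuous_on_subset)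

lemma flux_bound:
  assumes "has_partial i F F'" and cont: "continuous_on UNIV F" "continuous_on UNIV F'" and r: "0 \<le> r"
  shows "ennreal \<bar>\<integral>x. F' x * indicator (cube r) x \<partial>lborel\<bar>
    \<le> face r i r (\<lambda>x. \<bar>F x\<bar>) + face r i (- r) (\<lambda>x. \<bar>F x\<bar>)"
proof -
  have [measurable]: "F \<in> borel_measurable borel"  "F' \<in> borel_measurable borel"
    using cont by (auto intro: borel_measurable_continuous_onI)
  have int: "integrable lborel (\<lambda>x. F' x * indicator (cube r) x)"
    by (rule integrable_on_cube) fact
  have inner: "(\<integral>x. F' (pt i x q) * indicator (cube r) (pt i x q) \<partial>lborel)
      = (F (pt i r q) - F (pt i (- r) q)) * indicator (square r) q" for q
  proof -
    have "(\<integral>x. F' (pt i x q) * indicator {- r..r} x \<partial>lborel) = F (pt i r q) - F (pt i (- r) q)"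
    proof (rule integral_FTC_Icc_real)
      fix x
      show "((\<lambda>x. F (pt i x q)) has_real_derivative F' (pt i x q)) (at x)"
        using has_partial_pt[OF assms(1)] .
      have "continuous_on UNIV (\<lambda>x. F' (pt i x q))"
        by (intro continuous_on_compose2[OF cont(2)] continuous_intros) auto
      then show "isCont (\<lambda>x. F' (pt i x q)) x"
        by (simp add: continuous_on_eq_continuous_at)
    qed (use r in auto)
    moreover have "(\<lambda>x. F' (pt i x q) * indicator (cube r) (pt i x q))
        = (\<lambda>x. F' (pt i x q) * indicator {- r..r} x * indicator (square r) q)"
      by (auto simp: pt_in_cube indicator_def)
    ultimately show ?thesis
      by (simp only: Bochner_Integration.integral_mult_left_zero)
  qed
  have "ennreal \<bar>\<integral>x. F' x * indicator (cube r) x \<partial>lborel\<bar>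
     = ennreal (norm (\<integral>q. (F (pt i r q) - F (pt i (- r) q)) * indicator (square r) q \<partial>lborel))"
    by (subst lborel_integral_pt_pair(2)[OF int, of i]) (simp add: inner)
  also have "\<dots> \<le> (\<integral>\<^sup>+q. norm ((F (pt i r q) - F (pt i (- r) q)) * indicator (square r) q) \<partial>lborel)"
    using lborel_integral_pt_pair(1)[OF int, of i] by (intro integral_norm_bound_ennreal) (simp add: inner)
  also have "\<dots> \<le> (\<integral>\<^sup>+q. ennreal \<bar>F (pt i r q)\<bar> * indicator (square r) q
       + ennreal \<bar>F (pt i (- r) q)\<bar> * indicator (square r) q \<partial>lborel)"
    by (intro nn_integral_mono) (auto simp: indicator_def simp flip: ennreal_plus intro!: ennreal_leI)
  also have "\<dots> = face r i r (\<lambda>x. \<bar>F x\<bar>) + face r i (- r) (\<lambda>x. \<bar>F x\<bar>)"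
    unfolding face_def by (intro nn_integral_add) measurable
  finally show ?thesis .
qed

text \<open>On a face only the normal component contributes, so one majorant \<open>g\<close> of all
  components bounds the total flux, and the signs of the normals never enter.\<close>

lemma divergence_bound:
  assumes part: "\<And>i. has_partial i (F i) (F' i)"
    and cont: "\<And>i. continuous_on UNIV (F i)" "\<And>i. continuous_on UNIV (F' i)" and r: "0 \<le> r"
    and bound: "\<And>i x. \<bar>F i x\<bar> \<le> g x"
  shows "ennreal \<bar>\<integral>x. (\<Sum>i\<in>UNIV. F' i x) * indicator (cube r) x \<partial>lborel\<bar> \<le> surf r g"
proof -
  have "(\<integral>x. (\<Sum>i\<in>UNIV. F' i x) * indicator (cube r) x \<partial>lborel)
      = (\<Sum>i\<in>UNIV. \<integral>x. F' i x * indicator (cube r) x \<partial>lborel)"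
    unfolding sum_distrib_right
    by (intro Bochner_Integration.integral_sum integrable_on_cube cont)
  then have "ennreal \<bar>\<integral>x. (\<Sum>i\<in>UNIV. F' i x) * indicator (cube r) x \<partial>lborel\<bar>
     \<le> ennreal (\<Sum>i\<in>UNIV. \<bar>\<integral>x. F' i x * indicator (cube r) x \<partial>lborel\<bar>)"
    by (simp add: ennreal_leI sum_abs)
  also have "\<dots> = (\<Sum>i\<in>UNIV. ennreal \<bar>\<integral>x. F' i x * indicator (cube r) x \<partial>lborel\<bar>)"
    by simp
  also have "\<dots> \<le> (\<Sum>i\<in>UNIV. face r i r (\<lambda>x. \<bar>F i x\<bar>) + face r i (- r) (\<lambda>x. \<bar>F i x\<bar>))"
    by (intro sum_mono flux_bound part cont r)
  also have "\<dots> \<le> surf r g"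
    unfolding surf_def face_def using bound
    by (intro sum_mono add_mono nn_integral_mono mult_right_mono ennreal_leI) auto
  finally show ?thesis .
qed

lemma face_mono: "(\<And>x. f x \<le> g x) \<Longrightarrow> face r i s f \<le> face r i s g"
  unfolding face_def by (intro nn_integral_mono mult_right_mono ennreal_leI) auto

lemma surf_mono: "(\<And>x. f x \<le> g x) \<Longrightarrow> surf r f \<le> surf r g"
  unfolding surf_def by (intro sum_mono add_mono face_mono) auto

lemma face_const:
  assumes "0 \<le> r" "0 \<le> c"
  shows "face r i s (\<lambda>x. c) = ennreal (4 * r\<^sup>2 * c)"
proof -
  have "emeasure lborel (square r) = ennreal (4 * r\<^sup>2)"
  proof -
    have "emeasure (lborel \<Otimes>\<^sub>M lborel) (square r) = ennreal (2 * r) * ennreal (2 * r)"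
      unfolding square_def using assms by (subst lborel.emeasure_pair_measure_Times) auto
    then show ?thesis
      using assms by (simp add: lborel_prod power2_eq_square flip: ennreal_mult)
  qed
  then show ?thesis
    using assms unfolding face_def by (simp add: nn_integral_cmult ennreal_mult mult.commute)
qed

lemma surf_const:
  assumes "0 \<le> r" "0 \<le> c"
  shows "surf r (\<lambda>x. c) = ennreal (24 * r\<^sup>2 * c)"
  unfolding surf_def sum_cyclic3[of _ 1] using assms by (simp add: face_const flip: ennreal_plus)

lemma surf_add:
  assumes [measurable]: "f \<in> borel_measurable borel" "g \<in> borel_measurable borel"
    and "\<And>x. 0 \<le> f x" "\<And>x. 0 \<le> g x"
  shows "surf r (\<lambda>x. f x + g x) = surf r f + surf r g"
proof -
  have "face r i s (\<lambda>x. f x + g x) = face r i s f + face r i s g" for i s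
    unfolding face_def using assms
    by (subst nn_integral_add[symmetric]) (auto simp: distrib_right ennreal_plus intro!: nn_integral_cong)
  then show ?thesis
    unfolding surf_def by (simp add: sum.distrib algebra_simps)
qed

lemma surf_cmult:
  assumes [measurable]: "f \<in> borel_measurable borel" and "0 \<le> c" "\<And>x. 0 \<le> f x"
  shows "surf r (\<lambda>x. c * f x) = ennreal c * surf r f"
proof -
  have "face r i s (\<lambda>x. c * f x) = ennreal c * face r i s f" for i s
    unfolding face_def using assms
    by (subst nn_integral_cmult[symmetric]) (auto simp: ennreal_mult mult.assoc intro!: nn_integral_cong)
  then show ?thesis
    unfolding surf_def by (simp add: sum_distrib_left distrib_left)
qed

text \<open>As \<open>r\<close> varies, each of the six families of faces covers a point of space at
  most once; hence the factor 6.\<close>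

lemma nn_integral_surf_le:
  assumes [measurable]: "g \<in> borel_measurable borel"
  shows "(\<lambda>r. surf r g) \<in> borel_measurable borel"
    and "(\<integral>\<^sup>+r. surf r g \<partial>lborel) \<le> 6 * (\<integral>\<^sup>+x. ennreal (g x) \<partial>lborel)"
proof -
  \<comment> \<open>The domain of integration moves with \<open>r\<close>, so measurability in
    \<open>r\<close> rests on the pairs (r, q) with \<open>q\<close> in \<open>square r\<close>
    forming a measurable set, here a closed one.\<close>
  have sq: "{p :: real \<times> (real \<times> real). snd p \<in> square (fst p)} \<in> sets borel"
    unfolding square_def mem_Times_iff atLeastAtMost_iff
    by (intro borel_closed closed_Collect_conj closed_Collect_le continuous_intros)
  have ind: "indicator (square r) q = (indicator {p. snd p \<in> square (fst p)} (r, q) :: ennreal)" for r q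
    by (auto simp: indicator_def)
  have m: "(\<lambda>r. face r i (h r) g) \<in> borel_measurable borel" if [measurable]: "h \<in> borel_measurable borel" for i h
  proof -
    have "(\<lambda>p. ennreal (g (pt i (h (fst p)) (snd p))) * indicator {p :: real \<times> (real \<times> real). snd p \<in> square (fst p)} p) \<in> borel_measurable (borel \<Otimes>\<^sub>M lborel)"
    proof -
      have [measurable]: "{p :: real \<times> (real \<times> real). snd p \<in> square (fst p)} \<in> sets (borel \<Otimes>\<^sub>M lborel)"
        using sq by (simp add: borel_prod[symmetric] cong: sets_pair_measure_cong)
      show ?thesis by measurable
    qed
    from lborel.borel_measurable_nn_integral_fst[OF this] show ?thesis
      unfolding face_def ind by simp
  qed
  have [measurable]: "(\<lambda>r. face r i r g) \<in> borel_measurable borel" "(\<lambda>r. face r i (- r) g) \<in> borel_measurable borel" for i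
    using m[of "\<lambda>r. r" i] m[of uminus i] by simp_all
  show "(\<lambda>r. surf r g) \<in> borel_measurable borel"
    unfolding surf_def by measurable
  have *: "(\<integral>\<^sup>+r. face r i r g \<partial>lborel) \<le> (\<integral>\<^sup>+x. ennreal (g x) \<partial>lborel)" for i
    unfolding face_def nn_integral_pt_pair[of "\<lambda>x. ennreal (g x)" i, simplified]
    by (intro nn_integral_mono) (auto simp: indicator_def)
  have **: "(\<integral>\<^sup>+r. face r i (- r) g \<partial>lborel) \<le> (\<integral>\<^sup>+x. ennreal (g x) \<partial>lborel)" for i
  proof -
    have "(\<integral>\<^sup>+r. face r i (- r) g \<partial>lborel) \<le> (\<integral>\<^sup>+r. \<integral>\<^sup>+q. ennreal (g (pt i (- r) q)) \<partial>lborel \<partial>lborel)"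
      unfolding face_def by (intro nn_integral_mono) (auto simp: indicator_def)
    also have "\<dots> = (\<integral>\<^sup>+r. \<integral>\<^sup>+q. ennreal (g (pt i r q)) \<partial>lborel \<partial>distr lborel borel uminus)"
      by (subst nn_integral_distr) auto
    also have "\<dots> = (\<integral>\<^sup>+x. ennreal (g x) \<partial>lborel)"
      unfolding lborel_distr_uminus by (rule nn_integral_pt_pair[symmetric]) measurable
    finally show ?thesis .
  qed
  have "(\<integral>\<^sup>+r. surf r g \<partial>lborel) = (\<Sum>i\<in>UNIV. (\<integral>\<^sup>+r. face r i r g \<partial>lborel) + (\<integral>\<^sup>+r. face r i (- r) g \<partial>lborel))"
    unfolding surf_def by (subst nn_integral_sum) (auto intro!: sum.cong nn_integral_add)
  also have "\<dots> \<le> (\<Sum>i\<in>(UNIV::3 set). 2 * (\<integral>\<^sup>+x. ennreal (g x) \<partial>lborel))"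
    unfolding mult_2 by (intro sum_mono add_mono * **)
  also have "\<dots> = 6 * (\<integral>\<^sup>+x. ennreal (g x) \<partial>lborel)"
    unfolding sum_cyclic3[of _ 1] distrib_right[symmetric] by simp
  finally show "(\<integral>\<^sup>+r. surf r g \<partial>lborel) \<le> 6 * (\<integral>\<^sup>+x. ennreal (g x) \<partial>lborel)" .
qed

text \<open>Otherwise the integral of \<open>surf r g\<close> over \<open>r\<close> would dominate that of \<open>\<epsilon>/r\<close>, which diverges.\<close>

lemma ex_radius_surf_small:
  assumes [measurable]: "g \<in> borel_measurable borel"
    and fin: "(\<integral>\<^sup>+x. ennreal (g x) \<partial>lborel) < \<infinity>" and \<epsilon>: "0 < \<epsilon>"
  shows "\<exists>r>R. surf r g < ennreal (\<epsilon> / r)"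
proof (rule ccontr)
  assume "\<not> ?thesis"
  then have ge: "ennreal (\<epsilon> / r) \<le> surf r g" if "R < r" for r
    using that by (meson not_le)
  define a where "a = max R 0 + 1"
  have a: "R < a" "0 < a" by (auto simp: a_def)
  obtain N where N: "6 * (\<integral>\<^sup>+x. ennreal (g x) \<partial>lborel) = ennreal N" "0 \<le> N"
    using fin by (cases "6 * (\<integral>\<^sup>+x. ennreal (g x) \<partial>lborel)" rule: ennreal_cases)
      (auto simp: ennreal_mult_eq_top_iff)
  \<comment> \<open>Chosen so that the integral of \<open>\<epsilon> / r\<close> from
    \<open>a\<close> to \<open>b\<close> is \<open>N + 1\<close>.\<close>
  define b where "b = a * exp ((N + 1) / \<epsilon>)"
  have "1 < exp ((N + 1) / \<epsilon>)" using N \<epsilon> by simp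
  then have ab: "a \<le> b" unfolding b_def using a by simp
  have "ennreal (\<epsilon> * ln b - \<epsilon> * ln a) = (\<integral>\<^sup>+r. ennreal (\<epsilon> / r) * indicator {a..b} r \<partial>lborel)"
    by (rule nn_integral_FTC_Icc[symmetric])
       (use a ab \<epsilon> in \<open>auto intro!: derivative_eq_intros\<close>)
  also have "\<dots> \<le> (\<integral>\<^sup>+r. surf r g \<partial>lborel)"
    using ge a by (intro nn_integral_mono) (auto simp: indicator_def)
  also have "\<dots> \<le> ennreal N"
    using nn_integral_surf_le(2)[of g] N by simp
  finally have "\<epsilon> * ln b - \<epsilon> * ln a \<le> N"
    using N by simp
  moreover have "\<epsilon> * ln b - \<epsilon> * ln a = N + 1"
    unfolding b_def using a \<epsilon> by (simp add: ln_mult field_simps)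
  ultimately show False by simp
qed

section \<open>The Sobolev inequality\<close>

lemma ennreal_power2_le_imp_le:
  fixes x y :: ennreal
  assumes "x\<^sup>2 \<le> y\<^sup>2"
  shows "x \<le> y"
proof (cases y rule: ennreal_cases)
  case (real b)
  then have "x \<noteq> top"
    using assms by (auto simp: ennreal_power top_unique ennreal_mult_eq_top_iff power2_eq_square[of top])
  then obtain a where "x = ennreal a" "0 \<le> a"
    by (cases x rule: ennreal_cases) auto
  then show ?thesis
    using assms real by (auto simp: ennreal_power intro!: ennreal_leI power2_le_imp_le[of a b])
qed simp

text \<open>Because \<open>0 * top = 0\<close>, a vanishing factor on the right has to be treated on
  its own. In the finite case the inequality 2 |f g| \<le> t f^2 + g^2 / t is integrated with the
  best weight \<open>t\<close>.\<close>

lemma nn_integral_Cauchy_Schwarz: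
  fixes f g :: "'a \<Rightarrow> real"
  assumes [measurable]: "f \<in> borel_measurable M" "g \<in> borel_measurable M"
  shows "(\<integral>\<^sup>+x. ennreal \<bar>f x * g x\<bar> \<partial>M)\<^sup>2 \<le> (\<integral>\<^sup>+x. ennreal ((f x)\<^sup>2) \<partial>M) * (\<integral>\<^sup>+x. ennreal ((g x)\<^sup>2) \<partial>M)"
    (is "?P\<^sup>2 \<le> ?A * ?B")
proof -
  consider "?A = 0" | "?B = 0" | "?A \<noteq> 0" "?B \<noteq> 0" "?A * ?B = top" | "?A \<noteq> 0" "?B \<noteq> 0" "?A \<noteq> top" "?B \<noteq> top"
    by (auto simp: ennreal_mult_eq_top_iff)
  then show ?thesis
  proof cases
    case 1
    then have "AE x in M. f x = 0"
      by (subst (asm) nn_integral_0_iff_AE) auto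
    then have "?P = 0"
      by (subst nn_integral_0_iff_AE) auto
    then show ?thesis by simp
  next
    case 2
    then have "AE x in M. g x = 0"
      by (subst (asm) nn_integral_0_iff_AE) auto
    then have "?P = 0"
      by (subst nn_integral_0_iff_AE) auto
    then show ?thesis by simp
  next
    case 3
    then show ?thesis by simp
  next
    case 4
    obtain A where A: "?A = ennreal A" "0 < A"
      using 4 by (cases ?A rule: ennreal_cases) (auto simp: less_le)
    obtain B where B: "?B = ennreal B" "0 < B"
      using 4 by (cases ?B rule: ennreal_cases) (auto simp: less_le)
    \<comment> \<open>This weight minimises \<open>t * A + B / t\<close>; the minimum is
      \<open>2 * sqrt (A * B)\<close>.\<close>
    define t where "t = sqrt (B / A)"
    have t: "0 < t" "t\<^sup>2 = B / A"
      using A B by (auto simp: t_def)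
    have "2 * ?P = (\<integral>\<^sup>+x. ennreal (2 * \<bar>f x * g x\<bar>) \<partial>M)"
      by (subst nn_integral_cmult[symmetric]) (auto simp: ennreal_mult)
    also have "\<dots> \<le> (\<integral>\<^sup>+x. ennreal t * ennreal ((f x)\<^sup>2) + ennreal (1 / t) * ennreal ((g x)\<^sup>2) \<partial>M)"
    proof (intro nn_integral_mono)
      fix x
      have "0 \<le> (t * \<bar>f x\<bar> - \<bar>g x\<bar>)\<^sup>2 / t"
        using t by simp
      also have "\<dots> = t * (f x)\<^sup>2 + 1 / t * (g x)\<^sup>2 - 2 * \<bar>f x * g x\<bar>"
        using t by (simp add: power2_eq_square field_simps abs_mult)
      finally have "2 * \<bar>f x * g x\<bar> \<le> t * (f x)\<^sup>2 + 1 / t * (g x)\<^sup>2"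
        by simp
      then show "ennreal (2 * \<bar>f x * g x\<bar>) \<le> ennreal t * ennreal ((f x)\<^sup>2) + ennreal (1 / t) * ennreal ((g x)\<^sup>2)"
        using t by (simp add: ennreal_leI flip: ennreal_mult ennreal_plus)
    qed
    also have "\<dots> = ennreal t * ?A + ennreal (1 / t) * ?B"
      by (subst nn_integral_add) (auto simp: nn_integral_cmult)
    also have "\<dots> = ennreal (t * A + B / t)"
      using A B t by (simp flip: ennreal_mult ennreal_plus)
    also have "t * A + B / t = 2 * sqrt (A * B)"
    proof -
      have "t * A = sqrt (A * B)" "B / t = sqrt (A * B)"
        using A B by (auto simp: t_def real_sqrt_divide real_sqrt_mult field_simps)
      then show ?thesis by simp
    qed
    finally have le: "2 * ?P \<le> ennreal (2 * sqrt (A * B))" .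
    then have "?P \<noteq> top"
      by (auto simp: ennreal_mult_eq_top_iff top_unique)
    then obtain p where p: "?P = ennreal p" "0 \<le> p"
      by (cases ?P rule: ennreal_cases) auto
    have "2 * p \<le> 2 * sqrt (A * B)"
      using le A B p by (simp flip: ennreal_mult ennreal_numeral)
    then have "p\<^sup>2 \<le> (sqrt (A * B))\<^sup>2"
      using p by (intro power_mono) auto
    then show ?thesis
      unfolding p A B using A B p by (simp add: ennreal_power ennreal_leI flip: ennreal_mult)
  qed
qed

lemma abs_diff_le_nn_integral_deriv:
  fixes f f' :: "real \<Rightarrow> real"
  assumes f: "\<And>x. (f has_real_derivative f' x) (at x)" and cont: "continuous_on UNIV f'"
    and xy: "x \<in> {a..b}" "y \<in> {a..b}"
  shows "ennreal \<bar>f x - f y\<bar> \<le> (\<integral>\<^sup>+s. ennreal \<bar>f' s\<bar> * indicator {a..b} s \<partial>lborel)"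
proof -
  have *: "ennreal \<bar>f d - f c\<bar> \<le> (\<integral>\<^sup>+s. ennreal \<bar>f' s\<bar> * indicator {a..b} s \<partial>lborel)" if "a \<le> c" "c \<le> d" "d \<le> b" for c d
  proof -
    have bi: "has_bochner_integral lborel (\<lambda>x. f' x * indicator {c..d} x) (f d - f c)"
      using f cont that by (intro has_bochner_integral_FTC_Icc_real) (auto simp: continuous_on_eq_continuous_at)
    then have "ennreal (norm (f d - f c)) \<le> (\<integral>\<^sup>+s. norm (f' s * indicator {c..d} s) \<partial>lborel)"
      by (rule has_bochner_integral_norm_bound)
    also have "\<dots> \<le> (\<integral>\<^sup>+s. ennreal \<bar>f' s\<bar> * indicator {a..b} s \<partial>lborel)"
      using that by (intro nn_integral_mono) (auto simp: indicator_def)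
    finally show ?thesis by simp
  qed
  show ?thesis
    using *[of x y] *[of y x] xy by (cases "x \<le> y") (auto simp: abs_minus_commute)
qed

lemma abs_le_nn_integral_deriv:
  fixes f f' :: "real \<Rightarrow> real"
  assumes f: "\<And>x. (f has_real_derivative f' x) (at x)" and cont: "continuous_on UNIV f'"
    and supp: "\<And>x. r < \<bar>x\<bar> \<Longrightarrow> f x = 0"
  shows "ennreal \<bar>f x\<bar> \<le> (\<integral>\<^sup>+s. ennreal \<bar>f' s\<bar> \<partial>lborel)"
proof -
  define y where "y = - \<bar>x\<bar> - \<bar>r\<bar> - 1"
  have "ennreal \<bar>f x - f y\<bar> \<le> (\<integral>\<^sup>+s. ennreal \<bar>f' s\<bar> * indicator {y..x} s \<partial>lborel)"
    by (intro abs_diff_le_nn_integral_deriv f cont) (auto simp: y_def)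
  also have "\<dots> \<le> (\<integral>\<^sup>+s. ennreal \<bar>f' s\<bar> \<partial>lborel)"
    by (intro nn_integral_mono) (auto simp: indicator_def)
  finally show ?thesis
    using supp[of y] by (simp add: y_def)
qed

lemma continuous_on_coordinate_line:
  assumes "continuous_on UNIV (F :: real ^ 3 \<Rightarrow> real)"
  shows "continuous_on UNIV (\<lambda>t. F (pt i t q))"
  by (intro continuous_on_compose2[OF assms] continuous_intros) auto

lemma abs_diff_pt_le:
  assumes F: "has_partial i F F'" and cont: "continuous_on UNIV F'"
    and "x \<in> {-r..r}" "y \<in> {-r..r}"
  shows "ennreal \<bar>F (pt i x q) - F (pt i y q)\<bar> \<le> (\<integral>\<^sup>+s. ennreal \<bar>F' (pt i s q)\<bar> * indicator {-r..r} s \<partial>lborel)"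
  by (rule abs_diff_le_nn_integral_deriv[where f = "\<lambda>x. F (pt i x q)"])
     (use assms has_partial_pt[OF F] continuous_on_coordinate_line[OF cont] in auto)

lemma abs_pt_le:
  assumes F: "has_partial i F F'" and cont: "continuous_on UNIV F'"
    and supp: "\<And>x. x \<notin> cube r \<Longrightarrow> F x = 0"
  shows "ennreal \<bar>F (pt i x q)\<bar> \<le> (\<integral>\<^sup>+s. ennreal \<bar>F' (pt i s q)\<bar> \<partial>lborel)"
proof (rule abs_le_nn_integral_deriv[where f = "\<lambda>x. F (pt i x q)" and r = r])
  show "F (pt i x q) = 0" if "r < \<bar>x\<bar>" for x
    using that by (intro supp) (auto simp: pt_in_cube)
qed (use has_partial_pt[OF F] continuous_on_coordinate_line[OF cont] in auto)

lemma has_partial_power: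
  assumes "has_partial i F F'"
  shows "has_partial i (\<lambda>x. F x ^ Suc n) (\<lambda>x. real (Suc n) * F x ^ n * F' x)"
  unfolding has_partial_def
proof
  fix x
  have "((\<lambda>t. F (x + t *\<^sub>R axis i 1)) has_real_derivative F' x) (at 0)"
    using assms by (simp add: has_partial_def)
  from DERIV_power_Suc[OF this, of n]
  show "((\<lambda>t. F (x + t *\<^sub>R axis i 1) ^ Suc n) has_real_derivative real (Suc n) * F x ^ n * F' x) (at 0)"
    by (simp add: mult_ac)
qed

text \<open>In a plane, \<open>\<bar>w\<bar>\<^sup>3\<close> is bounded by the integral of its derivative along either coordinate line;
  the product of the two bounds separates the variables.\<close>

lemma sobolev_slice:
  assumes part: "\<And>i. has_partial i w (w' i)"
    and cont: "continuous_on UNIV w" "\<And>i. continuous_on UNIV (w' i)"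
    and supp: "\<And>x. x \<notin> cube r \<Longrightarrow> w x = 0"
  shows "(\<integral>\<^sup>+q. ennreal (w (pt i z q) ^ 6) \<partial>lborel)
    \<le> 9 * (\<integral>\<^sup>+q. ennreal (w (pt i z q) ^ 4) \<partial>lborel) * (\<integral>\<^sup>+q. ennreal (\<Sum>j\<in>UNIV. (w' j (pt i z q))\<^sup>2) \<partial>lborel)"
proof -
  have [measurable]: "w \<in> borel_measurable borel"  "w' j \<in> borel_measurable borel" for j
    using cont by (auto intro: borel_measurable_continuous_onI)
  have [measurable]: "(\<lambda>q. pt i z q) \<in> borel_measurable borel"
    by measurable
  define W where "W = (\<integral>\<^sup>+q. ennreal (w (pt i z q) ^ 4) \<partial>lborel)"
  define E where "E = (\<integral>\<^sup>+q. ennreal (\<Sum>j\<in>UNIV. (w' j (pt i z q))\<^sup>2) \<partial>lborel)"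
  \<comment> \<open>The derivative of \<open>w ^ 3\<close>. Split into \<open>w\<^sup>2\<close>
    times a derivative of \<open>w\<close>, it is integrated by Cauchy-Schwarz, which brings in the
    L^4 norm of \<open>w\<close> and the L^2 norm of the gradient on the slice.\<close>
  define d where "d j x = 3 * w x ^ 2 * w' j x" for j x
  have [measurable]: "d j \<in> borel_measurable borel" for j
    unfolding d_def by measurable
  have dpart: "has_partial j (\<lambda>x. w x ^ 3) (d j)" for j
    using has_partial_power[OF part[of j], of 2] by (simp add: d_def[abs_def] numeral_3_eq_3)
  have dcont: "continuous_on UNIV (d j)" for j
    unfolding d_def by (intro continuous_intros cont)
  define J where "J j = (\<integral>\<^sup>+q. ennreal \<bar>d j (pt i z q)\<bar> \<partial>lborel)" for j
  define a where "a y = (\<integral>\<^sup>+x. ennreal \<bar>d (i + 1) (pt i z (x, y))\<bar> \<partial>lborel)" for y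
  define b where "b x = (\<integral>\<^sup>+y. ennreal \<bar>d (i + 2) (pt i z (x, y))\<bar> \<partial>lborel)" for x
  have [measurable]: "(\<lambda>p. pt i z (fst p, snd p)) \<in> borel_measurable borel"
    by simp
  have [measurable]: "a \<in> borel_measurable borel" "b \<in> borel_measurable borel"
  proof -
    have "(\<lambda>p. ennreal \<bar>d (i + 1) (pt i z (snd p, fst p))\<bar>) \<in> borel_measurable (borel \<Otimes>\<^sub>M lborel)"
      by measurable
    from lborel.borel_measurable_nn_integral_fst[OF this] show "a \<in> borel_measurable borel"
      by (simp add: a_def[abs_def])
    have "(\<lambda>p. ennreal \<bar>d (i + 2) (pt i z (fst p, snd p))\<bar>) \<in> borel_measurable (borel \<Otimes>\<^sub>M lborel)"
      by measurable
    from lborel.borel_measurable_nn_integral_fst[OF this] show "b \<in> borel_measurable borel"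
      by (simp add: b_def[abs_def])
  qed
  have J: "J (i + 1) = (\<integral>\<^sup>+y. a y \<partial>lborel)" "J (i + 2) = (\<integral>\<^sup>+x. b x \<partial>lborel)"
    unfolding J_def a_def b_def
    by (rule nn_integral_plane(2), measurable) (rule nn_integral_plane(1), measurable)
  have "ennreal (w (pt i z (x, y)) ^ 6) \<le> b x * a y" for x y
  proof -
    have "ennreal \<bar>w (pt i z (x, y)) ^ 3\<bar> \<le> a y"
      using abs_pt_le[OF dpart dcont, of r "i + 1" x "(y, z)"] supp
      by (simp add: a_def pt_shift1)
    moreover have "ennreal \<bar>w (pt i z (x, y)) ^ 3\<bar> \<le> b x"
      using abs_pt_le[OF dpart dcont, of r "i + 2" y "(z, x)"] supp
      by (simp add: b_def pt_shift2)
    ultimately have "ennreal \<bar>w (pt i z (x, y)) ^ 3\<bar> * ennreal \<bar>w (pt i z (x, y)) ^ 3\<bar> \<le> b x * a y"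
      by (intro mult_mono) auto
    then show ?thesis
      by (simp flip: ennreal_mult abs_mult power_add)
  qed
  then have "(\<integral>\<^sup>+q. ennreal (w (pt i z q) ^ 6) \<partial>lborel) \<le> (\<integral>\<^sup>+x. \<integral>\<^sup>+y. b x * a y \<partial>lborel \<partial>lborel)"
    by (subst nn_integral_plane(1)) (auto intro!: nn_integral_mono)
  also have "\<dots> = J (i + 2) * J (i + 1)"
    unfolding J by (simp add: nn_integral_cmult nn_integral_multc)
  finally have 1: "(\<integral>\<^sup>+q. ennreal (w (pt i z q) ^ 6) \<partial>lborel) \<le> J (i + 2) * J (i + 1)" .
  have J2: "(J j)\<^sup>2 \<le> 9 * W * E" for j
  proof -
    have "(J j)\<^sup>2 = (\<integral>\<^sup>+q. ennreal \<bar>(3 * (w (pt i z q))\<^sup>2) * w' j (pt i z q)\<bar> \<partial>lborel)\<^sup>2"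
      by (simp add: J_def d_def)
    also have "\<dots> \<le> (\<integral>\<^sup>+q. ennreal ((3 * (w (pt i z q))\<^sup>2)\<^sup>2) \<partial>lborel) * (\<integral>\<^sup>+q. ennreal ((w' j (pt i z q))\<^sup>2) \<partial>lborel)"
      by (intro nn_integral_Cauchy_Schwarz) measurable
    also have "(\<integral>\<^sup>+q. ennreal ((3 * (w (pt i z q))\<^sup>2)\<^sup>2) \<partial>lborel) = 9 * W"
      unfolding W_def by (subst nn_integral_cmult[symmetric]) (auto simp: ennreal_mult power_mult_distrib)
    also have "(\<integral>\<^sup>+q. ennreal ((w' j (pt i z q))\<^sup>2) \<partial>lborel) \<le> E"
      unfolding E_def by (intro nn_integral_mono ennreal_leI member_le_sum) auto
    finally show ?thesis
      by (simp add: mult_left_mono)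
  qed
  \<comment> \<open>Each factor is bounded only through its square; comparing squares avoids roots
    of extended reals.\<close>
  have "(J (i + 2) * J (i + 1))\<^sup>2 \<le> (9 * W * E) * (9 * W * E)"
    unfolding power_mult_distrib by (intro mult_mono J2) auto
  then have "J (i + 2) * J (i + 1) \<le> 9 * W * E"
    unfolding power2_eq_square[of "9 * W * E", symmetric] by (rule ennreal_power2_le_imp_le)
  with 1 show ?thesis
    unfolding W_def E_def by (rule order_trans)
qed

text \<open>The L^4 integrals left over from the slices are bounded all at once: integrating the
  derivative of \<open>w ^ 4\<close> across the slices bounds each of them by \<open>B\<close>, and
  \<open>B\<^sup>2 \<le> 16 * A * D\<close> by Cauchy-Schwarz. With \<open>A \<le> 9 * B * D\<close>
  this yields \<open>A\<^sup>2 \<le> 1296 * A * D ^ 3\<close>. Cancelling one \<open>A\<close>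
  requires \<open>A\<close> to be finite, which is the first conclusion and comes from the compact
  support.\<close>

lemma sobolev_L6:
  assumes part: "\<And>i. has_partial i w (w' i)"
    and cont: "continuous_on UNIV w" "\<And>i. continuous_on UNIV (w' i)"
    and supp: "\<And>x. x \<notin> cube r \<Longrightarrow> w x = 0"
  shows "(\<integral>\<^sup>+x. ennreal (w x ^ 6) \<partial>lborel) < \<infinity>"
    and "(\<integral>\<^sup>+x. ennreal (w x ^ 6) \<partial>lborel) \<le> 1296 * (\<integral>\<^sup>+x. ennreal (\<Sum>j\<in>UNIV. (w' j x)\<^sup>2) \<partial>lborel) ^ 3"
proof -
  have [measurable]: "w \<in> borel_measurable borel"  "w' j \<in> borel_measurable borel" for j
    using cont by (auto intro: borel_measurable_continuous_onI)
  define i :: 3 where "i = 1"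
  define A where "A = (\<integral>\<^sup>+x. ennreal (w x ^ 6) \<partial>lborel)"
  define D where "D = (\<integral>\<^sup>+x. ennreal (\<Sum>j\<in>UNIV. (w' j x)\<^sup>2) \<partial>lborel)"
  define B where "B = (\<integral>\<^sup>+x. ennreal \<bar>(4 * w x ^ 3) * w' i x\<bar> \<partial>lborel)"
  have "integrable lborel (\<lambda>x. w x ^ 6 * indicator (cube r) x)"
    by (intro integrable_on_cube continuous_intros cont)
  moreover have "w x ^ 6 * indicator (cube r) x = w x ^ 6" for x
    using supp[of x] by (cases "x \<in> cube r") auto
  ultimately have "integrable lborel (\<lambda>x. w x ^ 6)"
    by simp
  then show Afin: "(\<integral>\<^sup>+x. ennreal (w x ^ 6) \<partial>lborel) < \<infinity>"
    by (subst nn_integral_eq_integral) auto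
  have W: "(\<integral>\<^sup>+q. ennreal (w (pt i z q) ^ 4) \<partial>lborel) \<le> B" for z
  proof -
    have p: "has_partial i (\<lambda>x. w x ^ 4) (\<lambda>x. 4 * w x ^ 3 * w' i x)"
      using has_partial_power[OF part[of i], of 3] by (simp add: eval_nat_numeral)
    have "ennreal (w (pt i z q) ^ 4) \<le> (\<integral>\<^sup>+s. ennreal \<bar>(4 * w (pt i s q) ^ 3) * w' i (pt i s q)\<bar> \<partial>lborel)" for q
    proof -
      have "ennreal \<bar>w (pt i z q) ^ 4\<bar> \<le> (\<integral>\<^sup>+s. ennreal \<bar>(4 * w (pt i s q) ^ 3) * w' i (pt i s q)\<bar> \<partial>lborel)"
        by (rule abs_pt_le[OF p, where r = r]) (use supp in \<open>auto intro!: continuous_intros cont\<close>)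
      then show ?thesis by simp
    qed
    then have "(\<integral>\<^sup>+q. ennreal (w (pt i z q) ^ 4) \<partial>lborel)
        \<le> (\<integral>\<^sup>+q. \<integral>\<^sup>+s. ennreal \<bar>(4 * w (pt i s q) ^ 3) * w' i (pt i s q)\<bar> \<partial>lborel \<partial>lborel)"
      by (intro nn_integral_mono)
    also have "\<dots> = (\<integral>\<^sup>+s. \<integral>\<^sup>+q. ennreal \<bar>(4 * w (pt i s q) ^ 3) * w' i (pt i s q)\<bar> \<partial>lborel \<partial>lborel)"
      by (rule lborel_pair.Fubini') (simp add: lborel_prod split_def)
    also have "\<dots> = B"
      unfolding B_def by (rule nn_integral_pt_pair[symmetric]) measurable
    finally show ?thesis .
  qed
  have "A = (\<integral>\<^sup>+z. \<integral>\<^sup>+q. ennreal (w (pt i z q) ^ 6) \<partial>lborel \<partial>lborel)"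
    unfolding A_def by (rule nn_integral_pt_pair) measurable
  also have "\<dots> \<le> (\<integral>\<^sup>+z. (9 * B) * (\<integral>\<^sup>+q. ennreal (\<Sum>j\<in>UNIV. (w' j (pt i z q))\<^sup>2) \<partial>lborel) \<partial>lborel)"
  proof (intro nn_integral_mono)
    fix z
    show "(\<integral>\<^sup>+q. ennreal (w (pt i z q) ^ 6) \<partial>lborel)
        \<le> (9 * B) * (\<integral>\<^sup>+q. ennreal (\<Sum>j\<in>UNIV. (w' j (pt i z q))\<^sup>2) \<partial>lborel)"
      by (rule order_trans[OF sobolev_slice[OF part cont supp]])
         (auto intro!: mult_mono W)
  qed
  also have "\<dots> = (9 * B) * (\<integral>\<^sup>+z. \<integral>\<^sup>+q. ennreal (\<Sum>j\<in>UNIV. (w' j (pt i z q))\<^sup>2) \<partial>lborel \<partial>lborel)"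
  proof (rule nn_integral_cmult)
    have "(\<lambda>p. ennreal (\<Sum>j\<in>UNIV. (w' j (pt i (fst p) (snd p)))\<^sup>2)) \<in> borel_measurable (lborel \<Otimes>\<^sub>M lborel)"
      by (simp add: lborel_prod)
    from lborel.borel_measurable_nn_integral_fst[OF this]
    show "(\<lambda>z. \<integral>\<^sup>+q. ennreal (\<Sum>j\<in>UNIV. (w' j (pt i z q))\<^sup>2) \<partial>lborel) \<in> borel_measurable lborel"
      by simp
  qed
  also have "(\<integral>\<^sup>+z. \<integral>\<^sup>+q. ennreal (\<Sum>j\<in>UNIV. (w' j (pt i z q))\<^sup>2) \<partial>lborel \<partial>lborel) = D"
    unfolding D_def by (rule nn_integral_pt_pair[symmetric]) measurable
  finally have AB: "A \<le> 9 * B * D" .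
  have "B\<^sup>2 \<le> (\<integral>\<^sup>+x. ennreal ((4 * w x ^ 3)\<^sup>2) \<partial>lborel) * (\<integral>\<^sup>+x. ennreal ((w' i x)\<^sup>2) \<partial>lborel)"
    unfolding B_def by (intro nn_integral_Cauchy_Schwarz) measurable
  also have "(\<integral>\<^sup>+x. ennreal ((4 * w x ^ 3)\<^sup>2) \<partial>lborel) = 16 * A"
    unfolding A_def by (subst nn_integral_cmult[symmetric])
      (auto simp: ennreal_mult power_mult_distrib simp flip: power_mult)
  also have "(\<integral>\<^sup>+x. ennreal ((w' i x)\<^sup>2) \<partial>lborel) \<le> D"
    unfolding D_def by (intro nn_integral_mono ennreal_leI member_le_sum) auto
  finally have B2: "B\<^sup>2 \<le> 16 * A * D"
    by (simp add: mult_left_mono)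
  have "A\<^sup>2 \<le> (9 * B * D)\<^sup>2"
    using AB by (intro power_mono) auto
  also have "\<dots> = 81 * D\<^sup>2 * B\<^sup>2"
    by (simp add: power_mult_distrib mult_ac)
  also have "\<dots> \<le> 81 * D\<^sup>2 * (16 * A * D)"
    by (intro mult_left_mono B2) auto
  finally have A2: "A\<^sup>2 \<le> 81 * D\<^sup>2 * (16 * A * D)" .
  show "A \<le> 1296 * D ^ 3"
  proof (cases D rule: ennreal_cases)
    case (real e)
    obtain c where c: "A = ennreal c" "0 \<le> c"
      using Afin unfolding A_def[symmetric] by (cases A rule: ennreal_cases) auto
    have "ennreal (c\<^sup>2) \<le> ennreal (81 * e\<^sup>2 * (16 * c * e))"
      using A2 real c by (simp add: ennreal_power flip: ennreal_mult ennreal_numeral)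
    then have "c * c \<le> c * (1296 * e ^ 3)"
      using real c by (simp add: power2_eq_square power3_eq_cube mult_ac)
    then have "c \<le> 1296 * e ^ 3"
      using c real by (cases "c = 0") auto
    then show ?thesis
      using real c by (simp add: ennreal_power ennreal_leI flip: ennreal_mult ennreal_numeral)
  next
    case top
    then show ?thesis
      by (simp add: ennreal_mult_eq_top_iff)
  qed
qed

section \<open>A priori estimates\<close>

lemma has_partial_mult:
  assumes "has_partial i F F'" "has_partial i G G'"
  shows "has_partial i (\<lambda>x. F x * G x) (\<lambda>x. F' x * G x + F x * G' x)"
  using assms unfolding has_partial_def by (auto intro!: derivative_eq_intros)

lemma has_partial_chain:
  assumes "\<And>s. (g has_real_derivative g' s) (at s)" "has_partial i F F'"
  shows "has_partial i (\<lambda>x. g (F x)) (\<lambda>x. g' (F x) * F' x)"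
  unfolding has_partial_def
proof
  fix x
  have "((\<lambda>t. F (x + t *\<^sub>R axis i 1)) has_real_derivative F' x) (at 0)"
    using assms by (simp add: has_partial_def)
  moreover have "(g has_real_derivative g' (F x)) (at (F (x + 0 *\<^sub>R axis i 1)))"
    using assms(1) by simp
  ultimately show "((\<lambda>t. g (F (x + t *\<^sub>R axis i 1))) has_real_derivative g' (F x) * F' x) (at 0)"
    by (intro DERIV_chain2)
qed

lemma nn_integral_limit_le:
  fixes f :: "nat \<Rightarrow> 'a \<Rightarrow> real"
  assumes [measurable]: "\<And>n. f n \<in> borel_measurable M"
    and lim: "\<And>x. (\<lambda>n. f n x) \<longlonglongrightarrow> g x" and bound: "\<And>n. (\<integral>\<^sup>+x. ennreal (f n x) \<partial>M) \<le> C"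
  shows "(\<integral>\<^sup>+x. ennreal (g x) \<partial>M) \<le> C"
proof -
  have "(\<integral>\<^sup>+x. ennreal (g x) \<partial>M) = (\<integral>\<^sup>+x. liminf (\<lambda>n. ennreal (f n x)) \<partial>M)"
    using lim by (intro nn_integral_cong lim_imp_Liminf[symmetric] tendsto_ennrealI) auto
  also have "\<dots> \<le> liminf (\<lambda>n. \<integral>\<^sup>+x. ennreal (f n x) \<partial>M)"
    by (rule nn_integral_liminf) measurable
  also have "\<dots> \<le> C"
    by (rule Liminf_le) (auto intro!: always_eventually bound)
  finally show ?thesis .
qed

lemma surf_eq_0:
  assumes "\<And>x. x \<notin> cube r \<Longrightarrow> g x = 0" "0 \<le> r" "r < R"
  shows "surf R g = 0"
proof -
  have "g (pt i s q) = 0" if "\<bar>s\<bar> = R" for i s q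
    using that assms by (intro assms(1)) (auto simp: pt_in_cube)
  then have "face R i R g = 0" "face R i (- R) g = 0" for i
    unfolding face_def using assms by simp_all
  then show ?thesis
    by (simp add: surf_def)
qed

lemma divergence_compact_support:
  assumes part: "\<And>i. has_partial i (F i) (F' i)"
    and cont: "\<And>i. continuous_on UNIV (F i)" "\<And>i. continuous_on UNIV (F' i)"
    and supp: "\<And>i x. x \<notin> cube r \<Longrightarrow> F i x = 0" and r: "0 \<le> r" "r < R"
  shows "(\<integral>x. (\<Sum>i\<in>UNIV. F' i x) * indicator (cube R) x \<partial>lborel) = 0"
proof -
  have "ennreal \<bar>\<integral>x. (\<Sum>i\<in>UNIV. F' i x) * indicator (cube R) x \<partial>lborel\<bar> \<le> surf R (\<lambda>x. \<Sum>i\<in>UNIV. \<bar>F i x\<bar>)"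
    by (rule divergence_bound[OF part cont]) (use r in \<open>auto intro!: member_le_sum\<close>)
  also have "\<dots> = 0"
    using r by (intro surf_eq_0[of r]) (auto simp: supp)
  finally show ?thesis by (simp add: ennreal_eq_0_iff)
qed

lemma not_in_cube: "x \<notin> cube r \<Longrightarrow> r < norm x"
  using component_le_norm_cart[of x] by (auto simp: cube_def not_le intro: less_le_trans)

text \<open>6 and 6/5 are conjugate exponents; the two cases decide which term alone dominates the
  product. The weight stays free so that the first term can be absorbed later.\<close>

lemma young_6_5:
  fixes w f :: real
  assumes "0 \<le> w" "0 \<le> f" "0 < \<kappa>"
  shows "w * f \<le> w ^ 6 / \<kappa> ^ 5 + \<kappa> * f powr (6 / 5)"
proof (cases "\<kappa> ^ 5 * f \<le> w ^ 5")
  case True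
  then have "w * (\<kappa> ^ 5 * f) \<le> w * w ^ 5"
    using assms by (intro mult_left_mono) auto
  then have "w * f \<le> w ^ 6 / \<kappa> ^ 5"
    using assms by (simp add: field_simps eval_nat_numeral)
  then show ?thesis
    using assms by (simp add: add_increasing2)
next
  case False
  then have f: "0 < f"
    using assms by (cases "f = 0") auto
  have "(f powr (1 / 5)) ^ 5 = f"
    using f by (simp add: powr_power)
  then have "w ^ 5 \<le> (\<kappa> * f powr (1 / 5)) ^ 5"
    using False by (simp add: power_mult_distrib)
  then have "w \<le> \<kappa> * f powr (1 / 5)"
    using assms f by (subst (asm) power_mono_iff) auto
  then have "w * f \<le> \<kappa> * f powr (1 / 5) * f"
    using f by (intro mult_right_mono) auto
  also have "\<dots> = \<kappa> * f powr (6 / 5)"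
    using f powr_add[of f "1 / 5" 1] by simp
  finally show ?thesis
    using assms by (simp add: add_increasing)
qed

text \<open>Squaring makes the positive part continuously differentiable. Both the truncation of
  \<open>u\<close> and the cutoff in space are built on this.\<close>

lemma DERIV_max0_square: "((\<lambda>t. (max 0 t)\<^sup>2) has_real_derivative 2 * max 0 t) (at t)" for t :: real
proof -
  consider "t < 0" | "t > 0" | "t = 0" by linarith
  then show ?thesis
  proof cases
    case 1
    have "((\<lambda>t. 0) has_real_derivative 2 * max 0 t) (at t)" using 1 by simp
    from this show ?thesis
      by (rule has_field_derivative_transform_within_open[where S = "{..<0}" and f = "\<lambda>t. 0"]) (use 1 in auto)
  next
    case 2
    have "((\<lambda>t. t\<^sup>2) has_real_derivative 2 * max 0 t) (at t)"
      using 2 by (auto intro!: derivative_eq_intros)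
    from this show ?thesis
      by (rule has_field_derivative_transform_within_open[where S = "{0<..}" and f = "\<lambda>t. t\<^sup>2"]) (use 2 in auto)
  next
    case 3
    have "((\<lambda>h::real. ((max 0 (0 + h))\<^sup>2 - (max 0 0)\<^sup>2) / h) \<longlongrightarrow> 0) (at 0)"
    proof (rule tendsto_0_le[where K = 1 and f = "\<lambda>h. h"])
      show "\<forall>\<^sub>F h in at (0::real). norm (((max 0 (0 + h))\<^sup>2 - (max 0 0)\<^sup>2) / h) \<le> norm h * 1"
        by (intro always_eventually allI) (auto simp: max_def power2_eq_square)
    qed (rule tendsto_ident_at)
    then show ?thesis
      using 3 by (simp add: DERIV_def)
  qed
qed

text \<open>A \<open>C\<^sup>1\<close> approximation of the identity that vanishes for \<open>\<bar>s\<bar> \<le> e\<close>; at \<open>s = 0\<close> the definitions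
  rely on \<open>0 / 0 = 0\<close>.\<close>

definition trunc :: "real \<Rightarrow> real \<Rightarrow> real" where
  "trunc e s = (max 0 (s\<^sup>2 - e\<^sup>2))\<^sup>2 / s ^ 3"

definition trunc' :: "real \<Rightarrow> real \<Rightarrow> real" where
  "trunc' e s = max 0 (s\<^sup>2 - e\<^sup>2) * (4 * s\<^sup>2 - 3 * max 0 (s\<^sup>2 - e\<^sup>2)) / s ^ 4"

lemma trunc_eq_0: "\<bar>s\<bar> \<le> e \<Longrightarrow> trunc e s = 0" "\<bar>s\<bar> \<le> e \<Longrightarrow> trunc' e s = 0"
  unfolding trunc_def trunc'_def using power_mono[of "\<bar>s\<bar>" e 2] by auto

lemma DERIV_trunc:
  assumes "0 < e"
  shows "(trunc e has_real_derivative trunc' e s) (at s)"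
proof (cases "\<bar>s\<bar> < e")
  case True
  have "trunc' e s = 0"
    using True by (intro trunc_eq_0) simp
  then have "((\<lambda>t. 0) has_real_derivative trunc' e s) (at s)"
    by simp
  from this show ?thesis
    by (rule has_field_derivative_transform_within_open[where S = "{-e<..<e}" and f = "\<lambda>t. 0"]) (use True in \<open>auto simp: trunc_eq_0\<close>)
next
  case False
  then have s: "s \<noteq> 0" using assms by auto
  have "((\<lambda>s. (max 0 (s\<^sup>2 - e\<^sup>2))\<^sup>2) has_real_derivative 2 * max 0 (s\<^sup>2 - e\<^sup>2) * (2 * s)) (at s)"
    by (rule DERIV_chain2[OF DERIV_max0_square]) (auto intro!: derivative_eq_intros)
  moreover have "((\<lambda>s. s ^ 3) has_real_derivative 3 * s\<^sup>2) (at s)"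
    by (auto intro!: derivative_eq_intros)
  ultimately have "((\<lambda>s. (max 0 (s\<^sup>2 - e\<^sup>2))\<^sup>2 / s ^ 3) has_real_derivative
      ((2 * max 0 (s\<^sup>2 - e\<^sup>2) * (2 * s)) * s ^ 3 - (max 0 (s\<^sup>2 - e\<^sup>2))\<^sup>2 * (3 * s\<^sup>2)) / (s ^ 3 * s ^ 3)) (at s)"
    using s by (intro DERIV_divide) auto
  also have "((2 * max 0 (s\<^sup>2 - e\<^sup>2) * (2 * s)) * s ^ 3 - (max 0 (s\<^sup>2 - e\<^sup>2))\<^sup>2 * (3 * s\<^sup>2)) / (s ^ 3 * s ^ 3) = trunc' e s"
    unfolding trunc'_def using s by (simp add: divide_simps eval_nat_numeral) (simp add: algebra_simps)
  finally show ?thesis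
    by (simp add: trunc_def[abs_def])
qed

text \<open>The quotient is singular at 0, so the line is covered by two open sets: one around 0
  where the function vanishes, and the complement of 0 where the formula is continuous.\<close>

lemma continuous_trunc':
  assumes "0 < e"
  shows "continuous_on UNIV (trunc' e)"
proof -
  have 1: "continuous_on {-e<..<e} (trunc' e)"
  proof (subst continuous_on_cong[OF refl])
    show "trunc' e x = 0" if "x \<in> {-e<..<e}" for x
      using that by (intro trunc_eq_0) auto
  qed simp
  have 2: "continuous_on (- {0}) (trunc' e)"
    unfolding trunc'_def by (intro continuous_intros) auto
  have "continuous_on ({-e<..<e} \<union> - {0}) (trunc' e)"
    by (rule continuous_on_open_Un[OF _ _ 1 2]) auto
  moreover have "{-e<..<e} \<union> - {0} = UNIV"
    using assms by auto
  ultimately show ?thesis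
    by simp
qed

lemma continuous_trunc: "0 < e \<Longrightarrow> continuous_on UNIV (trunc e)"
  by (rule DERIV_continuous_on) (rule DERIV_subset[OF DERIV_trunc], auto)

text \<open>Nonnegativity makes the integral of \<open>trunc' e u\<close> times |\<nabla>u|^2
  nonnegative. The upper bound gives |\<nabla>w|^2 \<le> 2 \<open>trunc' e u\<close> |\<nabla>u|^2
  for \<open>w = trunc e u\<close>, so the same integral controls the right-hand side of Sobolev's
  inequality for \<open>w\<close>.\<close>

lemma trunc'_bounds: "0 \<le> trunc' e s" "trunc' e s \<le> 2"
proof -
  let ?m = "max 0 (s\<^sup>2 - e\<^sup>2)"
  have m: "0 \<le> ?m" "?m \<le> s\<^sup>2" by auto
  have "0 \<le> 4 * a - 3 * b" if "0 \<le> b" "b \<le> a" for a b :: real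
    using that by linarith
  from this[OF m] have "0 \<le> 4 * s\<^sup>2 - 3 * ?m" .
  then have "0 \<le> ?m * (4 * s\<^sup>2 - 3 * ?m)"
    using m by (intro mult_nonneg_nonneg)
  then show "0 \<le> trunc' e s"
    unfolding trunc'_def by (intro divide_nonneg_nonneg) auto
  have "b * (4 * a - 3 * b) \<le> 2 * a\<^sup>2" for a b :: real
  proof -
    have "0 \<le> (3 * b - 2 * a)\<^sup>2 + 2 * a\<^sup>2"
      by simp
    then show ?thesis
      by (simp add: power2_eq_square algebra_simps)
  qed
  from this[of ?m "s\<^sup>2"] have "?m * (4 * s\<^sup>2 - 3 * ?m) \<le> 2 * (s\<^sup>2)\<^sup>2" .
  then show "trunc' e s \<le> 2"
    unfolding trunc'_def by (cases "s = 0") (auto simp: divide_le_eq simp flip: power_mult)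
qed

lemma trunc_tendsto:
  assumes "e \<longlonglongrightarrow> 0"
  shows "(\<lambda>n. trunc (e n) s) \<longlonglongrightarrow> s"
proof (cases "s = 0")
  case True
  then show ?thesis by (simp add: trunc_def)
next
  case False
  have "(\<lambda>n. (max 0 (s\<^sup>2 - (e n)\<^sup>2))\<^sup>2 / s ^ 3) \<longlonglongrightarrow> (max 0 (s\<^sup>2 - 0\<^sup>2))\<^sup>2 / s ^ 3"
    using False assms by (intro tendsto_intros) auto
  also have "(max 0 (s\<^sup>2 - 0\<^sup>2))\<^sup>2 / s ^ 3 = s"
    using False by (simp add: eval_nat_numeral)
  finally show ?thesis
    by (simp add: trunc_def)
qed

text \<open>With \<open>w = trunc e u\<close> and \<open>P\<close> the integral of \<open>trunc' e u \<bar>\<nabla>u\<bar>\<^sup>2\<close>, Sobolev and Young bound \<open>P\<close> by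
  a multiple of \<open>\<kappa>\<^sup>-\<^sup>5 P\<^sup>3 + \<kappa> N\<close>; the choice of \<open>\<kappa>\<close> absorbs the cubic term. The bound does not
  depend on \<open>e\<close>.\<close>

lemma truncated_energy_estimate:
  assumes part: "\<And>i. has_partial i u (u' i)" "\<And>i. has_partial i (u' i) (u'' i)"
    and cont: "continuous_on UNIV u" "\<And>i. continuous_on UNIV (u' i)" "\<And>i. continuous_on UNIV (u'' i)"
    and lim: "(u \<longlongrightarrow> 0) at_infinity"
    and N: "(\<integral>\<^sup>+x. ennreal (\<bar>\<Sum>i\<in>UNIV. u'' i x\<bar> powr (6 / 5)) \<partial>lborel) \<le> ennreal N" "0 \<le> N"
    and e: "0 < e"
  shows "(\<integral>\<^sup>+x. ennreal (trunc e (u x) ^ 6) \<partial>lborel) \<le> ennreal (10368 * 663552 * N ^ 5)"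
proof -
  have [measurable]: "u \<in> borel_measurable borel" "\<And>i. u' i \<in> borel_measurable borel" "\<And>i. u'' i \<in> borel_measurable borel"
    using cont by (auto intro: borel_measurable_continuous_onI)
  define f where "f x = (\<Sum>i\<in>UNIV. u'' i x)" for x
  define w where "w x = trunc e (u x)" for x
  define G where "G x = (\<Sum>i\<in>UNIV. (u' i x)\<^sup>2)" for x
  have cf: "continuous_on UNIV f" unfolding f_def by (intro continuous_intros cont)
  have cG: "continuous_on UNIV G" unfolding G_def by (intro continuous_intros cont)
  have cw: "continuous_on UNIV w" unfolding w_def
    by (rule continuous_on_compose2[OF continuous_trunc[OF e] cont(1)]) auto
  have ct: "continuous_on UNIV (\<lambda>x. trunc' e (u x))"
    by (rule continuous_on_compose2[OF continuous_trunc'[OF e] cont(1)]) auto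
  have [measurable]: "f \<in> borel_measurable borel" "w \<in> borel_measurable borel" "G \<in> borel_measurable borel"
    "(\<lambda>x. trunc' e (u x)) \<in> borel_measurable borel"
    using cf cG cw ct by (auto intro: borel_measurable_continuous_onI)
  obtain b where b: "\<And>x. b \<le> norm x \<Longrightarrow> \<bar>u x\<bar> < e"
    using lim e by (auto simp: tendsto_iff eventually_at_infinity)
  define r where "r = max b 0"
  have r: "0 \<le> r" by (simp add: r_def)
  have small: "\<bar>u x\<bar> \<le> e" if "x \<notin> cube r" for x
    using not_in_cube[OF that] b[of x] by (auto simp: r_def)
  have w0: "w x = 0" "trunc' e (u x) = 0" if "x \<notin> cube r" for x
    using small[OF that] by (auto simp: w_def trunc_eq_0)
  \<comment> \<open>One unit larger than the cube carrying the support, so that the flux through its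
    surface vanishes.\<close>
  define K where "K = cube (r + 1)"
  have K: "x \<in> K" if "x \<in> cube r" for x
    using that by (auto simp: K_def cube_def intro: order_trans[of _ r])
  have wpart: "has_partial i w (\<lambda>x. trunc' e (u x) * u' i x)" for i
    unfolding w_def by (rule has_partial_chain[OF DERIV_trunc[OF e] part(1)])
  define P where "P = (\<integral>x. trunc' e (u x) * G x * indicator K x \<partial>lborel)"
  define A where "A = (\<integral>\<^sup>+x. ennreal (w x ^ 6) \<partial>lborel)"
  have P0: "0 \<le> P" unfolding P_def
    by (intro integral_nonneg_AE AE_I2) (auto simp: G_def indicator_def trunc'_bounds intro!: mult_nonneg_nonneg sum_nonneg)
  have intP: "integrable lborel (\<lambda>x. trunc' e (u x) * G x * indicator K x)"
    unfolding K_def by (intro integrable_on_cube continuous_intros ct cG)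
  have P_eq: "(\<integral>\<^sup>+x. ennreal (trunc' e (u x) * G x) \<partial>lborel) = ennreal P"
  proof -
    have "(\<integral>\<^sup>+x. ennreal (trunc' e (u x) * G x) \<partial>lborel) = (\<integral>\<^sup>+x. ennreal (trunc' e (u x) * G x * indicator K x) \<partial>lborel)"
    proof (intro nn_integral_cong)
      show "ennreal (trunc' e (u x) * G x) = ennreal (trunc' e (u x) * G x * indicator K x)" for x
      proof (cases "x \<in> K")
        case False
        then have "x \<notin> cube r"
          using K by blast
        then show ?thesis
          using False w0(2) by simp
      qed simp
    qed
    also have "\<dots> = ennreal P"
      unfolding P_def by (rule nn_integral_eq_integral[OF intP])
        (auto simp: G_def indicator_def trunc'_bounds intro!: mult_nonneg_nonneg sum_nonneg)
    finally show ?thesis .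
  qed
  have sob: "A \<le> 1296 * (\<integral>\<^sup>+x. ennreal (\<Sum>j\<in>UNIV. (trunc' e (u x) * u' j x)\<^sup>2) \<partial>lborel) ^ 3" and Afin: "A < \<infinity>"
    unfolding A_def by (rule sobolev_L6[OF wpart cw]; use w0 in \<open>auto intro!: continuous_intros ct cont\<close>)+
  have "(\<integral>\<^sup>+x. ennreal (\<Sum>j\<in>UNIV. (trunc' e (u x) * u' j x)\<^sup>2) \<partial>lborel) \<le> (\<integral>\<^sup>+x. ennreal 2 * ennreal (trunc' e (u x) * G x) \<partial>lborel)"
  proof (intro nn_integral_mono)
    fix x
    have "(\<Sum>j\<in>UNIV. (trunc' e (u x) * u' j x)\<^sup>2) = trunc' e (u x) * (trunc' e (u x) * G x)"
      by (simp add: G_def sum_distrib_left power2_eq_square mult_ac)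
    also have "\<dots> \<le> 2 * (trunc' e (u x) * G x)"
      by (intro mult_right_mono trunc'_bounds mult_nonneg_nonneg) (auto simp: G_def sum_nonneg)
    finally have "(\<Sum>j\<in>UNIV. (trunc' e (u x) * u' j x)\<^sup>2) \<le> 2 * (trunc' e (u x) * G x)" .
    from ennreal_leI[OF this]
    show "ennreal (\<Sum>j\<in>UNIV. (trunc' e (u x) * u' j x)\<^sup>2) \<le> ennreal 2 * ennreal (trunc' e (u x) * G x)"
      by (simp add: ennreal_mult')
  qed
  also have "\<dots> = ennreal (2 * P)"
    using P0 by (simp add: nn_integral_cmult P_eq ennreal_mult)
  finally have "A \<le> 1296 * ennreal (2 * P) ^ 3"
    by (intro order_trans[OF sob] mult_left_mono power_mono) auto
  then have A1: "A \<le> ennreal (10368 * P ^ 3)"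
    using P0 by (simp add: ennreal_power power_mult_distrib flip: ennreal_mult ennreal_numeral)
  obtain a where a: "A = ennreal a" "0 \<le> a"
    using Afin by (cases A rule: ennreal_cases) auto
  have aP: "a \<le> 10368 * P ^ 3"
    using A1 a P0 by simp
  \<comment> \<open>The field with components \<open>w * u' i\<close> has compact support; that its
    divergence integrates to 0 is the equation tested with \<open>w\<close>.\<close>
  have "(\<integral>x. (\<Sum>i\<in>UNIV. trunc' e (u x) * u' i x * u' i x + w x * u'' i x) * indicator (cube (r + 1)) x \<partial>lborel) = 0"
    by (rule divergence_compact_support[OF has_partial_mult[OF wpart part(2)], where r = r])
       (use w0 r in \<open>auto intro!: continuous_intros ct cont cw\<close>)
  also have "(\<lambda>x. (\<Sum>i\<in>UNIV. trunc' e (u x) * u' i x * u' i x + w x * u'' i x) * indicator (cube (r + 1)) x)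
      = (\<lambda>x. trunc' e (u x) * G x * indicator K x + w x * f x * indicator K x)"
    by (auto simp: G_def f_def K_def sum.distrib sum_distrib_left power2_eq_square indicator_def mult_ac)
  also have "(\<integral>x. trunc' e (u x) * G x * indicator K x + w x * f x * indicator K x \<partial>lborel)
      = P + (\<integral>x. w x * f x * indicator K x \<partial>lborel)"
    unfolding P_def K_def
    by (intro Bochner_Integration.integral_add integrable_on_cube continuous_intros ct cG cw cf)
  finally have P_minus: "P = - (\<integral>x. w x * f x * indicator K x \<partial>lborel)"
    by simp
  have PN: "P \<le> a / \<kappa> ^ 5 + \<kappa> * N" if \<kappa>: "0 < \<kappa>" for \<kappa>
  proof -
    have "ennreal P \<le> ennreal (norm (\<integral>x. w x * f x * indicator K x \<partial>lborel))"
      using P_minus by (intro ennreal_leI) auto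
    also have "\<dots> \<le> (\<integral>\<^sup>+x. norm (w x * f x * indicator K x) \<partial>lborel)"
      unfolding K_def by (intro integral_norm_bound_ennreal integrable_on_cube continuous_intros cw cf)
    also have "\<dots> \<le> (\<integral>\<^sup>+x. ennreal (1 / \<kappa> ^ 5) * ennreal (w x ^ 6) + ennreal \<kappa> * ennreal (\<bar>f x\<bar> powr (6 / 5)) \<partial>lborel)"
    proof (intro nn_integral_mono)
      fix x
      have "norm (w x * f x * indicator K x) \<le> \<bar>w x\<bar> * \<bar>f x\<bar>"
        by (auto simp: indicator_def abs_mult)
      also have "\<dots> \<le> 1 / \<kappa> ^ 5 * w x ^ 6 + \<kappa> * \<bar>f x\<bar> powr (6 / 5)"
        using young_6_5[of "\<bar>w x\<bar>" "\<bar>f x\<bar>" \<kappa>] \<kappa> by simp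
      finally show "ennreal (norm (w x * f x * indicator K x))
          \<le> ennreal (1 / \<kappa> ^ 5) * ennreal (w x ^ 6) + ennreal \<kappa> * ennreal (\<bar>f x\<bar> powr (6 / 5))"
        using \<kappa> by (simp add: ennreal_leI flip: ennreal_mult ennreal_plus)
    qed
    also have "\<dots> = ennreal (1 / \<kappa> ^ 5) * A + ennreal \<kappa> * (\<integral>\<^sup>+x. ennreal (\<bar>f x\<bar> powr (6 / 5)) \<partial>lborel)"
      unfolding A_def by (subst nn_integral_add) (auto simp: nn_integral_cmult)
    also have "\<dots> \<le> ennreal (1 / \<kappa> ^ 5) * ennreal a + ennreal \<kappa> * ennreal N"
      using N(1) unfolding a f_def by (intro add_mono mult_left_mono) auto
    also have "\<dots> = ennreal (a / \<kappa> ^ 5 + \<kappa> * N)"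
      using \<kappa> a N by (simp flip: ennreal_mult ennreal_plus)
    finally show ?thesis
      using a \<kappa> N by (subst (asm) ennreal_le_iff) auto
  qed
  have P3: "P ^ 3 \<le> 663552 * N ^ 5"
  proof (cases "P = 0")
    case False
    then have P: "0 < P" using P0 by simp
    \<comment> \<open>With \<open>a \<le> 10368 * P ^ 3\<close>, where 10368 = 1296 * 2 ^ 3, this
      choice makes \<open>a / \<kappa> ^ 5\<close> at most \<open>P / 2\<close>. Hence
      \<open>P \<le> 2 * (\<kappa> * N)\<close>, and the fifth power produces 663552 = 2 ^ 5 *
      20736.\<close>
    define \<kappa> where "\<kappa> = root 5 (20736 * P\<^sup>2)"
    have \<kappa>: "0 < \<kappa>" "\<kappa> ^ 5 = 20736 * P\<^sup>2"
      using P by (auto simp: \<kappa>_def)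
    have "a / \<kappa> ^ 5 \<le> 10368 * P ^ 3 / (20736 * P\<^sup>2)"
      unfolding \<kappa>(2) using P aP by (intro divide_right_mono) auto
    also have "\<dots> = P / 2"
      using P by (simp add: eval_nat_numeral)
    finally have "P \<le> 2 * (\<kappa> * N)"
      using PN[OF \<kappa>(1)] by linarith
    then have "P ^ 5 \<le> (2 * (\<kappa> * N)) ^ 5"
      using P by (intro power_mono) auto
    also have "\<dots> = 663552 * P\<^sup>2 * N ^ 5"
      by (simp add: power_mult_distrib \<kappa>)
    finally have "P\<^sup>2 * P ^ 3 \<le> P\<^sup>2 * (663552 * N ^ 5)"
      by (simp add: mult_ac flip: power_add)
    from mult_left_le_imp_le[OF this] show ?thesis
      using P by simp
  qed (use N in auto)
  have "a \<le> 10368 * 663552 * N ^ 5"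
    using aP P3 by simp
  then show ?thesis
    using a unfolding A_def w_def by (simp add: ennreal_leI)
qed

text \<open>The bound for the truncations is uniform in \<open>e\<close>, so Fatou's lemma carries
  it to the limit.\<close>

lemma integrable_L6:
  assumes part: "\<And>i. has_partial i u (u' i)" "\<And>i. has_partial i (u' i) (u'' i)"
    and cont: "continuous_on UNIV u" "\<And>i. continuous_on UNIV (u' i)" "\<And>i. continuous_on UNIV (u'' i)"
    and lim: "(u \<longlongrightarrow> 0) at_infinity"
    and fin: "(\<integral>\<^sup>+x. ennreal (\<bar>\<Sum>i\<in>UNIV. u'' i x\<bar> powr (6 / 5)) \<partial>lborel) < \<infinity>"
  shows "(\<integral>\<^sup>+x. ennreal (u x ^ 6) \<partial>lborel) < \<infinity>"
proof -
  obtain N where N: "(\<integral>\<^sup>+x. ennreal (\<bar>\<Sum>i\<in>UNIV. u'' i x\<bar> powr (6 / 5)) \<partial>lborel) = ennreal N" "0 \<le> N"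
    using fin by (cases "\<integral>\<^sup>+x. ennreal (\<bar>\<Sum>i\<in>UNIV. u'' i x\<bar> powr (6 / 5)) \<partial>lborel" rule: ennreal_cases) auto
  have [measurable]: "(\<lambda>x. trunc e (u x)) \<in> borel_measurable borel" if "0 < e" for e
    by (intro borel_measurable_continuous_onI continuous_on_compose2[OF continuous_trunc[OF that] cont(1)]) auto
  have "(\<integral>\<^sup>+x. ennreal (u x ^ 6) \<partial>lborel) \<le> ennreal (10368 * 663552 * N ^ 5)"
  proof (rule nn_integral_limit_le[where f = "\<lambda>n x. trunc (1 / real (Suc n)) (u x) ^ 6"])
    show "(\<lambda>n. trunc (1 / real (Suc n)) (u x) ^ 6) \<longlonglongrightarrow> u x ^ 6" for x
      by (intro tendsto_power trunc_tendsto LIMSEQ_Suc[OF lim_1_over_n])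
    show "(\<integral>\<^sup>+ x. ennreal (trunc (1 / real (Suc n)) (u x) ^ 6) \<partial>lborel) \<le> ennreal (10368 * 663552 * N ^ 5)" for n
      by (rule truncated_energy_estimate[OF part cont lim]) (use N in auto)
  qed simp
  then show ?thesis
    by (rule le_less_trans) simp
qed

section \<open>Square integrability of the gradient\<close>

lemma nn_integral_cube_const:
  assumes "0 \<le> r" "0 \<le> c"
  shows "(\<integral>\<^sup>+x. ennreal (c * indicator (cube r) x) \<partial>lborel) = ennreal (8 * r ^ 3 * c)"
proof -
  have "\<forall>b\<in>Basis. ((\<chi> i. - r) :: real ^ 3) \<bullet> b \<le> (\<chi> i. r) \<bullet> b"
    using assms by (auto simp: Basis_vec_def inner_axis)
  then have "emeasure lborel (cube r) = ennreal (8 * r ^ 3)"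
    unfolding cube_eq_cbox emeasure_lborel_cbox_eq prod_Basis_cart
    by (simp add: inner_axis power_mult_distrib)
  then show ?thesis
    using assms by (simp add: ennreal_mult ennreal_indicator nn_integral_cmult_indicator mult_ac)
qed

text \<open>A Caccioppoli estimate: the equation is tested with \<open>u\<close> times the square of
  a cutoff at scale \<open>R\<close>. Letting \<open>e\<close> tend to 0 in the truncated estimate
  would bound the gradient only where \<open>u\<close> is nonzero, since
  \<open>trunc' e 0 = 0\<close>. The error term is of order \<open>u\<^sup>2 / R\<^sup>2\<close>;
  splitting at \<open>u\<^sup>2 = 1 / R\<close> bounds it by \<open>u ^ 6 + 1 / R ^ 3\<close>, and
  both parts have bounded integrals over a cube of volume of order \<open>R ^ 3\<close>.\<close>

lemma integrable_gradient_L2: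
  assumes part: "\<And>i. has_partial i u (u' i)" "\<And>i. has_partial i (u' i) (u'' i)"
    and cont: "continuous_on UNIV u" "\<And>i. continuous_on UNIV (u' i)" "\<And>i. continuous_on UNIV (u'' i)"
    and fin6: "(\<integral>\<^sup>+x. ennreal (u x ^ 6) \<partial>lborel) < \<infinity>"
    and fin: "(\<integral>\<^sup>+x. ennreal (\<bar>\<Sum>i\<in>UNIV. u'' i x\<bar> powr (6 / 5)) \<partial>lborel) < \<infinity>"
  shows "(\<integral>\<^sup>+x. ennreal (\<Sum>i\<in>UNIV. (u' i x)\<^sup>2) \<partial>lborel) < \<infinity>"
proof -
  define f where "f x = (\<Sum>i\<in>UNIV. u'' i x)" for x
  define G where "G x = (\<Sum>i\<in>UNIV. (u' i x)\<^sup>2)" for x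
  have cf: "continuous_on UNIV f" unfolding f_def by (intro continuous_intros cont)
  have cG: "continuous_on UNIV G" unfolding G_def by (intro continuous_intros cont)
  have [measurable]: "u \<in> borel_measurable borel" "f \<in> borel_measurable borel" "G \<in> borel_measurable borel"
    using cont cf cG by (auto intro: borel_measurable_continuous_onI)
  \<comment> \<open>Here 66 = 2 * (1 + 32), with 1 from Young's inequality for \<open>u * f\<close>
    and 32 from the derivative of the cutoff; 4096 = 2 * (8 * 2 ^ 3 * 32) comes from the volume of
    the cube. The common factor 2 undoes the absorption of half of the gradient term.\<close>
  define C where "C = 66 * (\<integral>\<^sup>+x. ennreal (u x ^ 6) \<partial>lborel)
    + 2 * (\<integral>\<^sup>+x. ennreal (\<bar>f x\<bar> powr (6 / 5)) \<partial>lborel) + 4096"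
  define \<psi> where "\<psi> R x = (max 0 (1 - (x \<bullet> x) / R\<^sup>2))\<^sup>2" for R :: real and x :: "real ^ 3"
  have main: "(\<integral>\<^sup>+x. ennreal ((\<psi> R x)\<^sup>2 * G x) \<partial>lborel) \<le> C" if R: "1 \<le> R" for R
  proof -
    define m where "m x = max 0 (1 - (x \<bullet> x) / R\<^sup>2)" for x :: "real ^ 3"
    define \<phi> where "\<phi> x = (m x)\<^sup>2" for x
    define \<phi>' where "\<phi>' i x = 2 * m x * (- 2 * x $ i / R\<^sup>2)" for i x
    have m0: "0 \<le> m x" "m x \<le> 1" for x
      by (auto simp: m_def)
    have supp: "m x = 0" if "x \<notin> cube R" for x
    proof -
      have "R\<^sup>2 \<le> (norm x)\<^sup>2"
        using not_in_cube[OF that] R by (intro power_mono) auto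
      then show ?thesis
        using R by (simp add: m_def dot_square_norm divide_simps)
    qed
    have cm: "continuous_on UNIV m" unfolding m_def by (intro continuous_intros) (use R in auto)
    have c\<phi>: "continuous_on UNIV \<phi>" unfolding \<phi>_def by (intro continuous_intros cm)
    have c\<phi>': "continuous_on UNIV (\<phi>' i)" for i unfolding \<phi>'_def by (intro continuous_intros cm) (use R in auto)
    have "has_partial i (\<lambda>x. 1 - (x \<bullet> x) / R\<^sup>2) (\<lambda>x. - 2 * x $ i / R\<^sup>2)" for i
      unfolding has_partial_def
    proof
      fix x :: "real ^ 3"
      have "(\<lambda>t. 1 - ((x + t *\<^sub>R axis i 1) \<bullet> (x + t *\<^sub>R axis i 1)) / R\<^sup>2)
          = (\<lambda>t. 1 - (x \<bullet> x + 2 * t * x $ i + t\<^sup>2) / R\<^sup>2)"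
        by (auto simp: inner_add_left inner_add_right inner_axis inner_axis' power2_eq_square algebra_simps)
      moreover have "((\<lambda>t. 1 - (x \<bullet> x + 2 * t * x $ i + t\<^sup>2) / R\<^sup>2) has_real_derivative - 2 * x $ i / R\<^sup>2) (at 0)"
        using R by (auto intro!: derivative_eq_intros simp: divide_simps eval_nat_numeral)
      ultimately show "((\<lambda>t. 1 - ((x + t *\<^sub>R axis i 1) \<bullet> (x + t *\<^sub>R axis i 1)) / R\<^sup>2) has_real_derivative - 2 * x $ i / R\<^sup>2) (at 0)"
        by simp
    qed
    from has_partial_chain[OF DERIV_max0_square this] have p\<phi>: "has_partial i \<phi> (\<phi>' i)" for i
      unfolding \<phi>_def \<phi>'_def m_def .
    define X' where "X' i x = ((\<phi>' i x * \<phi> x + \<phi> x * \<phi>' i x) * u x + (\<phi> x * \<phi> x) * u' i x) * u' i x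
        + (\<phi> x * \<phi> x * u x) * u'' i x" for i x
    have pX: "has_partial i (\<lambda>x. \<phi> x * \<phi> x * u x * u' i x) (X' i)" for i
      unfolding X'_def by (intro has_partial_mult p\<phi> part)
    have cX': "continuous_on UNIV (X' i)" for i
      unfolding X'_def by (intro continuous_intros c\<phi> c\<phi>' cont)
    have [measurable]: "\<phi> \<in> borel_measurable borel"
      using c\<phi> by (rule borel_measurable_continuous_onI)
    define K where "K = cube (R + 1)"
    have K0: "m x = 0" if "x \<notin> K" for x
      using that by (intro supp) (auto simp: K_def cube_def intro: order_trans[of _ R])
    have zero: "(\<integral>x. (\<Sum>i\<in>UNIV. X' i x) * indicator K x \<partial>lborel) = 0"
      unfolding K_def
      by (rule divergence_compact_support[OF pX _ cX', where r = R])
         (use supp R in \<open>auto intro!: continuous_intros cm cont simp: \<phi>_def\<close>)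
    define Z where "Z x = \<bar>u x\<bar> * \<bar>f x\<bar> + 32 * (u x ^ 6 + 1 / R ^ 3)" for x
    have cZ: "continuous_on UNIV Z"
      unfolding Z_def by (intro continuous_intros cont cf)
    \<comment> \<open>The cross term is split by -2 a b \<le> a^2 / 2 + 2 b^2, which costs half of
      \<open>\<phi> ^ 2 * G\<close>; all that remains is collected in \<open>Z\<close>.\<close>
    have pw: "\<phi> x ^ 2 * G x / 2 \<le> (\<Sum>i\<in>UNIV. X' i x) + Z x" if "x \<in> K" for x
    proof -
      have "(\<Sum>i\<in>UNIV. X' i x) = \<phi> x ^ 2 * G x + \<phi> x ^ 2 * (u x * f x) + (\<Sum>i\<in>UNIV. 2 * (\<phi> x * u' i x) * (\<phi>' i x * u x))"
        by (simp add: X'_def G_def f_def sum.distrib sum_distrib_left sum_distrib_right power2_eq_square algebra_simps)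
      moreover have "- (\<Sum>i\<in>UNIV. 2 * (\<phi> x * u' i x) * (\<phi>' i x * u x)) \<le> (\<Sum>i\<in>UNIV. (\<phi> x * u' i x)\<^sup>2 / 2 + 2 * (\<phi>' i x * u x)\<^sup>2)"
        unfolding sum_negf[symmetric]
      proof (intro sum_mono)
        fix i :: 3
        have "0 \<le> (\<phi> x * u' i x + 2 * (\<phi>' i x * u x))\<^sup>2 / 2"
          by simp
        also have "\<dots> = (\<phi> x * u' i x)\<^sup>2 / 2 + 2 * (\<phi>' i x * u x)\<^sup>2 + 2 * (\<phi> x * u' i x) * (\<phi>' i x * u x)"
          by (simp add: power2_eq_square field_simps)
        finally show "- (2 * (\<phi> x * u' i x) * (\<phi>' i x * u x)) \<le> (\<phi> x * u' i x)\<^sup>2 / 2 + 2 * (\<phi>' i x * u x)\<^sup>2"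
          by simp
      qed
      moreover have "(\<Sum>i\<in>UNIV. (\<phi> x * u' i x)\<^sup>2 / 2 + 2 * (\<phi>' i x * u x)\<^sup>2) = \<phi> x ^ 2 * G x / 2 + 2 * (u x)\<^sup>2 * (\<Sum>i\<in>UNIV. (\<phi>' i x)\<^sup>2)"
        by (simp add: G_def sum.distrib sum_distrib_left sum_divide_distrib power_mult_distrib mult_ac)
      moreover have "2 * (u x)\<^sup>2 * (\<Sum>i\<in>UNIV. (\<phi>' i x)\<^sup>2) \<le> 32 * (u x ^ 6 + 1 / R ^ 3)"
      proof -
        have s: "(\<Sum>i\<in>UNIV. (\<phi>' i x)\<^sup>2) \<le> 16 / R\<^sup>2"
        proof -
          have "(\<Sum>i\<in>UNIV. (\<phi>' i x)\<^sup>2) = 16 * (m x)\<^sup>2 * ((x \<bullet> x) / R\<^sup>2) / R\<^sup>2"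
            by (simp add: \<phi>'_def inner_vec_def sum_distrib_left sum_divide_distrib power2_eq_square mult_ac)
          also have "(m x)\<^sup>2 * ((x \<bullet> x) / R\<^sup>2) \<le> 1"
          proof (cases "(x \<bullet> x) / R\<^sup>2 \<le> 1")
            case True
            then show ?thesis
              using m0[of x] by (intro mult_le_one power_le_one) auto
          qed (auto simp: m_def)
          then have "16 * (m x)\<^sup>2 * ((x \<bullet> x) / R\<^sup>2) / R\<^sup>2 \<le> 16 / R\<^sup>2"
            by (intro divide_right_mono) auto
          finally show ?thesis .
        qed
        have "(u x)\<^sup>2 / R\<^sup>2 \<le> u x ^ 6 + 1 / R ^ 3"
        proof (cases "(u x)\<^sup>2 \<le> 1 / R")
          case True
          then have "(u x)\<^sup>2 / R\<^sup>2 \<le> 1 / R / R\<^sup>2"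
            by (intro divide_right_mono) auto
          then show ?thesis
            by (simp add: power2_eq_square power3_eq_cube add_increasing)
        next
          case False
          then have "(1 / R)\<^sup>2 \<le> ((u x)\<^sup>2)\<^sup>2"
            using R by (intro power_mono) auto
          then have "(u x)\<^sup>2 * (1 / R)\<^sup>2 \<le> (u x)\<^sup>2 * ((u x)\<^sup>2)\<^sup>2"
            by (intro mult_left_mono) auto
          also have "\<dots> = u x ^ 6"
            by (simp flip: power_mult power_add)
          finally show ?thesis
            using R by (simp add: power_divide add_increasing2)
        qed
        moreover have "2 * (u x)\<^sup>2 * (\<Sum>i\<in>UNIV. (\<phi>' i x)\<^sup>2) \<le> 2 * (u x)\<^sup>2 * (16 / R\<^sup>2)"
          by (intro mult_left_mono s) auto
        ultimately show ?thesis by simp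
      qed
      moreover have "- (\<phi> x ^ 2 * (u x * f x)) \<le> \<bar>u x\<bar> * \<bar>f x\<bar>"
      proof -
        have "- (\<phi> x ^ 2 * (u x * f x)) \<le> \<phi> x ^ 2 * (\<bar>u x\<bar> * \<bar>f x\<bar>)"
          unfolding abs_mult[symmetric] minus_mult_right by (intro mult_left_mono) auto
        also have "\<dots> \<le> 1 * (\<bar>u x\<bar> * \<bar>f x\<bar>)"
          using m0[of x] by (intro mult_right_mono) (auto simp: \<phi>_def power_le_one)
        finally show ?thesis by simp
      qed
      ultimately show ?thesis
        unfolding Z_def by linarith
    qed
    have int1: "integrable lborel (\<lambda>x. \<phi> x ^ 2 * G x * indicator K x)"
      unfolding K_def by (intro integrable_on_cube continuous_intros c\<phi> cG)
    have int2: "integrable lborel (\<lambda>x. (\<Sum>i\<in>UNIV. X' i x) * indicator K x)" "integrable lborel (\<lambda>x. Z x * indicator K x)"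
      unfolding K_def by (intro integrable_on_cube continuous_intros cX' cZ)+
    have G0: "0 \<le> G x" for x by (simp add: G_def sum_nonneg)
    have Z0: "0 \<le> Z x" for x using R by (simp add: Z_def)
    have "(\<integral>x. \<phi> x ^ 2 * G x * indicator K x \<partial>lborel)
        \<le> (\<integral>x. 2 * ((\<Sum>i\<in>UNIV. X' i x) * indicator K x + Z x * indicator K x) \<partial>lborel)"
    proof (intro integral_mono int1 integrable_mult_right Bochner_Integration.integrable_add int2)
      fix x
      show "\<phi> x ^ 2 * G x * indicator K x \<le> 2 * ((\<Sum>i\<in>UNIV. X' i x) * indicator K x + Z x * indicator K x)"
        using pw[of x] by (auto simp: indicator_def)
    qed
    also have "\<dots> = 2 * (\<integral>x. Z x * indicator K x \<partial>lborel)"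
      using int2 zero by simp
    finally have le: "(\<integral>x. \<phi> x ^ 2 * G x * indicator K x \<partial>lborel) \<le> 2 * (\<integral>x. Z x * indicator K x \<partial>lborel)" .
    have "(\<integral>\<^sup>+x. ennreal ((\<psi> R x)\<^sup>2 * G x) \<partial>lborel) = (\<integral>\<^sup>+x. ennreal (\<phi> x ^ 2 * G x * indicator K x) \<partial>lborel)"
    proof (intro nn_integral_cong)
      show "ennreal ((\<psi> R x)\<^sup>2 * G x) = ennreal (\<phi> x ^ 2 * G x * indicator K x)" for x
        using K0[of x] by (cases "x \<in> K") (simp_all add: \<psi>_def \<phi>_def flip: m_def)
    qed
    also have "\<dots> = ennreal (\<integral>x. \<phi> x ^ 2 * G x * indicator K x \<partial>lborel)"
      by (rule nn_integral_eq_integral[OF int1]) (auto simp: G0)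
    also have "\<dots> \<le> ennreal (2 * (\<integral>x. Z x * indicator K x \<partial>lborel))"
      by (rule ennreal_leI[OF le])
    also have "\<dots> = 2 * ennreal (\<integral>x. Z x * indicator K x \<partial>lborel)"
      by (simp add: ennreal_mult')
    also have "ennreal (\<integral>x. Z x * indicator K x \<partial>lborel) = (\<integral>\<^sup>+x. ennreal (Z x * indicator K x) \<partial>lborel)"
      by (rule nn_integral_eq_integral[symmetric, OF int2(2)]) (auto simp: Z0)
    also have "\<dots> \<le> (\<integral>\<^sup>+x. 33 * ennreal (u x ^ 6) + ennreal (\<bar>f x\<bar> powr (6 / 5)) + ennreal (32 / R ^ 3 * indicator K x) \<partial>lborel)"
    proof (intro nn_integral_mono)
      fix x
      have "Z x * indicator K x \<le> 33 * u x ^ 6 + \<bar>f x\<bar> powr (6 / 5) + 32 / R ^ 3 * indicator K x"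
        using young_6_5[of "\<bar>u x\<bar>" "\<bar>f x\<bar>" 1] by (auto simp: Z_def indicator_def)
      then have "ennreal (Z x * indicator K x) \<le> ennreal (33 * u x ^ 6 + \<bar>f x\<bar> powr (6 / 5) + 32 / R ^ 3 * indicator K x)"
        by (rule ennreal_leI)
      also have "\<dots> = 33 * ennreal (u x ^ 6) + ennreal (\<bar>f x\<bar> powr (6 / 5)) + ennreal (32 / R ^ 3 * indicator K x)"
        using R by (simp add: ennreal_plus ennreal_mult)
      finally show "ennreal (Z x * indicator K x) \<le> \<dots>" .
    qed
    also have "\<dots> = 33 * (\<integral>\<^sup>+x. ennreal (u x ^ 6) \<partial>lborel) + (\<integral>\<^sup>+x. ennreal (\<bar>f x\<bar> powr (6 / 5)) \<partial>lborel)
        + (\<integral>\<^sup>+x. ennreal (32 / R ^ 3 * indicator K x) \<partial>lborel)"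
      unfolding K_def by (subst nn_integral_add; (subst nn_integral_add)?) (auto simp: nn_integral_cmult)
    also have "(\<integral>\<^sup>+x. ennreal (32 / R ^ 3 * indicator K x) \<partial>lborel) = ennreal (8 * (R + 1) ^ 3 * (32 / R ^ 3))"
      unfolding K_def using R by (intro nn_integral_cube_const) auto
    also have "\<dots> \<le> ennreal 2048"
    proof (rule ennreal_leI)
      have "(R + 1) ^ 3 \<le> (2 * R) ^ 3"
        using R by (intro power_mono) auto
      then show "8 * (R + 1) ^ 3 * (32 / R ^ 3) \<le> 2048"
        using R by (simp add: divide_simps power_mult_distrib)
    qed
    finally have "(\<integral>\<^sup>+x. ennreal ((\<psi> R x)\<^sup>2 * G x) \<partial>lborel)
        \<le> 2 * (33 * (\<integral>\<^sup>+x. ennreal (u x ^ 6) \<partial>lborel) + (\<integral>\<^sup>+x. ennreal (\<bar>f x\<bar> powr (6 / 5)) \<partial>lborel) + ennreal 2048)"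
      by (simp add: mult_left_mono add_left_mono)
    also have "\<dots> = C"
      by (simp add: C_def distrib_left mult.assoc[symmetric])
    finally show ?thesis .
  qed
  have "(\<integral>\<^sup>+x. ennreal (G x) \<partial>lborel) \<le> C"
  proof (rule nn_integral_limit_le[where f = "\<lambda>n x. (\<psi> (real (Suc n)) x)\<^sup>2 * G x"])
    show "(\<lambda>x. (\<psi> (real (Suc n)) x)\<^sup>2 * G x) \<in> borel_measurable lborel" for n
      unfolding \<psi>_def by measurable
    show "(\<lambda>n. (\<psi> (real (Suc n)) x)\<^sup>2 * G x) \<longlonglongrightarrow> G x" for x
    proof -
      have "(\<lambda>n. (x \<bullet> x) * (1 / real (Suc n))\<^sup>2) \<longlonglongrightarrow> (x \<bullet> x) * 0\<^sup>2"
        by (intro tendsto_intros LIMSEQ_Suc[OF lim_1_over_n])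
      then have "(\<lambda>n. ((max 0 (1 - (x \<bullet> x) * (1 / real (Suc n))\<^sup>2))\<^sup>2)\<^sup>2 * G x) \<longlonglongrightarrow> ((max 0 (1 - (x \<bullet> x) * 0\<^sup>2))\<^sup>2)\<^sup>2 * G x"
        by (intro tendsto_intros LIMSEQ_Suc[OF lim_1_over_n])
      then show ?thesis
        by (simp add: \<psi>_def power_divide)
    qed
    show "(\<integral>\<^sup>+ x. ennreal ((\<psi> (real (Suc n)) x)\<^sup>2 * G x) \<partial>lborel) \<le> C" for n
      by (rule main) simp
  qed
  also have "C < \<infinity>"
    using fin6 fin by (simp add: C_def f_def ennreal_mult_less_top)
  finally show ?thesis
    by (simp add: G_def)
qed

section \<open>A Poincare inequality on the surface of a cube\<close>

text \<open>The points are written in the coordinates of the inner direction of integration, so that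
  the inner integrals are integrals along coordinate lines.\<close>

lemma face_iterated:
  assumes [measurable]: "g \<in> borel_measurable borel"
  shows "face r i s g = (\<integral>\<^sup>+z. (\<integral>\<^sup>+y. ennreal (g (pt (i + 1) y (z, s))) * indicator {-r..r} y \<partial>lborel) * indicator {-r..r} z \<partial>lborel)"
    and "face r i s g = (\<integral>\<^sup>+y. (\<integral>\<^sup>+z. ennreal (g (pt (i + 2) z (s, y))) * indicator {-r..r} z \<partial>lborel) * indicator {-r..r} y \<partial>lborel)"
proof -
  have ind: "indicator (square r) (y, z) = (indicator {-r..r} y * indicator {-r..r} z :: ennreal)" for y z
    by (simp add: square_def indicator_times)
  have [measurable]: "(\<lambda>p. pt k (fst p) (snd p, c)) \<in> borel_measurable borel" "(\<lambda>p. pt k (fst p) (c, snd p)) \<in> borel_measurable borel"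
    "(\<lambda>p. pt k d (p, c)) \<in> borel_measurable borel" "(\<lambda>p. pt k d (c, p)) \<in> borel_measurable borel" for k c d
    by (intro borel_measurable_continuous_onI continuous_intros)+
  have [measurable]: "(\<lambda>q. ennreal (g (pt i s q)) * indicator (square r) q) \<in> borel_measurable borel"
    by measurable
  show "face r i s g = (\<integral>\<^sup>+z. (\<integral>\<^sup>+y. ennreal (g (pt (i + 1) y (z, s))) * indicator {-r..r} y \<partial>lborel) * indicator {-r..r} z \<partial>lborel)"
    unfolding face_def
    by (subst nn_integral_plane(2))
       (auto simp: ind pt_shift1 nn_integral_cmult mult_ac intro!: nn_integral_cong)
  show "face r i s g = (\<integral>\<^sup>+y. (\<integral>\<^sup>+z. ennreal (g (pt (i + 2) z (s, y))) * indicator {-r..r} z \<partial>lborel) * indicator {-r..r} y \<partial>lborel)"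
    unfolding face_def
    by (subst nn_integral_plane(1))
       (auto simp: ind pt_shift2 nn_integral_cmult mult_ac intro!: nn_integral_cong)
qed

text \<open>The mean over an interval of length \<open>2 * r\<close> is at most
  \<open>I / (2 * r)\<close>; allowing twice this makes the contradiction strict.\<close>

lemma ex_le_mean:
  assumes "(\<integral>\<^sup>+t. h t * indicator {-r..r} t \<partial>lborel) \<le> ennreal I" "0 < I" "0 < r"
  shows "\<exists>a\<in>{-r..r}. h a \<le> ennreal (I / r)"
proof (rule ccontr)
  assume "\<not> ?thesis"
  then have "ennreal (I / r) \<le> h a" if "a \<in> {-r..r}" for a
    using that by (auto intro: less_imp_le simp: not_le)
  then have "(\<integral>\<^sup>+t. ennreal (I / r) * indicator {-r..r} t \<partial>lborel) \<le> (\<integral>\<^sup>+t. h t * indicator {-r..r} t \<partial>lborel)"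
    by (intro nn_integral_mono) (auto simp: indicator_def)
  also have "(\<integral>\<^sup>+t. ennreal (I / r) * indicator {-r..r} t \<partial>lborel) = ennreal (2 * I)"
    using assms by (simp add: nn_integral_cmult_indicator flip: ennreal_mult)
  finally have "ennreal (2 * I) \<le> ennreal I"
    using assms(1) by (rule order_trans)
  then show False
    using assms by simp
qed

text \<open>Choose coordinates \<open>a j\<close> such that on the closed curve cut out of the surface by \<open>x j = a j\<close> the
  integral of \<open>\<bar>\<nabla>F\<bar>\<close> is at most its mean. These three curves meet pairwise, and every point of a
  face is joined to them by a segment in each of the two coordinate directions of the face. The
  product of the two resulting bounds for \<open>\<bar>F - c\<bar>\<close> separates the variables.\<close>

lemma surface_poincare:
  assumes part: "\<And>i. has_partial i F (F' i)"
    and cont: "continuous_on UNIV F" "\<And>i. continuous_on UNIV (F' i)"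
    and r: "0 < r" and I: "0 < I" "surf r (\<lambda>x. \<Sum>i\<in>UNIV. \<bar>F' i x\<bar>) \<le> ennreal I"
  shows "\<exists>c. surf r (\<lambda>x. (F x - c)\<^sup>2) \<le> ennreal (726 * I\<^sup>2)"
proof -
  have [measurable]: "F \<in> borel_measurable borel" "F' i \<in> borel_measurable borel" for i
    using cont by (auto intro: borel_measurable_continuous_onI)
  define line where "line j q = (\<integral>\<^sup>+t. ennreal \<bar>F' j (pt j t q)\<bar> * indicator {-r..r} t \<partial>lborel)" for j q
  have [measurable]: "(\<lambda>z. line j (z, s)) \<in> borel_measurable borel" "(\<lambda>z. line j (s, z)) \<in> borel_measurable borel" for j s
  proof -
    have [measurable]: "(\<lambda>p. pt j (snd p) (fst p, s)) \<in> borel_measurable borel" "(\<lambda>p. pt j (snd p) (s, fst p)) \<in> borel_measurable borel"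
      by (intro borel_measurable_continuous_onI continuous_intros)+
    have "(\<lambda>p. ennreal \<bar>F' j (pt j (snd p) (fst p, s))\<bar> * indicator {-r..r} (snd p)) \<in> borel_measurable (borel \<Otimes>\<^sub>M lborel)"
      by measurable
    from lborel.borel_measurable_nn_integral_fst[OF this] show "(\<lambda>z. line j (z, s)) \<in> borel_measurable borel"
      by (simp add: line_def)
    have "(\<lambda>p. ennreal \<bar>F' j (pt j (snd p) (s, fst p))\<bar> * indicator {-r..r} (snd p)) \<in> borel_measurable (borel \<Otimes>\<^sub>M lborel)"
      by measurable
    from lborel.borel_measurable_nn_integral_fst[OF this] show "(\<lambda>z. line j (s, z)) \<in> borel_measurable borel"
      by (simp add: line_def)
  qed
  have diff: "ennreal \<bar>F (pt j x q) - F (pt j y q)\<bar> \<le> line j q" if "x \<in> {-r..r}" "y \<in> {-r..r}" for j x y q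
    unfolding line_def by (rule abs_diff_pt_le[OF part cont(2) that])
  have face1: "(\<integral>\<^sup>+z. line (i + 1) (z, s) * indicator {-r..r} z \<partial>lborel) = face r i s (\<lambda>x. \<bar>F' (i + 1) x\<bar>)" for i s
    unfolding line_def by (rule face_iterated(1)[symmetric]) measurable
  have face2: "(\<integral>\<^sup>+y. line (i + 2) (s, y) * indicator {-r..r} y \<partial>lborel) = face r i s (\<lambda>x. \<bar>F' (i + 2) x\<bar>)" for i s
    unfolding line_def by (rule face_iterated(2)[symmetric]) measurable
  define D where "D x = (\<Sum>i\<in>UNIV. \<bar>F' i x\<bar>)" for x
  have face_D: "face r i s (\<lambda>x. \<bar>F' k x\<bar>) \<le> face r i s D" for i s k
    unfolding D_def by (intro face_mono member_le_sum) auto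
  have surf_D: "surf r D = (face r (j + 1) r D + face r (j + 1) (- r) D) + (face r (j + 2) r D + face r (j + 2) (- r) D)
      + (face r j r D + face r j (- r) D)" for j
    unfolding surf_def sum_cyclic3[of _ j] by (simp add: add_ac)
  have ID: "surf r D \<le> ennreal I"
    using I by (simp add: D_def[abs_def])
  have face_I: "face r i s (\<lambda>x. \<bar>F' k x\<bar>) \<le> ennreal I" if "s \<in> {r, - r}" for i s k
  proof -
    have "face r i s D \<le> surf r D"
      using that unfolding surf_D[of i] by (auto simp: add_increasing add_increasing2)
    then show ?thesis
      using ID face_D by (blast intro: order_trans)
  qed
  define M where "M = I / r"
  have M: "0 < M" using I r by (simp add: M_def)
  \<comment> \<open>The four terms are the four segments of the closed curve: two on the faces
    normal to direction \<open>j + 1\<close> and two on those normal to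
    \<open>j + 2\<close>.\<close>
  have "\<exists>a\<in>{-r..r}. (line (j + 2) (a, r) + line (j + 2) (a, - r)) + (line (j + 1) (r, a) + line (j + 1) (- r, a)) \<le> ennreal M" for j
    unfolding M_def
  proof (rule ex_le_mean)
    have "(\<integral>\<^sup>+a. ((line (j + 2) (a, r) + line (j + 2) (a, - r)) + (line (j + 1) (r, a) + line (j + 1) (- r, a))) * indicator {-r..r} a \<partial>lborel)
      = (face r (j + 1) r (\<lambda>x. \<bar>F' (j + 2) x\<bar>) + face r (j + 1) (- r) (\<lambda>x. \<bar>F' (j + 2) x\<bar>))
      + (face r (j + 2) r (\<lambda>x. \<bar>F' (j + 1) x\<bar>) + face r (j + 2) (- r) (\<lambda>x. \<bar>F' (j + 1) x\<bar>))"
      using face1[of "j + 1"] face2[of "j + 2"] by (simp add: distrib_right nn_integral_add)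
    also have "\<dots> \<le> (face r (j + 1) r D + face r (j + 1) (- r) D) + (face r (j + 2) r D + face r (j + 2) (- r) D)"
      by (intro add_mono face_D)
    also have "\<dots> \<le> surf r D"
      unfolding surf_D[of j] by (rule add_increasing2) auto
    finally show "(\<integral>\<^sup>+a. ((line (j + 2) (a, r) + line (j + 2) (a, - r)) + (line (j + 1) (r, a) + line (j + 1) (- r, a))) * indicator {-r..r} a \<partial>lborel)
      \<le> ennreal I"
      using ID by (rule order_trans)
  qed (use I r in auto)
  then obtain a where a: "\<And>j. a j \<in> {-r..r}" and
    a_sum: "\<And>j. (line (j + 2) (a j, r) + line (j + 2) (a j, - r)) + (line (j + 1) (r, a j) + line (j + 1) (- r, a j)) \<le> ennreal M"
    by metis
  have lineM: "line (j + 2) (a j, s) \<le> ennreal M" "line (j + 1) (s, a j) \<le> ennreal M" if "s \<in> {r, - r}" for j s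
    using that by (auto intro!: order_trans[OF _ a_sum[of j]] simp: add_increasing add_increasing2)
  have line1: "line (i + 1) (a (i + 2), s) \<le> ennreal M" if "s \<in> {r, - r}" for i s
    using lineM(1)[OF that, of "i + 2"] by simp
  have line2: "line (i + 2) (s, a (i + 1)) \<le> ennreal M" if "s \<in> {r, - r}" for i s
    using lineM(2)[OF that, of "i + 1"] by simp
  \<comment> \<open>The value of \<open>F\<close> where the curves for \<open>i + 1\<close> and
    \<open>i + 2\<close> cross on a face normal to direction \<open>i\<close>.\<close>
  define cen where "cen i s = F (pt i s (a (i + 1), a (i + 2)))" for i s
  have real_le: "x \<le> M" if "ennreal x \<le> ennreal M" for x
    using that M by (simp add: ennreal_le_iff)
  \<comment> \<open>Both crossing points lie on the curve for \<open>i + 2\<close>; the path along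
    it passes over the common edge of the two faces, with one segment on each.\<close>
  have adj: "\<bar>cen i s - cen (i + 1) t\<bar> \<le> 2 * M" if s: "s \<in> {r, - r}" and t: "t \<in> {r, - r}" for i s t
  proof -
    have sr: "s \<in> {-r..r}" "t \<in> {-r..r}" using s t r by auto
    have "\<bar>F (pt (i + 1) (a (i + 1)) (a (i + 2), s)) - F (pt (i + 1) t (a (i + 2), s))\<bar> \<le> M"
      by (intro real_le order_trans[OF diff line1] a sr s)
    moreover have "\<bar>F (pt (i + 1 + 2) s (t, a (i + 1 + 1))) - F (pt (i + 1 + 2) (a i) (t, a (i + 1 + 1)))\<bar> \<le> M"
      by (intro real_le order_trans[OF diff line2] a sr t)
    ultimately have "\<bar>F (pt i s (a (i + 1), a (i + 2))) - F (pt i s (t, a (i + 2)))\<bar> \<le> M"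
      "\<bar>F (pt i s (t, a (i + 2))) - F (pt i (a i) (t, a (i + 2)))\<bar> \<le> M"
      by (simp_all add: pt_shift1)
    moreover have "cen (i + 1) t = F (pt i (a i) (t, a (i + 2)))"
      by (simp add: cen_def pt_shift1)
    ultimately show ?thesis
      unfolding cen_def by linarith
  qed
  define c where "c = cen 1 r"
  \<comment> \<open>Opposite faces share no edge and are compared through an adjacent one, which
    doubles the bound.\<close>
  have cen: "\<bar>cen i s - c\<bar> \<le> 4 * M" if s: "s \<in> {r, - r}" for i s
  proof -
    have 1: "\<bar>cen 1 s - cen 2 r\<bar> \<le> 2 * M" "\<bar>cen 1 r - cen 2 r\<bar> \<le> 2 * M" "\<bar>cen 1 r - cen 2 s\<bar> \<le> 2 * M"
      using adj[of _ _ 1] s by auto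
    have "\<bar>cen 3 s - cen (3 + 1) r\<bar> \<le> 2 * M"
      by (rule adj[OF s]) simp
    moreover have "(3 :: 3) + 1 = 1" by simp
    ultimately have 3: "\<bar>cen 3 s - cen 1 r\<bar> \<le> 2 * M"
      by (simp only:)
    show ?thesis
      using exhaust_3[of i] 1 3 M unfolding c_def by auto
  qed
  have face: "face r i s (\<lambda>x. (F x - c)\<^sup>2) \<le> ennreal (121 * I\<^sup>2)" if s: "s \<in> {r, - r}" for i s
  proof -
    have sr: "s \<in> {-r..r}" using s r by auto
    \<comment> \<open>Of the \<open>5 * M\<close>, \<open>4 * M\<close> leads from \<open>c\<close>
      to the crossing point of the face and \<open>M\<close> along one of the curves. Integrated
      over \<open>{-r..r}\<close> this is \<open>10 * I\<close>, and the line term adds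
      \<open>I\<close>; hence 121 = 11 ^ 2 for each face and 726 for all six.\<close>
    define A where "A z = line (i + 1) (z, s) + ennreal (5 * M)" for z
    define B where "B y = line (i + 2) (s, y) + ennreal (5 * M)" for y
    have [measurable]: "A \<in> borel_measurable borel" "B \<in> borel_measurable borel"
      unfolding A_def B_def by measurable
    have pw: "ennreal ((F (pt i s (y, z)) - c)\<^sup>2) \<le> B y * A z" if yz: "y \<in> {-r..r}" "z \<in> {-r..r}" for y z
    proof -
      let ?d = "\<bar>F (pt i s (y, z)) - c\<bar>"
      have tri: "ennreal ?d \<le> L + ennreal (5 * M)"
        if "ennreal \<bar>F (pt i s (y, z)) - e\<bar> \<le> L" "\<bar>e - cen i s\<bar> \<le> M" for e L
      proof -
        have "?d \<le> \<bar>F (pt i s (y, z)) - e\<bar> + 5 * M"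
          using that(2) cen[OF s, of i] by linarith
        then have "ennreal ?d \<le> ennreal \<bar>F (pt i s (y, z)) - e\<bar> + ennreal (5 * M)"
          using M by (simp flip: ennreal_plus add: ennreal_leI)
        then show ?thesis
          using that(1) by (meson add_right_mono order_trans)
      qed
      have "ennreal \<bar>F (pt (i + 1) y (z, s)) - F (pt (i + 1) (a (i + 1)) (z, s))\<bar> \<le> line (i + 1) (z, s)"
        by (intro diff a yz)
      moreover have "\<bar>F (pt (i + 2) z (s, a (i + 1))) - F (pt (i + 2) (a (i + 2)) (s, a (i + 1)))\<bar> \<le> M"
        by (intro real_le order_trans[OF diff line2] a yz s)
      ultimately have "ennreal ?d \<le> A z"
        unfolding A_def by (intro tri[of "F (pt i s (a (i + 1), z))"]) (simp_all add: pt_shift1 pt_shift2 cen_def)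
      moreover have "ennreal ?d \<le> B y"
      proof -
        have "ennreal \<bar>F (pt (i + 2) z (s, y)) - F (pt (i + 2) (a (i + 2)) (s, y))\<bar> \<le> line (i + 2) (s, y)"
          by (intro diff a yz)
        moreover have "\<bar>F (pt (i + 1) y (a (i + 2), s)) - F (pt (i + 1) (a (i + 1)) (a (i + 2), s))\<bar> \<le> M"
          by (intro real_le order_trans[OF diff line1] a yz s)
        ultimately show ?thesis
          unfolding B_def by (intro tri[of "F (pt i s (y, a (i + 2)))"]) (simp_all add: pt_shift1 pt_shift2 cen_def)
      qed
      ultimately have "ennreal ?d * ennreal ?d \<le> B y * A z"
        by (intro mult_mono) auto
      then show ?thesis
        by (simp add: power2_eq_square flip: ennreal_mult abs_mult)
    qed
    have "face r i s (\<lambda>x. (F x - c)\<^sup>2)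
        = (\<integral>\<^sup>+y. \<integral>\<^sup>+z. ennreal ((F (pt i s (y, z)) - c)\<^sup>2) * indicator (square r) (y, z) \<partial>lborel \<partial>lborel)"
      unfolding face_def by (rule nn_integral_plane(1)) measurable
    also have "\<dots> \<le> (\<integral>\<^sup>+y. \<integral>\<^sup>+z. (B y * indicator {-r..r} y) * (A z * indicator {-r..r} z) \<partial>lborel \<partial>lborel)"
      using pw by (intro nn_integral_mono) (auto simp: indicator_def square_def)
    also have "\<dots> = (\<integral>\<^sup>+y. B y * indicator {-r..r} y \<partial>lborel) * (\<integral>\<^sup>+z. A z * indicator {-r..r} z \<partial>lborel)"
      by (simp add: nn_integral_cmult nn_integral_multc)
    also have "\<dots> \<le> ennreal (11 * I) * ennreal (11 * I)"
    proof (intro mult_mono)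
      have k: "(\<integral>\<^sup>+z. ennreal (5 * M) * indicator {-r..r} z \<partial>lborel) = ennreal (10 * I)"
        using r M by (simp add: nn_integral_cmult_indicator flip: ennreal_mult) (simp add: M_def)
      have "(\<integral>\<^sup>+y. B y * indicator {-r..r} y \<partial>lborel) = face r i s (\<lambda>x. \<bar>F' (i + 2) x\<bar>) + ennreal (10 * I)"
        unfolding B_def distrib_right by (subst nn_integral_add) (simp_all add: face2 k)
      also have "\<dots> \<le> ennreal I + ennreal (10 * I)"
        by (intro add_right_mono face_I s)
      finally show "(\<integral>\<^sup>+y. B y * indicator {-r..r} y \<partial>lborel) \<le> ennreal (11 * I)"
        using I by (simp flip: ennreal_plus)
      have "(\<integral>\<^sup>+z. A z * indicator {-r..r} z \<partial>lborel) = face r i s (\<lambda>x. \<bar>F' (i + 1) x\<bar>) + ennreal (10 * I)"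
        unfolding A_def distrib_right by (subst nn_integral_add) (simp_all add: face1 k)
      also have "\<dots> \<le> ennreal I + ennreal (10 * I)"
        by (intro add_right_mono face_I s)
      finally show "(\<integral>\<^sup>+z. A z * indicator {-r..r} z \<partial>lborel) \<le> ennreal (11 * I)"
        using I by (simp flip: ennreal_plus)
    qed auto
    also have "\<dots> = ennreal (121 * I\<^sup>2)"
      using I by (simp add: power2_eq_square mult_ac flip: ennreal_mult)
    finally show ?thesis .
  qed
  have "surf r (\<lambda>x. (F x - c)\<^sup>2) \<le> (\<Sum>i\<in>(UNIV :: 3 set). ennreal (121 * I\<^sup>2) + ennreal (121 * I\<^sup>2))"
    unfolding surf_def by (intro sum_mono add_mono face) auto
  also have "\<dots> = ennreal (726 * I\<^sup>2)"
    unfolding sum_cyclic3[of _ 1] by (simp flip: ennreal_plus)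
  finally show ?thesis
    by blast
qed

section \<open>The vanishing of the energy\<close>

lemma has_partial_add:
  assumes "has_partial i F F'" "has_partial i G G'"
  shows "has_partial i (\<lambda>x. F x + G x) (\<lambda>x. F' x + G' x)"
  using assms unfolding has_partial_def by (auto intro!: derivative_eq_intros)

lemma has_partial_cmult:
  assumes "has_partial i F F'"
  shows "has_partial i (\<lambda>x. c * F x) (\<lambda>x. c * F' x)"
  using assms unfolding has_partial_def by (auto intro!: derivative_eq_intros)

lemma has_partial_sum:
  assumes "\<And>k. k \<in> A \<Longrightarrow> has_partial i (F k) (F' k)"
  shows "has_partial i (\<lambda>x. \<Sum>k\<in>A. F k x) (\<lambda>x. \<Sum>k\<in>A. F' k x)"
  using assms unfolding has_partial_def by (auto intro!: DERIV_sum)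

text \<open>Young's inequality with exponents 6, 2 and 3, the third factor being 1. For
  \<open>t\<close> of order \<open>r\<close>, the term \<open>1 / t\<^sup>2\<close> integrates to a
  bounded amount over a surface of area of order \<open>r\<^sup>2\<close>.\<close>

lemma mult_le_young:
  fixes a b t :: real
  assumes "0 < t"
  shows "\<bar>a\<bar> * \<bar>b\<bar> \<le> t * b\<^sup>2 + t * a ^ 6 + 1 / t\<^sup>2"
proof -
  have "0 \<le> (\<bar>a\<bar> - t * \<bar>b\<bar>)\<^sup>2" by simp
  then have "2 * t * (\<bar>a\<bar> * \<bar>b\<bar>) \<le> a\<^sup>2 + t\<^sup>2 * b\<^sup>2"
    by (simp add: power2_diff power_mult_distrib mult_ac)
  then have "2 * (\<bar>a\<bar> * \<bar>b\<bar>) \<le> a\<^sup>2 / t + t * b\<^sup>2"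
    using assms by (simp add: field_simps power2_eq_square)
  moreover have "a\<^sup>2 / t \<le> t * a ^ 6 + 1 / t\<^sup>2"
  proof (cases "a\<^sup>2 \<le> 1 / t")
    case True
    then have "a\<^sup>2 / t \<le> 1 / t / t"
      using assms by (intro divide_right_mono) auto
    then show ?thesis
      using assms by (simp add: power2_eq_square add_increasing)
  next
    case False
    then have "(1 / t)\<^sup>2 \<le> (a\<^sup>2)\<^sup>2"
      using assms by (intro power_mono) auto
    then have "t * a\<^sup>2 * (1 / t)\<^sup>2 \<le> t * a\<^sup>2 * (a\<^sup>2)\<^sup>2"
      using assms by (intro mult_left_mono) auto
    also have "\<dots> = t * a ^ 6"
      by (simp add: mult.assoc flip: power_mult power_add)
    also have "t * a\<^sup>2 * (1 / t)\<^sup>2 = a\<^sup>2 / t"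
      using assms by (simp add: power2_eq_square)
    finally show ?thesis
      using assms by (simp add: add_increasing2)
  qed
  moreover have "0 \<le> \<bar>a\<bar> * \<bar>b\<bar>" "0 \<le> t * b\<^sup>2"
    using assms by auto
  ultimately show ?thesis
    by linarith
qed

text \<open>Young's inequality with exponents 6/5 and 6, the second factor being 1.\<close>

lemma le_young_6_5:
  fixes d t :: real
  assumes "0 \<le> d" "0 < t"
  shows "d \<le> t * d powr (6 / 5) + 1 / t ^ 5"
proof (cases "d \<le> 1 / t ^ 5")
  case True
  then show ?thesis
    using assms by (simp add: add_increasing)
next
  case False
  then have d: "0 < d"
    using assms by (auto simp: not_le intro: less_trans[rotated])
  have "1 \<le> t * d powr (1 / 5)"
  proof (rule ccontr)
    assume "\<not> ?thesis"
    then have "(t * d powr (1 / 5)) ^ 5 \<le> 1"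
      using assms by (intro power_le_one) auto
    also have "(t * d powr (1 / 5)) ^ 5 = t ^ 5 * d"
      using d by (simp add: power_mult_distrib powr_power)
    finally show False
      using False assms by (simp add: field_simps)
  qed
  then have "1 * d \<le> t * d powr (1 / 5) * d"
    using d by (intro mult_right_mono) auto
  also have "\<dots> = t * d powr (6 / 5)"
    using d powr_add[of d "1 / 5" 1] by simp
  finally show ?thesis
    using assms by (simp add: add_increasing2)
qed

text \<open>As \<open>l\<close> tends to 0, the derivative of \<open>bulk l\<close> tends to 1 away from 0 and \<open>bulk l\<close> remains
  quadratically small at 0.\<close>

definition bulk :: "real \<Rightarrow> real \<Rightarrow> real" where
  "bulk l s = s ^ 3 / (l\<^sup>2 + s\<^sup>2)"

definition bulk' :: "real \<Rightarrow> real \<Rightarrow> real" where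
  "bulk' l s = (s ^ 4 + 3 * l\<^sup>2 * s\<^sup>2) / (l\<^sup>2 + s\<^sup>2)\<^sup>2"

lemma bulk_denominator: "0 < l \<Longrightarrow> 0 < l\<^sup>2 + s\<^sup>2" for l s :: real
  by (simp add: add_pos_nonneg)

lemma DERIV_bulk:
  assumes "0 < l"
  shows "(bulk l has_real_derivative bulk' l s) (at s)"
proof -
  have "((\<lambda>s. s ^ 3 / (l\<^sup>2 + s\<^sup>2)) has_real_derivative ((3 * s\<^sup>2) * (l\<^sup>2 + s\<^sup>2) - s ^ 3 * (2 * s)) / ((l\<^sup>2 + s\<^sup>2) * (l\<^sup>2 + s\<^sup>2))) (at s)"
    using bulk_denominator[OF assms, of s] by (intro DERIV_divide) (auto intro!: derivative_eq_intros)
  also have "((3 * s\<^sup>2) * (l\<^sup>2 + s\<^sup>2) - s ^ 3 * (2 * s)) / ((l\<^sup>2 + s\<^sup>2) * (l\<^sup>2 + s\<^sup>2)) = bulk' l s"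
    unfolding bulk'_def power2_eq_square[of "l\<^sup>2 + s\<^sup>2"] by (rule arg_cong2[of _ _ _ _ "(/)"]) (simp_all add: algebra_simps eval_nat_numeral)
  finally show ?thesis
    by (simp add: bulk_def[abs_def])
qed

lemma continuous_bulk':
  assumes "0 < l"
  shows "continuous_on UNIV (bulk' l)"
  unfolding bulk'_def using assms by (intro continuous_intros) auto

lemma abs_mult_le_denominator: "0 < l \<Longrightarrow> l * \<bar>s\<bar> \<le> l\<^sup>2 + s\<^sup>2" for l s :: real
proof -
  assume l: "0 < l"
  have "0 \<le> (l - \<bar>s\<bar>)\<^sup>2 + l * \<bar>s\<bar>"
    using l by simp
  then show ?thesis
    by (simp add: power2_diff)
qed

lemma abs_bulk_le:
  assumes "0 < l"
  shows "\<bar>bulk l s\<bar> \<le> s\<^sup>2 / l"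
proof -
  have "s\<^sup>2 * (l * \<bar>s\<bar>) \<le> s\<^sup>2 * (l\<^sup>2 + s\<^sup>2)"
    using abs_mult_le_denominator[OF assms, of s] by (intro mult_left_mono) auto
  then show ?thesis
    using assms bulk_denominator[OF assms, of s]
    by (simp add: bulk_def abs_divide divide_simps power_abs eval_nat_numeral abs_mult mult_ac)
qed

text \<open>The difference equals \<open>l\<^sup>2 * s / (l\<^sup>2 + s\<^sup>2)\<close>, and the
  denominator is at least \<open>l * \<bar>s\<bar>\<close>.\<close>

lemma abs_minus_bulk_le:
  assumes "0 < l"
  shows "\<bar>s - bulk l s\<bar> \<le> l"
proof -
  have "s - bulk l s = (s * (l\<^sup>2 + s\<^sup>2) - s ^ 3) / (l\<^sup>2 + s\<^sup>2)"
    using bulk_denominator[OF assms, of s] by (simp add: bulk_def diff_divide_distrib)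
  also have "s * (l\<^sup>2 + s\<^sup>2) - s ^ 3 = l\<^sup>2 * s"
    by (simp add: algebra_simps eval_nat_numeral)
  finally have "s - bulk l s = l\<^sup>2 * s / (l\<^sup>2 + s\<^sup>2)" .
  moreover have "l * (l * \<bar>s\<bar>) \<le> l * (l\<^sup>2 + s\<^sup>2)"
    using abs_mult_le_denominator[OF assms, of s] assms by (intro mult_left_mono) auto
  ultimately show ?thesis
    using bulk_denominator[OF assms, of s]
    by (simp add: abs_divide abs_mult divide_le_eq power2_eq_square mult_ac)
qed

lemma bulk'_0: "bulk' l 0 = 0"
  by (simp add: bulk'_def)

lemma abs_1_minus_bulk'_le:
  assumes "0 < l"
  shows "\<bar>1 - bulk' l s\<bar> \<le> l\<^sup>2 / (l\<^sup>2 + s\<^sup>2)"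
proof -
  let ?d = "l\<^sup>2 + s\<^sup>2"
  have d: "0 < ?d" using bulk_denominator[OF assms] .
  have "1 - bulk' l s = (?d\<^sup>2 - (s ^ 4 + 3 * l\<^sup>2 * s\<^sup>2)) / ?d\<^sup>2"
    using d less_imp_neq[OF assms] by (simp add: bulk'_def diff_divide_distrib)
  also have "?d\<^sup>2 - (s ^ 4 + 3 * l\<^sup>2 * s\<^sup>2) = l\<^sup>2 * (l\<^sup>2 - s\<^sup>2)"
    by (simp add: power2_eq_square eval_nat_numeral algebra_simps)
  finally have "\<bar>1 - bulk' l s\<bar> = l\<^sup>2 * \<bar>l\<^sup>2 - s\<^sup>2\<bar> / ?d\<^sup>2"
    by (simp add: abs_mult abs_divide)
  also have "\<dots> \<le> l\<^sup>2 * ?d / ?d\<^sup>2"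
    by (intro divide_right_mono mult_left_mono) (auto simp: abs_le_iff)
  also have "\<dots> = l\<^sup>2 / ?d"
    using d by (simp add: power2_eq_square)
  finally show ?thesis .
qed

lemma abs_1_minus_bulk'_le_1:
  assumes "0 < l"
  shows "\<bar>1 - bulk' l s\<bar> \<le> 1"
proof (rule order_trans[OF abs_1_minus_bulk'_le[OF assms]])
  show "l\<^sup>2 / (l\<^sup>2 + s\<^sup>2) \<le> 1"
    unfolding divide_le_eq_1_pos[OF bulk_denominator[OF assms]] by simp
qed

text \<open>The argument may vary with \<open>n\<close>, because the constant subtracted from
  \<open>Q\<close> changes with the cube; it only has to stay away from 0.\<close>

lemma bulk'_tendsto_1:
  assumes l: "\<And>n. 0 < l n" "l \<longlonglongrightarrow> 0" and \<eta>: "0 < \<eta>" "\<forall>\<^sub>F n in sequentially. \<eta> \<le> \<bar>s n\<bar>"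
  shows "(\<lambda>n. bulk' (l n) (s n)) \<longlonglongrightarrow> 1"
proof -
  have "(\<lambda>n. 1 - bulk' (l n) (s n)) \<longlonglongrightarrow> 0"
  proof (rule Lim_null_comparison)
    show "\<forall>\<^sub>F n in sequentially. norm (1 - bulk' (l n) (s n)) \<le> (l n)\<^sup>2 / \<eta>\<^sup>2"
      using \<eta>(2)
    proof eventually_elim
      case (elim n)
      have "\<eta>\<^sup>2 \<le> \<bar>s n\<bar>\<^sup>2"
        using elim \<eta>(1) by (intro power_mono) auto
      then have "(l n)\<^sup>2 / ((l n)\<^sup>2 + (s n)\<^sup>2) \<le> (l n)\<^sup>2 / \<eta>\<^sup>2"
        using \<eta>(1) by (intro divide_left_mono mult_pos_pos bulk_denominator l) (auto simp: add_increasing)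
      then show ?case
        using abs_1_minus_bulk'_le[OF l(1), of n "s n"] by simp
    qed
    have "(\<lambda>n. (l n)\<^sup>2 / \<eta>\<^sup>2) \<longlonglongrightarrow> 0\<^sup>2 / \<eta>\<^sup>2"
      using \<eta>(1) by (intro tendsto_intros l) auto
    then show "(\<lambda>n. (l n)\<^sup>2 / \<eta>\<^sup>2) \<longlonglongrightarrow> 0" by simp
  qed
  from tendsto_diff[OF tendsto_const[of 1] this] show ?thesis by simp
qed

lemma abs_arctan_diff_le: "\<bar>arctan x - arctan y\<bar> \<le> \<bar>x - y\<bar>"
proof -
  have "norm (arctan x - arctan y) \<le> 1 * norm (x - y)"
  proof (rule field_differentiable_bound[of UNIV arctan "\<lambda>x. inverse (1 + x\<^sup>2)"])
    show "norm (inverse (1 + z\<^sup>2)) \<le> 1" for z :: real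
      by (simp add: inverse_le_1_iff)
  qed (auto intro: DERIV_arctan)
  then show ?thesis by simp
qed

lemma continuous_AE_zero:
  fixes G :: "'a::euclidean_space \<Rightarrow> real"
  assumes cont: "continuous_on UNIV G" and ae: "AE x in lborel. G x = 0"
  shows "G x = 0"
proof -
  have "open {x. G x \<noteq> 0}"
    by (intro open_Collect_neq cont continuous_intros)
  moreover have "{x. G x \<noteq> 0} \<in> null_sets lborel"
  proof -
    have "{x. G x \<noteq> 0} \<in> sets lborel"
      using \<open>open {x. G x \<noteq> 0}\<close> by simp
    then show ?thesis
      using ae AE_iff_null_sets[of "{x. G x \<noteq> 0}" lborel] by simp
  qed
  then have "negligible {x. G x \<noteq> 0}"
    by (simp add: negligible_iff_null_sets null_sets_completionI)
  ultimately have "{x. G x \<noteq> 0} = {}"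
    using open_not_negligible by blast
  then show ?thesis by auto
qed

text \<open>\<open>v' i j\<close> stands for \<open>\<partial>\<^sub>j v\<^sub>i\<close> and \<open>v'' i j\<close> for the pure second derivative \<open>\<partial>\<^sub>j \<partial>\<^sub>j v\<^sub>i\<close>.\<close>

locale navier_stokes_components =
  fixes v :: "3 \<Rightarrow> real ^ 3 \<Rightarrow> real" and v' v'' :: "3 \<Rightarrow> 3 \<Rightarrow> real ^ 3 \<Rightarrow> real"
    and p :: "real ^ 3 \<Rightarrow> real" and p' :: "3 \<Rightarrow> real ^ 3 \<Rightarrow> real"
  assumes part_v: "\<And>i j. has_partial j (v i) (v' i j)" "\<And>i j. has_partial j (v' i j) (v'' i j)"
    and part_p: "\<And>j. has_partial j p (p' j)"
    and cont_v: "\<And>i. continuous_on UNIV (v i)" "\<And>i j. continuous_on UNIV (v' i j)" "\<And>i j. continuous_on UNIV (v'' i j)"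
    and cont_p: "continuous_on UNIV p" "\<And>j. continuous_on UNIV (p' j)"
    and momentum: "\<And>i x. (\<Sum>j\<in>UNIV. v j x * v' i j x) = - p' i x + (\<Sum>j\<in>UNIV. v'' i j x)"
    and divergence_free: "\<And>x. (\<Sum>i\<in>UNIV. v' i i x) = 0"
    and lim_v: "\<And>i. (v i \<longlongrightarrow> 0) at_infinity"
    and fin_L: "\<And>i. (\<integral>\<^sup>+x. ennreal (\<bar>\<Sum>j\<in>UNIV. v'' i j x\<bar> powr (6 / 5)) \<partial>lborel) < \<infinity>"
begin

section \<open>Head pressure, finite energy and good radii\<close>

definition L :: "3 \<Rightarrow> real ^ 3 \<Rightarrow> real" where "L i x = (\<Sum>j\<in>UNIV. v'' i j x)"

definition Q :: "real ^ 3 \<Rightarrow> real" where "Q x = (\<Sum>i\<in>UNIV. (v i x)\<^sup>2 / 2) + p x"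

definition Q' :: "3 \<Rightarrow> real ^ 3 \<Rightarrow> real" where "Q' j x = (\<Sum>i\<in>UNIV. v i x * v' i j x) + p' j x"

definition f :: "real ^ 3 \<Rightarrow> real" where "f x = (\<Sum>i\<in>UNIV. v i x * L i x)"

definition G :: "real ^ 3 \<Rightarrow> real" where "G x = (\<Sum>i\<in>UNIV. \<Sum>j\<in>UNIV. (v' i j x)\<^sup>2)"

lemma cont_L: "continuous_on UNIV (L i)"
  unfolding L_def by (intro continuous_intros cont_v)

lemma cont_Q: "continuous_on UNIV Q"
  unfolding Q_def by (intro continuous_intros cont_v cont_p) simp

lemma cont_Q': "continuous_on UNIV (Q' j)"
  unfolding Q'_def by (intro continuous_intros cont_v cont_p)

lemma cont_f: "continuous_on UNIV f"
  unfolding f_def by (intro continuous_intros cont_v cont_L)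

lemma cont_G: "continuous_on UNIV G"
  unfolding G_def by (intro continuous_intros cont_v)

lemma measurables [measurable]: "v i \<in> borel_measurable borel" "v' i j \<in> borel_measurable borel"
  "L i \<in> borel_measurable borel" "Q \<in> borel_measurable borel" "Q' j \<in> borel_measurable borel"
  "f \<in> borel_measurable borel" "G \<in> borel_measurable borel"
  using cont_v cont_L cont_Q cont_Q' cont_f cont_G by (auto intro: borel_measurable_continuous_onI)

lemma part_Q: "has_partial j Q (Q' j)"
proof -
  have "has_partial j (\<lambda>x. (v i x)\<^sup>2 / 2) (\<lambda>x. v i x * v' i j x)" for i
    using has_partial_cmult[OF has_partial_power[OF part_v(1)[of j i], of 1], of "1 / 2"]
    by (simp add: power2_eq_square)
  then show ?thesis
    unfolding Q_def Q'_def by (intro has_partial_add has_partial_sum part_p)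
qed

text \<open>The momentum equation eliminates the pressure gradient, so the gradient of
  \<open>Q\<close> is estimated by the velocity and its Laplacian alone.\<close>

lemma Q'_eq: "Q' j x = L j x - (\<Sum>k\<in>UNIV. v k x * v' j k x) + (\<Sum>i\<in>UNIV. v i x * v' i j x)"
  using momentum[of x j] by (simp add: Q'_def L_def)

text \<open>The two quadratic terms in \<open>Q'_eq\<close>, multiplied by the velocity and summed,
  differ only in the order of summation and cancel.\<close>

lemma advection_Q: "(\<Sum>j\<in>UNIV. v j x * Q' j x) = f x"
proof -
  have "(\<Sum>j\<in>UNIV. v j x * Q' j x) = (\<Sum>j\<in>UNIV. v j x * L j x) - (\<Sum>j\<in>UNIV. \<Sum>k\<in>UNIV. v j x * (v k x * v' j k x))
      + (\<Sum>j\<in>UNIV. \<Sum>i\<in>UNIV. v j x * (v i x * v' i j x))"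
    by (simp add: Q'_eq distrib_left right_diff_distrib sum.distrib sum_subtractf sum_distrib_left)
  also have "(\<Sum>j\<in>UNIV. \<Sum>i\<in>UNIV. v j x * (v i x * v' i j x)) = (\<Sum>i\<in>UNIV. \<Sum>j\<in>UNIV. v j x * (v i x * v' i j x))"
    by (rule sum.swap)
  finally show ?thesis
    by (simp add: f_def mult_ac)
qed

text \<open>All integrable quantities are gathered in one density, so that a single radius is good
  for each of them.\<close>

definition energy :: "real ^ 3 \<Rightarrow> real" where
  "energy x = (\<Sum>i\<in>UNIV. v i x ^ 6) + G x + (\<Sum>i\<in>UNIV. \<bar>L i x\<bar> powr (6 / 5))"

lemma measurable_energy [measurable]: "energy \<in> borel_measurable borel"
  unfolding energy_def by measurable

lemma G_nonneg: "0 \<le> G x"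
  unfolding G_def by (intro sum_nonneg) auto

lemma energy_nonneg: "0 \<le> energy x"
  unfolding energy_def using G_nonneg by (intro add_nonneg_nonneg sum_nonneg) auto

lemma finite_energy: "(\<integral>\<^sup>+x. ennreal (energy x) \<partial>lborel) < \<infinity>"
proof -
  have L6: "(\<integral>\<^sup>+x. ennreal (v i x ^ 6) \<partial>lborel) < \<infinity>" for i
    by (rule integrable_L6[OF part_v cont_v lim_v fin_L])
  have L2: "(\<integral>\<^sup>+x. ennreal (\<Sum>j\<in>UNIV. (v' i j x)\<^sup>2) \<partial>lborel) < \<infinity>" for i
    by (rule integrable_gradient_L2[OF part_v cont_v L6 fin_L])
  have "(\<integral>\<^sup>+x. ennreal (energy x) \<partial>lborel) = (\<integral>\<^sup>+x. (\<Sum>i\<in>UNIV. ennreal (v i x ^ 6))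
      + (\<Sum>i\<in>UNIV. ennreal (\<Sum>j\<in>UNIV. (v' i j x)\<^sup>2)) + (\<Sum>i\<in>UNIV. ennreal (\<bar>L i x\<bar> powr (6 / 5))) \<partial>lborel)"
    unfolding energy_def G_def
    by (intro nn_integral_cong) (simp add: sum_nonneg)
  also have "\<dots> = (\<Sum>i\<in>UNIV. \<integral>\<^sup>+x. ennreal (v i x ^ 6) \<partial>lborel)
      + (\<Sum>i\<in>UNIV. \<integral>\<^sup>+x. ennreal (\<Sum>j\<in>UNIV. (v' i j x)\<^sup>2) \<partial>lborel)
      + (\<Sum>i\<in>UNIV. \<integral>\<^sup>+x. ennreal (\<bar>L i x\<bar> powr (6 / 5)) \<partial>lborel)"
    by (simp add: nn_integral_add nn_integral_sum del: sum_ennreal)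
  also have "\<dots> < \<infinity>"
    using L6 L2 fin_L by (simp add: L_def)
  finally show ?thesis .
qed

lemma integrable_energy: "integrable lborel energy"
  using finite_energy energy_nonneg by (intro integrableI_nonneg) auto

lemma integrable_G: "integrable lborel G"
proof (rule Bochner_Integration.integrable_bound[OF integrable_energy])
  show "AE x in lborel. norm (G x) \<le> norm (energy x)"
    using G_nonneg energy_nonneg by (intro AE_I2) (auto simp: energy_def intro!: add_nonneg_nonneg add_increasing add_increasing2 sum_nonneg)
qed simp

lemma abs_f_le: "\<bar>f x\<bar> \<le> energy x"
proof -
  have "\<bar>f x\<bar> \<le> (\<Sum>i\<in>UNIV. \<bar>v i x\<bar> * \<bar>L i x\<bar>)"
    unfolding f_def using sum_abs[of "\<lambda>i. v i x * L i x" UNIV] by (simp add: abs_mult)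
  also have "\<dots> \<le> (\<Sum>i\<in>UNIV. v i x ^ 6 + \<bar>L i x\<bar> powr (6 / 5))"
    using young_6_5[of "\<bar>v i x\<bar>" "\<bar>L i x\<bar>" 1 for i] by (intro sum_mono) simp
  also have "\<dots> \<le> energy x"
    using G_nonneg[of x] by (simp add: energy_def sum.distrib)
  finally show ?thesis .
qed

lemma integrable_f: "integrable lborel f"
proof (rule Bochner_Integration.integrable_bound[OF integrable_energy])
  show "AE x in lborel. norm (f x) \<le> norm (energy x)"
    using abs_f_le energy_nonneg by (intro AE_I2) auto
qed simp

text \<open>Dominates both integrands needed on a surface: the gradient of \<open>Q\<close> for the
  Poincare inequality, and the flux of the energy identity. The same radii therefore serve
  both.\<close>

definition W :: "real ^ 3 \<Rightarrow> real" where
  "W x = (\<Sum>j\<in>UNIV. \<bar>Q' j x\<bar>) + (\<Sum>i\<in>UNIV. \<Sum>j\<in>UNIV. \<bar>v i x\<bar> * \<bar>v' i j x\<bar>)"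

lemma W_le:
  assumes t: "1 \<le> t"
  shows "W x \<le> 9 * t * energy x + 30 / t\<^sup>2"
proof -
  define a where "a = (\<Sum>i\<in>UNIV. v i x ^ 6)"
  define b where "b = (\<Sum>i\<in>UNIV. \<bar>L i x\<bar> powr (6 / 5))"
  have ab: "0 \<le> a" "0 \<le> b" unfolding a_def b_def by (auto intro: sum_nonneg)
  have E: "energy x = a + G x + b"
    by (simp add: energy_def a_def b_def)
  have 1: "(\<Sum>i\<in>UNIV. \<Sum>j\<in>UNIV. \<bar>v i x\<bar> * \<bar>v' i j x\<bar>) \<le> t * G x + 3 * t * a + 9 / t\<^sup>2"
  proof -
    have "(\<Sum>i\<in>UNIV. \<Sum>j\<in>UNIV. \<bar>v i x\<bar> * \<bar>v' i j x\<bar>) \<le> (\<Sum>i\<in>UNIV. \<Sum>j\<in>(UNIV :: 3 set). t * (v' i j x)\<^sup>2 + t * v i x ^ 6 + 1 / t\<^sup>2)"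
      using t by (intro sum_mono mult_le_young) auto
    also have "\<dots> = t * G x + 3 * t * a + 9 / t\<^sup>2"
      by (simp add: sum.distrib G_def a_def sum_distrib_left mult_ac)
    finally show ?thesis .
  qed
  have 2: "(\<Sum>j\<in>UNIV. \<Sum>i\<in>UNIV. \<bar>v i x\<bar> * \<bar>v' j i x\<bar>) \<le> t * G x + 3 * t * a + 9 / t\<^sup>2"
  proof -
    have "(\<Sum>j\<in>UNIV. \<Sum>i\<in>UNIV. \<bar>v i x\<bar> * \<bar>v' j i x\<bar>) \<le> (\<Sum>j\<in>(UNIV :: 3 set). \<Sum>i\<in>UNIV. t * (v' j i x)\<^sup>2 + t * v i x ^ 6 + 1 / t\<^sup>2)"
      using t by (intro sum_mono mult_le_young) auto
    also have "\<dots> = t * G x + 3 * t * a + 9 / t\<^sup>2"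
      by (simp add: sum.distrib G_def a_def sum_distrib_left mult_ac)
    finally show ?thesis .
  qed
  have 3: "(\<Sum>j\<in>UNIV. \<bar>L j x\<bar>) \<le> t * b + 3 / t\<^sup>2"
  proof -
    have "(\<Sum>j\<in>UNIV. \<bar>L j x\<bar>) \<le> (\<Sum>j\<in>(UNIV :: 3 set). t * \<bar>L j x\<bar> powr (6 / 5) + 1 / t ^ 2)"
    proof (intro sum_mono)
      fix j :: 3
      have "1 / t ^ 5 \<le> 1 / t ^ 2"
        using t by (intro divide_left_mono power_increasing) auto
      then show "\<bar>L j x\<bar> \<le> t * \<bar>L j x\<bar> powr (6 / 5) + 1 / t ^ 2"
        using le_young_6_5[of "\<bar>L j x\<bar>" t] t by simp
    qed
    also have "\<dots> = t * b + 3 / t\<^sup>2"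
      by (simp add: sum.distrib b_def sum_distrib_left)
    finally show ?thesis .
  qed
  have "(\<Sum>j\<in>UNIV. \<bar>Q' j x\<bar>) \<le> (\<Sum>j\<in>UNIV. \<bar>L j x\<bar> + (\<Sum>i\<in>UNIV. \<bar>v i x\<bar> * \<bar>v' j i x\<bar>) + (\<Sum>i\<in>UNIV. \<bar>v i x\<bar> * \<bar>v' i j x\<bar>))"
  proof (intro sum_mono)
    fix j
    have "\<bar>\<Sum>k\<in>UNIV. v k x * v' j k x\<bar> \<le> (\<Sum>i\<in>UNIV. \<bar>v i x\<bar> * \<bar>v' j i x\<bar>)"
      "\<bar>\<Sum>i\<in>UNIV. v i x * v' i j x\<bar> \<le> (\<Sum>i\<in>UNIV. \<bar>v i x\<bar> * \<bar>v' i j x\<bar>)"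
      unfolding abs_mult[symmetric] by (rule sum_abs)+
    then show "\<bar>Q' j x\<bar> \<le> \<bar>L j x\<bar> + (\<Sum>i\<in>UNIV. \<bar>v i x\<bar> * \<bar>v' j i x\<bar>) + (\<Sum>i\<in>UNIV. \<bar>v i x\<bar> * \<bar>v' i j x\<bar>)"
      unfolding Q'_eq by linarith
  qed
  also have "\<dots> = (\<Sum>j\<in>UNIV. \<bar>L j x\<bar>) + (\<Sum>j\<in>UNIV. \<Sum>i\<in>UNIV. \<bar>v i x\<bar> * \<bar>v' j i x\<bar>)
      + (\<Sum>i\<in>UNIV. \<Sum>j\<in>UNIV. \<bar>v i x\<bar> * \<bar>v' i j x\<bar>)"
    unfolding sum.distrib by (subst (3) sum.swap) simp
  finally have 4: "(\<Sum>j\<in>UNIV. \<bar>Q' j x\<bar>) \<le> \<dots>" .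
  \<comment> \<open>The double sums count three times: both kinds occur in the bound for
    \<open>Q'\<close>, and the second occurs again in \<open>W\<close>. This gives the constant 30 =
    3 * 9 + 3.\<close>
  have "q + s2 \<le> y + 3 * z" if "q \<le> l + s1 + s2" "s2 \<le> z" "s1 \<le> z" "l \<le> y" for q l s1 s2 y z :: real
    using that by linarith
  from this[OF 4 1 2 3] have "W x \<le> t * b + 3 / t\<^sup>2 + 3 * (t * G x + 3 * t * a + 9 / t\<^sup>2)"
    unfolding W_def .
  also have "\<dots> = t * b + 3 * (t * G x) + 9 * (t * a) + 30 / t\<^sup>2"
    by (simp add: algebra_simps)
  also have "\<dots> \<le> 9 * (t * b) + 9 * (t * G x) + 9 * (t * a) + 30 / t\<^sup>2"
    using ab G_nonneg[of x] t by (intro add_mono mult_right_mono) auto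
  also have "\<dots> = 9 * t * energy x + 30 / t\<^sup>2"
    unfolding E by (simp add: algebra_simps)
  finally show ?thesis .
qed

text \<open>In \<open>W_le\<close> the weight is taken proportional to the radius,
  \<open>t = \<tau> * r\<close>. The energy part is then at most
  \<open>9 * \<tau> * \<epsilon> = \<delta> / 2\<close>, and the constant part, integrated over the
  area \<open>24 * r\<^sup>2\<close>, is \<open>720 / \<tau>\<^sup>2\<close>; both are free of
  \<open>r\<close>. First \<open>\<tau>\<close> is chosen large, then \<open>\<epsilon>\<close>
  small.\<close>

lemma ex_good_radius:
  assumes \<delta>: "0 < \<delta>"
  shows "\<exists>r>R. surf r W \<le> ennreal \<delta>"
proof -
  define \<tau> where "\<tau> = 1 + 1440 / \<delta>"
  have \<tau>: "1 \<le> \<tau>" "1440 / \<delta> \<le> \<tau>" using \<delta> by (auto simp: \<tau>_def)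
  define \<epsilon> where "\<epsilon> = \<delta> / (18 * \<tau>)"
  have \<epsilon>: "0 < \<epsilon>" using \<delta> \<tau> by (simp add: \<epsilon>_def)
  obtain r where r: "max R 1 < r" "surf r energy < ennreal (\<epsilon> / r)"
    using ex_radius_surf_small[OF measurable_energy finite_energy \<epsilon>] by blast
  have r1: "1 < r" "R < r" using r by auto
  have \<tau>r: "1 \<le> \<tau> * r"
    using \<tau> r1 mult_mono[of 1 \<tau> 1 r] by simp
  then have \<tau>r0: "0 < \<tau> * r"
    by linarith
  have "surf r W \<le> surf r (\<lambda>x. 9 * (\<tau> * r) * energy x + 30 / (\<tau> * r)\<^sup>2)"
    by (rule surf_mono) (rule W_le[OF \<tau>r])
  also have "\<dots> = surf r (\<lambda>x. 9 * (\<tau> * r) * energy x) + surf r (\<lambda>x. 30 / (\<tau> * r)\<^sup>2)"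
    by (rule surf_add) (use \<tau>r0 energy_nonneg in \<open>auto simp: less_imp_le\<close>)
  also have "surf r (\<lambda>x. 9 * (\<tau> * r) * energy x) = ennreal (9 * (\<tau> * r)) * surf r energy"
    by (rule surf_cmult) (use \<tau>r0 energy_nonneg in \<open>auto simp: less_imp_le\<close>)
  also have "surf r (\<lambda>x. 30 / (\<tau> * r)\<^sup>2) = ennreal (24 * r\<^sup>2 * (30 / (\<tau> * r)\<^sup>2))"
    by (rule surf_const) (use r1 in auto)
  also have "ennreal (9 * (\<tau> * r)) * surf r energy \<le> ennreal (9 * (\<tau> * r)) * ennreal (\<epsilon> / r)"
    using r(2) by (intro mult_left_mono) (auto intro: less_imp_le)
  also have "\<dots> = ennreal (\<delta> / 2)"
    using r1 \<tau> \<epsilon> \<tau>r0 \<delta> by (simp add: \<epsilon>_def flip: ennreal_mult)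
  also have "24 * r\<^sup>2 * (30 / (\<tau> * r)\<^sup>2) = 720 / \<tau>\<^sup>2"
    using r1 by (simp add: power_mult_distrib)
  also have "ennreal (720 / \<tau>\<^sup>2) \<le> ennreal (\<delta> / 2)"
  proof (rule ennreal_leI)
    have "1440 / \<delta> \<le> \<tau> * \<tau>"
      using \<tau> mult_mono[of 1 \<tau> "1440 / \<delta>" \<tau>] \<delta> by simp
    then show "720 / \<tau>\<^sup>2 \<le> \<delta> / 2"
      using \<delta> \<tau> by (simp add: power2_eq_square field_simps)
  qed
  finally have "surf r W \<le> ennreal (\<delta> / 2) + ennreal (\<delta> / 2)"
    by (simp add: add_left_mono add_right_mono)
  also have "\<dots> = ennreal \<delta>"
    using \<delta> by (simp flip: ennreal_plus)
  finally show ?thesis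
    using r1 by blast
qed

section \<open>Fluxes of functions of the head pressure\<close>

lemma ex_bound_v: "\<exists>V>0. \<forall>i x. \<bar>v i x\<bar> \<le> V"
proof -
  have "\<exists>V. \<forall>x. \<bar>v i x\<bar> \<le> V" for i
  proof -
    have "\<forall>\<^sub>F x in at_infinity. dist (v i x) 0 < 1"
      using lim_v by (rule tendstoD) simp
    then obtain b where b: "\<And>x. b \<le> norm x \<Longrightarrow> \<bar>v i x\<bar> < 1"
      unfolding eventually_at_infinity by auto
    have "compact (v i ` cball 0 b)"
      by (intro compact_continuous_image continuous_on_subset[OF cont_v(1)]) auto
    then obtain B where "\<forall>y\<in>v i ` cball 0 b. norm y \<le> B"
      using compact_imp_bounded bounded_iff by metis
    then have B: "\<bar>v i x\<bar> \<le> B" if "x \<in> cball 0 b" for x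
      using that by auto
    have "\<bar>v i x\<bar> \<le> max 1 B" for x
      using b[of x] B[of x] by (cases "b \<le> norm x") auto
    then show ?thesis by blast
  qed
  then obtain V where V: "\<And>i x. \<bar>v i x\<bar> \<le> V i"
    by metis
  have "\<bar>v i x\<bar> \<le> 1 + (\<Sum>i\<in>UNIV. \<bar>V i\<bar>)" for i x
    using V[of i x] member_le_sum[of i UNIV "\<lambda>i. \<bar>V i\<bar>"] by auto
  moreover have "0 < 1 + (\<Sum>i\<in>UNIV. \<bar>V i\<bar>)"
    by (simp add: add_pos_nonneg sum_nonneg)
  ultimately show ?thesis by blast
qed

text \<open>As the velocity is divergence-free, the divergence of \<open>\<phi> (Q)\<close> times
  the velocity is \<open>\<phi>' (Q)\<close> times the advection of \<open>Q\<close>, which is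
  \<open>f\<close>.\<close>

lemma flux_Q_bound:
  assumes \<phi>: "\<And>s. (\<phi> has_real_derivative \<phi>' s) (at s)" "continuous_on UNIV \<phi>'" and r: "0 \<le> r"
    and V: "\<And>i x. \<bar>v i x\<bar> \<le> V"
  shows "ennreal \<bar>\<integral>x. \<phi>' (Q x) * f x * indicator (cube r) x \<partial>lborel\<bar> \<le> surf r (\<lambda>x. \<bar>\<phi> (Q x)\<bar> * V)"
proof -
  have c\<phi>: "continuous_on UNIV \<phi>"
    by (rule DERIV_continuous_on) (rule DERIV_subset[OF \<phi>(1)], auto)
  have c1: "continuous_on UNIV (\<lambda>x. \<phi> (Q x))" "continuous_on UNIV (\<lambda>x. \<phi>' (Q x))"
    by (rule continuous_on_compose2[OF c\<phi> cont_Q], simp) (rule continuous_on_compose2[OF \<phi>(2) cont_Q], simp)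
  have "ennreal \<bar>\<integral>x. (\<Sum>j\<in>UNIV. \<phi>' (Q x) * Q' j x * v j x + \<phi> (Q x) * v' j j x) * indicator (cube r) x \<partial>lborel\<bar>
      \<le> surf r (\<lambda>x. \<bar>\<phi> (Q x)\<bar> * V)"
    by (rule divergence_bound[OF has_partial_mult[OF has_partial_chain[OF \<phi>(1) part_Q] part_v(1)]])
       (auto intro!: continuous_intros c1 cont_Q' cont_v r mult_left_mono V simp: abs_mult)
  also have "(\<lambda>x. (\<Sum>j\<in>UNIV. \<phi>' (Q x) * Q' j x * v j x + \<phi> (Q x) * v' j j x) * indicator (cube r) x)
      = (\<lambda>x. \<phi>' (Q x) * f x * indicator (cube r) x)"
  proof
    fix x
    have "(\<Sum>j\<in>UNIV. \<phi>' (Q x) * Q' j x * v j x + \<phi> (Q x) * v' j j x) = \<phi>' (Q x) * (\<Sum>j\<in>UNIV. v j x * Q' j x) + \<phi> (Q x) * (\<Sum>j\<in>UNIV. v' j j x)"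
      by (simp add: sum.distrib sum_distrib_left mult_ac)
    then show "(\<Sum>j\<in>UNIV. \<phi>' (Q x) * Q' j x * v j x + \<phi> (Q x) * v' j j x) * indicator (cube r) x = \<phi>' (Q x) * f x * indicator (cube r) x"
      by (simp add: advection_Q divergence_free)
  qed
  finally show ?thesis .
qed

text \<open>The function \<open>s - bulk l s\<close> is bounded by \<open>l\<close>, whereas its derivative tends to the indicator function
  of 0.\<close>

lemma integral_level_set_eq_0:
  assumes r: "0 \<le> r"
  shows "(\<integral>x. indicator {x. Q x = c} x * f x * indicator (cube r) x \<partial>lborel) = 0"
proof -
  obtain V where V: "0 < V" "\<And>i x. \<bar>v i x\<bar> \<le> V"
    using ex_bound_v by auto
  define l where "l n = 1 / real (Suc n)" for n
  have l: "0 < l n" for n by (simp add: l_def)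
  have l0: "l \<longlonglongrightarrow> 0" unfolding l_def by (rule LIMSEQ_Suc[OF lim_1_over_n])
  let ?h = "\<lambda>n x. (1 - bulk' (l n) (Q x - c)) * f x * indicator (cube r) x"
  have cb: "continuous_on UNIV (\<lambda>x. bulk' (l n) (Q x - c))" for n
    by (rule continuous_on_compose2[OF continuous_bulk'[OF l]]) (auto intro!: continuous_intros cont_Q)
  have [measurable]: "(\<lambda>x. bulk' (l n) (Q x - c)) \<in> borel_measurable borel" for n
    using cb by (rule borel_measurable_continuous_onI)
  \<comment> \<open>The cube is fixed while \<open>l n\<close> tends to 0, so its area does no harm
    here, in contrast to the limit over growing cubes.\<close>
  have bound: "\<bar>\<integral>x. ?h n x \<partial>lborel\<bar> \<le> 24 * r\<^sup>2 * (l n * V)" for n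
  proof -
    have "((\<lambda>s. (s - c) - bulk (l n) (s - c)) has_real_derivative 1 - bulk' (l n) (s - c)) (at s)" for s
      by (auto intro!: derivative_eq_intros DERIV_chain2[OF DERIV_bulk[OF l]])
    moreover have "continuous_on UNIV (\<lambda>s. 1 - bulk' (l n) (s - c))"
      by (intro continuous_intros continuous_on_compose2[OF continuous_bulk'[OF l]]) auto
    ultimately have "ennreal \<bar>\<integral>x. ?h n x \<partial>lborel\<bar> \<le> surf r (\<lambda>x. \<bar>(Q x - c) - bulk (l n) (Q x - c)\<bar> * V)"
      by (rule flux_Q_bound) (use r V in auto)
    also have "\<dots> \<le> surf r (\<lambda>x. l n * V)"
      using V by (intro surf_mono mult_right_mono abs_minus_bulk_le l) auto
    also have "\<dots> = ennreal (24 * r\<^sup>2 * (l n * V))"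
      using r l[of n] V by (intro surf_const) (auto simp: less_imp_le)
    finally show ?thesis
      using r l[of n] V by (subst (asm) ennreal_le_iff) (auto simp: less_imp_le)
  qed
  have "(\<lambda>n. \<integral>x. ?h n x \<partial>lborel) \<longlonglongrightarrow> (\<integral>x. indicator {x. Q x = c} x * f x * indicator (cube r) x \<partial>lborel)"
  proof (rule integral_dominated_convergence[where w = "\<lambda>x. \<bar>f x\<bar>"])
    show "AE x in lborel. (\<lambda>n. ?h n x) \<longlonglongrightarrow> indicator {x. Q x = c} x * f x * indicator (cube r) x"
    proof (rule AE_I2)
      fix x
      have "(\<lambda>n. 1 - bulk' (l n) (Q x - c)) \<longlonglongrightarrow> indicator {x. Q x = c} x"
      proof (cases "Q x = c")
        case True
        then show ?thesis by (simp add: bulk'_0)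
      next
        case False
        have "(\<lambda>n. 1 - bulk' (l n) (Q x - c)) \<longlonglongrightarrow> 1 - 1"
          using False by (intro tendsto_diff tendsto_const bulk'_tendsto_1[OF l l0, of "\<bar>Q x - c\<bar>"]) auto
        then show ?thesis using False by simp
      qed
      then show "(\<lambda>n. ?h n x) \<longlonglongrightarrow> indicator {x. Q x = c} x * f x * indicator (cube r) x"
        by (intro tendsto_mult tendsto_const)
    qed
    show "AE x in lborel. norm (?h n x) \<le> \<bar>f x\<bar>" for n
    proof (rule AE_I2)
      fix x
      have "\<bar>1 - bulk' (l n) (Q x - c)\<bar> * \<bar>f x\<bar> \<le> 1 * \<bar>f x\<bar>"
        by (intro mult_right_mono abs_1_minus_bulk'_le_1 l) auto
      then show "norm (?h n x) \<le> \<bar>f x\<bar>"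
        by (auto simp: abs_mult indicator_def)
    qed
  qed (use integrable_f in auto)
  moreover have "(\<lambda>n. \<integral>x. ?h n x \<partial>lborel) \<longlonglongrightarrow> 0"
  proof (rule Lim_null_comparison)
    show "\<forall>\<^sub>F n in sequentially. norm (\<integral>x. ?h n x \<partial>lborel) \<le> 24 * r\<^sup>2 * (l n * V)"
      using bound by (intro always_eventually) auto
    have "(\<lambda>n. 24 * r\<^sup>2 * (l n * V)) \<longlonglongrightarrow> 24 * r\<^sup>2 * (0 * V)"
      by (intro tendsto_intros l0)
    then show "(\<lambda>n. 24 * r\<^sup>2 * (l n * V)) \<longlonglongrightarrow> 0" by simp
  qed
  ultimately show ?thesis
    by (rule LIMSEQ_unique)
qed

end

lemma indicator_cube_tendsto:
  assumes "\<And>n. real n \<le> r n"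
  shows "(\<lambda>n. indicator (cube (r n)) x :: real) \<longlonglongrightarrow> 1"
proof (rule tendsto_eventually)
  obtain N :: nat where N: "norm x \<le> real N"
    using real_arch_simple by blast
  have "x \<in> cube (r n)" if "N \<le> n" for n
    using that N assms[of n] not_in_cube[of x "r n"] by linarith
  then show "\<forall>\<^sub>F n in sequentially. indicator (cube (r n)) x = (1 :: real)"
    unfolding eventually_sequentially by (intro exI[of _ N]) auto
qed

lemma integral_cubes_tendsto:
  fixes g :: "real ^ 3 \<Rightarrow> real"
  assumes "integrable lborel g" "\<And>n. real n \<le> r n"
  shows "(\<lambda>n. \<integral>x. g x * indicator (cube (r n)) x \<partial>lborel) \<longlonglongrightarrow> (\<integral>x. g x \<partial>lborel)"
proof (rule integral_dominated_convergence[where w = "\<lambda>x. \<bar>g x\<bar>"])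
  have [measurable]: "g \<in> borel_measurable borel" using assms by auto
  show "(\<lambda>x. g x * indicator (cube (r n)) x) \<in> borel_measurable lborel" for n
    by measurable
  show "AE x in lborel. (\<lambda>n. g x * indicator (cube (r n)) x) \<longlonglongrightarrow> g x"
    using tendsto_mult[OF tendsto_const indicator_cube_tendsto[OF assms(2)]] by (intro AE_I2) simp
qed (use assms in \<open>auto simp: indicator_def\<close>)

context navier_stokes_components
begin

lemma good_radii:
  obtains r c where "\<And>n. real n < r n" "\<And>n. 0 < r n" "\<And>n. surf (r n) W \<le> ennreal (1 / real (Suc n))"
    "\<And>n. surf (r n) (\<lambda>x. (Q x - c n)\<^sup>2) \<le> ennreal (726 * (1 / real (Suc n))\<^sup>2)"
proof -
  have "\<exists>r>real n. surf r W \<le> ennreal (1 / real (Suc n))" for n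
    by (rule ex_good_radius) simp
  then obtain r where r: "\<And>n. real n < r n" "\<And>n. surf (r n) W \<le> ennreal (1 / real (Suc n))"
    by metis
  have r0: "0 < r n" for n
    using r(1)[of n] by (rule le_less_trans[rotated]) simp
  have "\<exists>c. surf (r n) (\<lambda>x. (Q x - c)\<^sup>2) \<le> ennreal (726 * (1 / real (Suc n))\<^sup>2)" for n
  proof (rule surface_poincare[OF part_Q cont_Q cont_Q' r0])
    have "surf (r n) (\<lambda>x. \<Sum>i\<in>UNIV. \<bar>Q' i x\<bar>) \<le> surf (r n) W"
      by (rule surf_mono) (auto simp: W_def intro!: sum_nonneg)
    then show "surf (r n) (\<lambda>x. \<Sum>i\<in>UNIV. \<bar>Q' i x\<bar>) \<le> ennreal (1 / real (Suc n))"
      using r(2) by (rule order_trans)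
  qed simp
  then obtain c where "\<And>n. surf (r n) (\<lambda>x. (Q x - c n)\<^sup>2) \<le> ennreal (726 * (1 / real (Suc n))\<^sup>2)"
    by metis
  with r r0 show ?thesis
    using that by blast
qed

text \<open>The constants \<open>c n\<close> may be unbounded, so a convergent subsequence is extracted from \<open>arctan (c n)\<close>.\<close>

lemma integral_f_eq_0: "(\<integral>x. f x \<partial>lborel) = 0"
proof -
  obtain V where V: "0 < V" "\<And>i x. \<bar>v i x\<bar> \<le> V"
    using ex_bound_v by auto
  obtain r0 c0 where r0: "\<And>n. real n < r0 n" "\<And>n. 0 < r0 n"
    and c0: "\<And>n. surf (r0 n) (\<lambda>x. (Q x - c0 n)\<^sup>2) \<le> ennreal (726 * (1 / real (Suc n))\<^sup>2)"
    using good_radii by metis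
  have "\<forall>n. arctan (c0 n) \<in> {-(pi/2)..pi/2}"
    using arctan_bounded by (auto intro: less_imp_le)
  then obtain a \<sigma> where \<sigma>: "strict_mono (\<sigma> :: nat \<Rightarrow> nat)" and a: "((\<lambda>n. arctan (c0 n)) \<circ> \<sigma>) \<longlonglongrightarrow> a"
    using seq_compactE[OF compact_Icc[unfolded compact_eq_seq_compact_metric]] by metis
  define r where "r n = r0 (\<sigma> n)" for n
  define c where "c n = c0 (\<sigma> n)" for n
  \<comment> \<open>The scale equals the bound for the surface integral of the gradient of
    \<open>Q\<close>. The flux of \<open>bulk\<close> is of order (L^2 bound) / \<open>l n\<close>,
    that is \<open>(l n)\<^sup>2 / l n\<close>, and still tends to 0.\<close>
  define l where "l n = 1 / real (Suc (\<sigma> n))" for n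
  have \<sigma>n: "n \<le> \<sigma> n" for n using \<sigma> by (rule seq_suble)
  have r: "real n \<le> r n" "0 \<le> r n" for n
    using r0(1)[of "\<sigma> n"] r0(2)[of "\<sigma> n"] \<sigma>n[of n] by (auto simp: r_def)
  have l: "0 < l n" for n by (simp add: l_def)
  have l0: "l \<longlonglongrightarrow> 0"
    using LIMSEQ_subseq_LIMSEQ[OF LIMSEQ_Suc[OF lim_1_over_n] \<sigma>] by (simp add: l_def[abs_def] o_def)
  \<comment> \<open>The points at which \<open>bulk' (l n) (Q x - c n)\<close> may fail to tend to
    1. If the constants converge, this is a level set of \<open>Q\<close>; if \<open>a\<close> is
    \<plusminus>\<open>pi/2\<close>, it is empty, since \<open>arctan\<close> does not attain these
    values.\<close>
  define E where "E = {x. arctan (Q x) = a}"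
  have [measurable]: "E \<in> sets borel"
    unfolding E_def by measurable
  let ?B = "\<lambda>n x. bulk' (l n) (Q x - c n)"
  have cB: "continuous_on UNIV (?B n)" for n
    by (rule continuous_on_compose2[OF continuous_bulk'[OF l]]) (auto intro!: continuous_intros cont_Q)
  have [measurable]: "?B n \<in> borel_measurable borel" for n
    using cB by (rule borel_measurable_continuous_onI)
  \<comment> \<open>On \<open>E\<close> the function \<open>Q\<close> is constant, so
    \<open>g (Q x)\<close> is a constant factor and the vanishing over level sets applies on every
    cube.\<close>
  have E0: "(\<integral>x. g (Q x) * (indicator E x * f x * indicator (cube R) x) \<partial>lborel) = 0" if "0 \<le> R" for R g
  proof (cases "E = {}")
    case False
    then obtain x0 where "x0 \<in> E" by blast
    then have E: "E = {x. Q x = Q x0}"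
      by (auto simp: E_def arctan_eq_iff)
    have "(\<lambda>x. g (Q x) * (indicator E x * f x * indicator (cube R) x)) = (\<lambda>x. g (Q x0) * (indicator E x * f x * indicator (cube R) x))"
      by (auto simp: E indicator_def)
    then have "(\<integral>x. g (Q x) * (indicator E x * f x * indicator (cube R) x) \<partial>lborel)
        = g (Q x0) * (\<integral>x. indicator E x * f x * indicator (cube R) x \<partial>lborel)"
      by simp
    then show ?thesis
      unfolding E by (simp add: integral_level_set_eq_0[OF that])
  qed simp
  have intE: "integrable lborel (\<lambda>x. indicator E x * f x)"
    by (rule Bochner_Integration.integrable_bound[OF integrable_f]) (auto simp: indicator_def)
  have "(\<lambda>n. \<integral>x. indicator E x * f x * indicator (cube (r n)) x \<partial>lborel) \<longlonglongrightarrow> (\<integral>x. indicator E x * f x \<partial>lborel)"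
    by (rule integral_cubes_tendsto[OF intE r(1)])
  moreover have "(\<integral>x. indicator E x * f x * indicator (cube (r n)) x \<partial>lborel) = 0" for n
    using E0[OF r(2), of "\<lambda>_. 1" n] by simp
  ultimately have int_E: "(\<integral>x. indicator E x * f x \<partial>lborel) = 0"
    by (simp add: LIMSEQ_const_iff)
  let ?h = "\<lambda>n x. ?B n x * (indicator (- E) x * f x) * indicator (cube (r n)) x"
  have B2: "\<bar>?B n x\<bar> \<le> 2" for n x
    using abs_1_minus_bulk'_le_1[OF l, of n "Q x - c n"] by linarith
  have "(\<lambda>n. \<integral>x. ?h n x \<partial>lborel) \<longlonglongrightarrow> (\<integral>x. 1 * (indicator (- E) x * f x) * 1 \<partial>lborel)"
  proof (rule integral_dominated_convergence[where w = "\<lambda>x. 2 * \<bar>f x\<bar>"])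
    show "AE x in lborel. (\<lambda>n. ?h n x) \<longlonglongrightarrow> 1 * (indicator (- E) x * f x) * 1"
    proof (rule AE_I2)
      fix x
      show "(\<lambda>n. ?h n x) \<longlonglongrightarrow> 1 * (indicator (- E) x * f x) * 1"
      proof (cases "x \<in> E")
        case False
        define \<eta> where "\<eta> = \<bar>arctan (Q x) - a\<bar> / 2"
        have \<eta>: "0 < \<eta>" using False by (simp add: \<eta>_def E_def)
        have "\<forall>\<^sub>F n in sequentially. dist (arctan (c n)) a < \<eta>"
          using a \<eta> by (auto simp: tendsto_iff c_def o_def)
        \<comment> \<open>Since \<open>arctan\<close> is 1-Lipschitz, separation of the arctangents
          separates \<open>Q x\<close> from \<open>c n\<close>, whether or not the constants stay
          bounded.\<close>
        then have "\<forall>\<^sub>F n in sequentially. \<eta> \<le> \<bar>Q x - c n\<bar>"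
        proof eventually_elim
          case (elim n)
          have "2 * \<eta> = \<bar>arctan (Q x) - a\<bar>" by (simp add: \<eta>_def)
          also have "\<dots> \<le> \<bar>arctan (Q x) - arctan (c n)\<bar> + \<bar>arctan (c n) - a\<bar>" by linarith
          also have "\<dots> \<le> \<bar>Q x - c n\<bar> + \<eta>"
            using elim abs_arctan_diff_le[of "Q x" "c n"] by (simp add: dist_real_def)
          finally show ?case by simp
        qed
        from bulk'_tendsto_1[OF l l0 \<eta> this] show ?thesis
          by (intro tendsto_mult tendsto_const indicator_cube_tendsto r)
      qed simp
    qed
    show "AE x in lborel. norm (?h n x) \<le> 2 * \<bar>f x\<bar>" for n
    proof (rule AE_I2)
      fix x
      have "\<bar>?B n x\<bar> * \<bar>f x\<bar> \<le> 2 * \<bar>f x\<bar>"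
        by (intro mult_right_mono B2) auto
      then show "norm (?h n x) \<le> 2 * \<bar>f x\<bar>"
        by (auto simp: abs_mult indicator_def)
    qed
  qed (use integrable_f in auto)
  moreover have "(\<lambda>n. \<integral>x. ?h n x \<partial>lborel) \<longlonglongrightarrow> 0"
  proof (rule Lim_null_comparison)
    show "\<forall>\<^sub>F n in sequentially. norm (\<integral>x. ?h n x \<partial>lborel) \<le> 726 * V * l n"
    proof (intro always_eventually allI)
      fix n
      have i1: "integrable lborel (\<lambda>x. ?B n x * f x * indicator (cube (r n)) x)"
        by (intro integrable_on_cube continuous_intros cB cont_f)
      have i2: "integrable lborel (\<lambda>x. ?B n x * (indicator E x * f x * indicator (cube (r n)) x))"
        by (rule Bochner_Integration.integrable_bound[OF i1]) (auto simp: indicator_def)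
      \<comment> \<open>The flux bound concerns the whole cube and cannot leave out
        \<open>E\<close>; the contribution of \<open>E\<close> is exactly 0 on each cube, so it may
        be put back.\<close>
      have "(\<integral>x. ?h n x \<partial>lborel) = (\<integral>x. ?B n x * f x * indicator (cube (r n)) x - ?B n x * (indicator E x * f x * indicator (cube (r n)) x) \<partial>lborel)"
        by (intro Bochner_Integration.integral_cong) (auto simp: indicator_def)
      also have "\<dots> = (\<integral>x. ?B n x * f x * indicator (cube (r n)) x \<partial>lborel)"
        using E0[OF r(2), of "\<lambda>q. bulk' (l n) (q - c n)" n] i1 i2 by simp
      finally have "ennreal (norm (\<integral>x. ?h n x \<partial>lborel)) = ennreal \<bar>\<integral>x. ?B n x * f x * indicator (cube (r n)) x \<partial>lborel\<bar>"
        by simp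
      also have "\<dots> \<le> surf (r n) (\<lambda>x. \<bar>bulk (l n) (Q x - c n)\<bar> * V)"
      proof (rule flux_Q_bound)
        show "((\<lambda>s. bulk (l n) (s - c n)) has_real_derivative bulk' (l n) (s - c n)) (at s)" for s
        proof -
          have "((\<lambda>s. s - c n) has_real_derivative 1) (at s)"
            by (auto intro!: derivative_eq_intros)
          from DERIV_chain2[OF DERIV_bulk[OF l[of n]] this] show ?thesis
            by simp
        qed
        show "continuous_on UNIV (\<lambda>s. bulk' (l n) (s - c n))"
          by (intro continuous_intros continuous_on_compose2[OF continuous_bulk'[OF l]]) auto
      qed (use r V in auto)
      also have "\<dots> \<le> surf (r n) (\<lambda>x. V / l n * (Q x - c n)\<^sup>2)"
      proof (rule surf_mono)
        fix x
        have "\<bar>bulk (l n) (Q x - c n)\<bar> * V \<le> (Q x - c n)\<^sup>2 / l n * V"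
          using V by (intro mult_right_mono abs_bulk_le l) auto
        then show "\<bar>bulk (l n) (Q x - c n)\<bar> * V \<le> V / l n * (Q x - c n)\<^sup>2"
          by (simp add: mult_ac)
      qed
      also have "\<dots> = ennreal (V / l n) * surf (r n) (\<lambda>x. (Q x - c n)\<^sup>2)"
        using V l[of n] by (intro surf_cmult) auto
      also have "\<dots> \<le> ennreal (V / l n) * ennreal (726 * (l n)\<^sup>2)"
        using c0[of "\<sigma> n"] by (intro mult_left_mono) (auto simp: r_def c_def l_def)
      also have "\<dots> = ennreal (726 * V * l n)"
        using V l[of n] by (simp add: power2_eq_square mult_ac flip: ennreal_mult)
      finally show "norm (\<integral>x. ?h n x \<partial>lborel) \<le> 726 * V * l n"
        using V l[of n] by (subst (asm) ennreal_le_iff) auto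
    qed
    have "(\<lambda>n. 726 * V * l n) \<longlonglongrightarrow> 726 * V * 0"
      by (intro tendsto_intros l0)
    then show "(\<lambda>n. 726 * V * l n) \<longlonglongrightarrow> 0" by simp
  qed
  ultimately have int_notE: "(\<integral>x. indicator (- E) x * f x \<partial>lborel) = 0"
    using LIMSEQ_unique by force
  have intE': "integrable lborel (\<lambda>x. indicator (- E) x * f x)"
    by (rule Bochner_Integration.integrable_bound[OF integrable_f]) (auto simp: indicator_def)
  have "(\<integral>x. f x \<partial>lborel) = (\<integral>x. indicator E x * f x + indicator (- E) x * f x \<partial>lborel)"
    by (intro Bochner_Integration.integral_cong) (auto simp: indicator_def)
  also have "\<dots> = 0"
    using intE intE' int_E int_notE by simp
  finally show ?thesis .
qed

text \<open>\<open>f + G\<close> is the divergence of half the gradient of the squared speed. Its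
  flux is dominated by \<open>W\<close> and vanishes along the good radii, and \<open>f\<close>
  integrates to 0; so the nonnegative continuous function \<open>G\<close> is identically 0.\<close>

lemma gradient_eq_0: "v' i j x = 0"
proof -
  obtain r where r: "\<And>n. real n < r n" "\<And>n. 0 < r n" and rW: "\<And>n. surf (r n) W \<le> ennreal (1 / real (Suc n))"
    using good_radii by metis
  have bound: "\<bar>\<integral>x. (f x + G x) * indicator (cube (r n)) x \<partial>lborel\<bar> \<le> 1 / real (Suc n)" for n
  proof -
    have "ennreal \<bar>\<integral>x. (\<Sum>j\<in>UNIV. \<Sum>i\<in>UNIV. v' i j x * v' i j x + v i x * v'' i j x) * indicator (cube (r n)) x \<partial>lborel\<bar> \<le> surf (r n) W"
    proof (rule divergence_bound)
      show "has_partial j (\<lambda>x. \<Sum>i\<in>UNIV. v i x * v' i j x) (\<lambda>x. \<Sum>i\<in>UNIV. v' i j x * v' i j x + v i x * v'' i j x)" for j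
        by (intro has_partial_sum has_partial_mult part_v)
      show "\<bar>\<Sum>i\<in>UNIV. v i x * v' i j x\<bar> \<le> W x" for j x
      proof -
        have "\<bar>\<Sum>i\<in>UNIV. v i x * v' i j x\<bar> \<le> (\<Sum>i\<in>UNIV. \<bar>v i x\<bar> * \<bar>v' i j x\<bar>)"
          unfolding abs_mult[symmetric] by (rule sum_abs)
        also have "\<dots> \<le> (\<Sum>i\<in>UNIV. \<Sum>j\<in>UNIV. \<bar>v i x\<bar> * \<bar>v' i j x\<bar>)"
          by (intro sum_mono member_le_sum) auto
        also have "\<dots> \<le> W x"
          unfolding W_def by (simp add: sum_nonneg)
        finally show ?thesis .
      qed
    qed (use r in \<open>auto intro!: continuous_intros cont_v less_imp_le\<close>)
    also have "(\<lambda>x. (\<Sum>j\<in>UNIV. \<Sum>i\<in>UNIV. v' i j x * v' i j x + v i x * v'' i j x) * indicator (cube (r n)) x)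
        = (\<lambda>x. (f x + G x) * indicator (cube (r n)) x)"
    proof
      fix x
      have "(\<Sum>j\<in>UNIV. \<Sum>i\<in>UNIV. v' i j x * v' i j x + v i x * v'' i j x) = (\<Sum>i\<in>UNIV. \<Sum>j\<in>UNIV. v' i j x * v' i j x + v i x * v'' i j x)"
        by (rule sum.swap)
      also have "\<dots> = f x + G x"
        by (simp add: f_def G_def L_def sum.distrib sum_distrib_left power2_eq_square)
      finally show "(\<Sum>j\<in>UNIV. \<Sum>i\<in>UNIV. v' i j x * v' i j x + v i x * v'' i j x) * indicator (cube (r n)) x
        = (f x + G x) * indicator (cube (r n)) x" by simp
    qed
    finally have "ennreal \<bar>\<integral>x. (f x + G x) * indicator (cube (r n)) x \<partial>lborel\<bar> \<le> ennreal (1 / real (Suc n))"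
      using rW by (rule order_trans)
    then show ?thesis
      by (subst (asm) ennreal_le_iff) auto
  qed
  have "(\<lambda>n. \<integral>x. (f x + G x) * indicator (cube (r n)) x \<partial>lborel) \<longlonglongrightarrow> 0"
    by (rule Lim_null_comparison[OF _ LIMSEQ_Suc[OF lim_1_over_n]]) (use bound in \<open>auto intro!: always_eventually\<close>)
  moreover have "(\<lambda>n. \<integral>x. (f x + G x) * indicator (cube (r n)) x \<partial>lborel) \<longlonglongrightarrow> (\<integral>x. f x + G x \<partial>lborel)"
    using r by (intro integral_cubes_tendsto Bochner_Integration.integrable_add integrable_f integrable_G) (auto intro: less_imp_le)
  ultimately have "(\<integral>x. f x + G x \<partial>lborel) = 0"
    using LIMSEQ_unique by blast
  then have "(\<integral>x. G x \<partial>lborel) = 0"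
    using integrable_f integrable_G integral_f_eq_0 by simp
  then have "AE x in lborel. G x = 0"
    using integral_nonneg_eq_0_iff_AE[OF integrable_G] G_nonneg by simp
  then have "G x = 0"
    by (rule continuous_AE_zero[OF cont_G])
  then have "(\<Sum>j\<in>UNIV. (v' i j x)\<^sup>2) = 0"
    unfolding G_def by (subst (asm) sum_nonneg_eq_0_iff) (auto intro: sum_nonneg)
  then show ?thesis
    by (subst (asm) sum_nonneg_eq_0_iff) auto
qed

text \<open>A line in direction 1 already leaves every ball, so constancy along it and decay at
  infinity are contradictory unless the value is 0.\<close>

lemma velocity_eq_0: "v i x = 0"
proof (rule ccontr)
  assume "v i x \<noteq> 0"
  then have "\<forall>\<^sub>F y in at_infinity. dist (v i y) 0 < \<bar>v i x\<bar>"
    by (intro tendstoD[OF lim_v]) simp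
  then obtain b where b: "\<And>y. b \<le> norm y \<Longrightarrow> \<bar>v i y\<bar> < \<bar>v i x\<bar>"
    unfolding eventually_at_infinity by auto
  let ?g = "\<lambda>t. v i (pt 1 t (x $ (1 + 1), x $ (1 + 2)))"
  have "(?g has_real_derivative 0) (at t)" for t
    using has_partial_pt[OF part_v(1)[of 1 i]] by (simp only: gradient_eq_0)
  then have "?g (x $ 1) = ?g \<bar>b\<bar>"
    using DERIV_isconst_all[of ?g] by blast
  then have "v i x = ?g \<bar>b\<bar>"
    by (simp only: pt_coords)
  moreover have "b \<le> norm (pt 1 \<bar>b\<bar> (x $ (1 + 1), x $ (1 + 2)))"
    using component_le_norm_cart[of "pt 1 \<bar>b\<bar> (x $ (1 + 1), x $ (1 + 2))" 1] by (simp only: pt_nth)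
  ultimately show False
    using b by force
qed

end

section \<open>From smooth vector fields to scalar components\<close>

lemma frechet_partial:
  assumes "f differentiable (at x)"
  shows "((\<lambda>t. f (x + t *\<^sub>R axis i 1)) has_vector_derivative partial i f x) (at 0)"
proof -
  have "(f has_derivative frechet_derivative f (at x)) (at (x + 0 *\<^sub>R axis i 1))"
    using assms by (simp add: frechet_derivative_works)
  moreover have "((\<lambda>t. x + t *\<^sub>R axis i 1) has_derivative (\<lambda>t. t *\<^sub>R axis i 1)) (at 0)"
    by (auto intro!: derivative_eq_intros)
  ultimately have "((\<lambda>t. f (x + t *\<^sub>R axis i 1)) has_derivative (\<lambda>t. frechet_derivative f (at x) (t *\<^sub>R axis i 1))) (at 0)"
    using has_derivative_compose by blast
  moreover have "linear (frechet_derivative f (at x))"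
    using assms by (simp add: frechet_derivative_works has_derivative_linear)
  ultimately show ?thesis
    unfolding has_vector_derivative_def partial_def by (simp add: linear_cmul)
qed

lemma has_partial_partial:
  fixes f :: "real ^ 3 \<Rightarrow> real"
  assumes "\<And>x. f differentiable (at x)"
  shows "has_partial i f (partial i f)"
  unfolding has_partial_def has_real_derivative_iff_has_vector_derivative
  using frechet_partial[OF assms] by blast

lemma smoothD:
  assumes "smooth f"
  shows "f differentiable (at x)" "smooth (partial j f)" "continuous_on UNIV f"
proof -
  have "C_k (Suc k) f" for k
    using assms unfolding smooth_def by blast
  then show "f differentiable (at x)" "smooth (partial j f)"
    by (auto simp: smooth_def)
  show "continuous_on UNIV f"
    using assms unfolding smooth_def by (metis C_k.simps(1))
qed

text \<open>Taking a component is bounded and linear and so commutes with \<open>partial\<close>.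
  This passes from the smooth vector field of the hypothesis to the scalar functions of the
  estimates.\<close>

lemma C_k_component: "C_k k f \<Longrightarrow> C_k k (\<lambda>x. f x $ i)"
  for f :: "real ^ 'n \<Rightarrow> real ^ 'm"
proof (induction k arbitrary: f)
  case 0
  then show ?case by (auto intro!: continuous_intros)
next
  case (Suc k)
  have d: "((\<lambda>x. f x $ i) has_derivative (\<lambda>h. frechet_derivative f (at x) h $ i)) (at x)" for x
    using Suc.prems by (intro bounded_linear.has_derivative[OF bounded_linear_vec_nth]) (simp add: frechet_derivative_works)
  then have "partial j (\<lambda>x. f x $ i) = (\<lambda>x. partial j f x $ i)" for j
    by (auto simp: partial_def frechet_derivative_at[OF d, symmetric])
  then show ?case
    using Suc d by (auto simp: differentiable_def)
qed

lemma smooth_component: "smooth f \<Longrightarrow> smooth (\<lambda>x. f x $ i)"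
  for f :: "real ^ 'n \<Rightarrow> real ^ 'm"
  unfolding smooth_def by (blast intro: C_k_component)

theorem theorem1p2:
  fixes v :: "real ^ 3 \<Rightarrow> real ^ 3" and p :: "real ^ 3 \<Rightarrow> real"
  assumes "smooth v" and "smooth p"
    and "steady_navier_stokes v p"
    and "(v \<longlongrightarrow> 0) at_infinity"
    and "(\<integral>\<^sup>+ x. ennreal (norm (vector_laplacian v x) powr (6 / 5)) \<partial>lborel) < \<infinity>"
  shows "\<forall>x. v x = 0"
proof -
  define u where "u i x = v x $ i" for i x
  have su: "smooth (u i)" for i
    unfolding u_def by (rule smooth_component[OF assms(1)])
  note su' = smoothD(2)[OF su] and su'' = smoothD(2)[OF smoothD(2)[OF su]]
  have L: "(\<Sum>j\<in>UNIV. partial j (partial j (u i)) x) = vector_laplacian v x $ i" for i x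
    by (simp add: vector_laplacian_def laplacian_def u_def[abs_def])
  interpret navier_stokes_components u "\<lambda>i j. partial j (u i)" "\<lambda>i j. partial j (partial j (u i))" p "\<lambda>j. partial j p"
  proof
    show "has_partial j (u i) (partial j (u i))" "has_partial j (partial j (u i)) (partial j (partial j (u i)))"
      "has_partial j p (partial j p)" for i j
      by (intro has_partial_partial smoothD(1) su su' assms(2))+
    show "continuous_on UNIV (u i)" "continuous_on UNIV (partial j (u i))" "continuous_on UNIV (partial j (partial j (u i)))"
      "continuous_on UNIV p" "continuous_on UNIV (partial j p)" for i j
      by (intro smoothD(3) su su' su'' smoothD(2) assms(2))+
    show "(\<Sum>j\<in>UNIV. u j x * partial j (u i) x) = - partial i p x + (\<Sum>j\<in>UNIV. partial j (partial j (u i)) x)" for i x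
    proof -
      have "convective v v x $ i = (- grad p x + vector_laplacian v x) $ i"
        using assms(3) by (simp add: steady_navier_stokes_def)
      then show ?thesis
        unfolding L by (simp add: convective_def grad_def u_def[abs_def])
    qed
    show "(\<Sum>i\<in>UNIV. partial i (u i) x) = 0" for x
      using assms(3) by (simp add: steady_navier_stokes_def divergence_def u_def[abs_def])
    show "(u i \<longlongrightarrow> 0) at_infinity" for i
      using tendsto_vec_nth[OF assms(4), of i] by (simp add: u_def[abs_def])
    show "(\<integral>\<^sup>+x. ennreal (\<bar>\<Sum>j\<in>UNIV. partial j (partial j (u i)) x\<bar> powr (6 / 5)) \<partial>lborel) < \<infinity>" for i
      unfolding L by (rule le_less_trans[OF nn_integral_mono assms(5)])
        (auto intro!: ennreal_leI powr_mono2 component_le_norm_cart)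
  qed
  show ?thesis
    using velocity_eq_0 by (simp add: u_def vec_eq_iff)
qed

end
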